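(* Let $I,J\subseteq\{1,\dots,N-1\}$ be disjoint with $i-1,i+1\notin J$ for every $i\in I$ and $j-1,j+1\notin I$ for every $j\in J$. Let $\eta^*$ be a composition with $\eta^*_i\ge\eta^*_{i+1}$ for all $i\in I$ and $\eta^*_j>\eta^*_{j+1}$ for all $j\in J$, and let $\eta^+$ be the partition obtained by sorting $\eta^*$. Then $$U^{(I,J)}_{\eta^*}(1^N)=\frac{\prod_s|\tilde I_s|!}{\mathcal M_{I,\eta^*}}\;\frac{e_{\eta^+}}{\alpha^{-|\delta|}\,e_{\delta^+}\,d_{\eta^{*(-,-)}}}\;\prod_{\vec\beta\in R_{J,+}}\big((\overline{\eta^*}_{\vec\beta}+1)/\alpha\big),$$ where $1^N$ denotes the point $z_1=\dots=z_N=1$.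
   Context: Fix $N\ge 1$ and a real parameter $\alpha>0$. A composition is $\eta=(\eta_1,\dots,\eta_N)$ with nonnegative integer entries; $|\eta|=\sum_j\eta_j$; $\eta^+$ is the partition obtained by sorting the entries of $\eta$ in weakly decreasing order. For compositions $\nu\ne\eta$ with $|\nu|=|\eta|$, write $\nu<\eta$ if $\sum_{j=1}^p\nu_j\le\sum_{j=1}^p\eta_j$ for all $p=1,\dots,N$; write $\nu\prec\eta$ if $\nu^+<\eta^+$, or if $\nu^+=\eta^+$ and $\nu<\eta$. Let $s_{jk}$ be the operator interchanging $z_j$ and $z_k$ in a function of $z=(z_1,\dots,z_N)$, and $s_j:=s_{j,j+1}$. The Cherednik operators are $$\xi_i=\alpha z_i\frac{\partial}{\partial z_i}+\sum_{p<i}\frac{z_i}{z_i-z_p}(1-s_{ip})+\sum_{p>i}\frac{z_p}{z_i-z_p}(1-s_{ip})+1-i ,\quad i=1,\dots,N.$$ The nonsymmetric Jack polynomial $E_\eta(z)=E_\eta(z;\alpha)$ is the unique polynomial of the form $z^\eta+\sum_{\nu\prec\eta}c_{\eta\nu}z^\nu$ with $\xi_iE_\eta=\bar\eta_iE_\eta$ for all $i$, where $\bar\eta_i:=\alpha\eta_i-\#\{k<i\mid\eta_k\ge\eta_i\}-\#\{k>i\mid\eta_k>\eta_i\}$ (so $\overline{\eta^*}_i$ is this quantity for $\eta^*$). For $K\subseteq\{1,\dots,N-1\}$, $W_K$ is the group generated by the transpositions $s_j$, $j\in K$, acting on compositions by $w(\lambda)=(\lambda_{w^{-1}(1)},\dots,\lambda_{w^{-1}(N)})$.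 Write $I=\bigcup_sI_s$, $J=\bigcup_sJ_s$ as unions of their maximal sets of consecutive integers, $\tilde I_s:=I_s\cup\{\max(I_s)+1\}$, $\tilde J_s:=J_s\cup\{\max(J_s)+1\}$, $\tilde J:=\bigcup_s\tilde J_s$. For $w\in W_{I\cup J}$, $\det_J(w)=+1$ or $-1$ according to whether an expression of $w$ as a product of the generators $s_k$, $k\in I\cup J$, has an even or odd number of factors from $\{s_j\mid j\in J\}$. The operator $\mathcal O_{I,J}$ is defined linearly by $\mathcal O_{I,J}(z^\lambda)=\sum_{w\in W_{I\cup J}}\det_J(w)\,z^{w(\lambda)}$. For $\eta^*$ as in the claim, the Jack polynomial with prescribed symmetry $S^{(I,J)}_{\eta^*}(z)$ is the scalar multiple of $\mathcal O_{I,J}E_{\eta^*}(z)$ normalized so that $S^{(I,J)}_{\eta^*}(z)=z^{\eta^*}+\sum_{\nu\prec\eta^*}\tilde c_{\nu}z^\nu$. It is antisymmetric under $s_j$, $j\in J$, hence factorizes as $$S^{(I,J)}_{\eta^*}(z)=\prod_s\Delta_{\tilde J_s}(z)\;U^{(I,J)}_{\eta^*}(z),\qquad \Delta_X(z):=\prod_{i<i',\ i,i'\in X}(z_i-z_{i'}),$$ which defines the polynomial $U^{(I,J)}_{\eta^*}$. Further notation. $\mathcal M_{I,\eta^*}:=\#\{\sigma\in W_I\mid\sigma(\eta^* )=\eta^*\}$. $\eta^{*(-,-)}$ is the element $\mu$ of $W_{I\cup J}(\eta^* )$ with $\mu_i\le\mu_{i+1}$ for all $i\in I$ and $\mu_j<\mu_{j+1}$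 for all $j\in J$. The composition $\delta$ is $\delta_j=\max(\tilde J_s)-j$ for $j\in\tilde J_s$ and $\delta_j=0$ for $j\notin\tilde J$. $R_{J,+}=\{\vec e_j-\vec e_k\mid1\le j<k\le N,\ j,k\in\tilde J_s\text{ for some }s\}$ ($\vec e_j$ the standard unit vectors), and $\overline{\eta^*}_{\vec\beta}:=\overline{\eta^*}_j-\overline{\eta^*}_k$ for $\vec\beta=\vec e_j-\vec e_k$. For a composition $\eta$, $$d_\eta=\prod_{(i,j)\in\eta}\big(\alpha(a(i,j)+1)+l(i,j)+1\big),$$ product over $1\le i\le N$, $1\le j\le\eta_i$, with $a(i,j)=\eta_i-j$ and $l(i,j)=\#\{k<i\mid j\le\eta_k+1\le\eta_i\}+\#\{k>i\mid j\le\eta_k\le\eta_i\}$. For a partition $\kappa$ of length at most $N$, $e_\kappa:=\alpha^{|\kappa|}[1+N/\alpha]^{(\alpha)}_\kappa$ with $[u]^{(\alpha)}_\kappa:=\prod_{j=1}^N\frac{\Gamma(u-\frac1\alpha(j-1)+\kappa_j)}{\Gamma(u-\frac1\alpha(j-1))}$. *)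

theory Defs
  imports
    "HOL-Analysis.Gamma_Function"
    "HOL-Library.Poly_Mapping"
    "HOL-Combinatorics.Transposition"
begin

text \<open>
  Compositions and exponent vectors are finitely supported maps on the positions
  \<open>1, \<dots>, N\<close>; a multivariate polynomial is a finitely supported map from exponent
  vectors to real coefficients. With these choices the product of the library on
  \<open>mpol\<close> is the usual (convolution) product of polynomials.
\<close>

type_synonym comp = "nat \<Rightarrow>\<^sub>0 nat"
type_synonym mpol = "(nat \<Rightarrow>\<^sub>0 nat) \<Rightarrow>\<^sub>0 real"

section \<open>Polynomials\<close>

definition monom :: "comp \<Rightarrow> mpol" where
  "monom \<kappa> = Poly_Mapping.single \<kappa> 1"

definition Const :: "real \<Rightarrow> mpol" where
  "Const c = Poly_Mapping.single 0 c"

definition Z :: "nat \<Rightarrow> mpol" where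
  "Z i = monom (Poly_Mapping.single i 1)"

definition eval :: "(nat \<Rightarrow> real) \<Rightarrow> mpol \<Rightarrow> real" where
  "eval x f = (\<Sum>\<kappa>\<in>Poly_Mapping.keys f. Poly_Mapping.lookup f \<kappa> *
     (\<Prod>i\<in>Poly_Mapping.keys \<kappa>. x i ^ Poly_Mapping.lookup \<kappa> i))"

definition partial_deriv :: "nat \<Rightarrow> mpol \<Rightarrow> mpol" where
  "partial_deriv i f = (\<Sum>\<kappa>\<in>Poly_Mapping.keys f.
     Const (Poly_Mapping.lookup f \<kappa> * real (Poly_Mapping.lookup \<kappa> i)) *
     monom (\<kappa> - Poly_Mapping.single i 1))"

text \<open>
  \<open>mpol\<close> is an integral domain, so the quotient by a nonzero divisor is unique
  whenever it exists. Below it is only used for divisible pairs.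
\<close>

definition exact_quotient :: "mpol \<Rightarrow> mpol \<Rightarrow> mpol" where
  "exact_quotient f g = (THE q. f = g * q)"

lemma exact_quotient_mult: "g \<noteq> 0 \<Longrightarrow> exact_quotient (g * q) g = q"
  unfolding exact_quotient_def by (rule the_equality) auto

section \<open>Compositions and their orderings\<close>

definition composition :: "nat \<Rightarrow> comp \<Rightarrow> bool" where
  "composition N \<eta> \<longleftrightarrow> Poly_Mapping.keys \<eta> \<subseteq> {1..N}"

definition weight :: "nat \<Rightarrow> comp \<Rightarrow> nat" where
  "weight N \<eta> = (\<Sum>j=1..N. Poly_Mapping.lookup \<eta> j)"

text \<open>The partition \<open>\<eta>\<^sup>+\<close>; lists are indexed from 0, positions from 1.\<close>

definition sort_comp :: "nat \<Rightarrow> comp \<Rightarrow> comp" where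
  "sort_comp N \<eta> = (\<Sum>j=1..N. Poly_Mapping.single j
     (rev (sort (map (Poly_Mapping.lookup \<eta>) [1..<Suc N])) ! (j - 1)))"

definition dom_less :: "nat \<Rightarrow> comp \<Rightarrow> comp \<Rightarrow> bool" where
  "dom_less N \<nu> \<eta> \<longleftrightarrow> \<nu> \<noteq> \<eta> \<and> weight N \<nu> = weight N \<eta> \<and>
     (\<forall>p\<in>{1..N}. (\<Sum>j=1..p. Poly_Mapping.lookup \<nu> j) \<le> (\<Sum>j=1..p. Poly_Mapping.lookup \<eta> j))"

definition comp_prec :: "nat \<Rightarrow> comp \<Rightarrow> comp \<Rightarrow> bool" where
  "comp_prec N \<nu> \<eta> \<longleftrightarrow> composition N \<nu> \<and> composition N \<eta> \<and>
     \<nu> \<noteq> \<eta> \<and> weight N \<nu> = weight N \<eta> \<and>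
     (dom_less N (sort_comp N \<nu>) (sort_comp N \<eta>) \<or>
      sort_comp N \<nu> = sort_comp N \<eta> \<and> dom_less N \<nu> \<eta>)"

text \<open>Polynomials of the form \<open>z\<^sup>\<eta> + (\<Sum>\<nu> \<prec> \<eta>. c \<nu> z\<^sup>\<nu>)\<close>.\<close>

definition monic_triangular :: "nat \<Rightarrow> comp \<Rightarrow> mpol \<Rightarrow> bool" where
  "monic_triangular N \<eta> f \<longleftrightarrow> Poly_Mapping.lookup f \<eta> = 1 \<and>
     (\<forall>\<nu>\<in>Poly_Mapping.keys f. \<nu> = \<eta> \<or> comp_prec N \<nu> \<eta>)"

section \<open>Permutations\<close>

text \<open>\<open>(w \<kappa>)\<^sub>i = \<kappa>\<^sub>j\<close> where \<open>j\<close> is the preimage of \<open>i\<close> under \<open>w\<close>.\<close>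

definition act :: "(nat \<Rightarrow> nat) \<Rightarrow> comp \<Rightarrow> comp" where
  "act w \<kappa> = Poly_Mapping.map_key (inv w) \<kappa>"

definition swap_vars :: "nat \<Rightarrow> nat \<Rightarrow> mpol \<Rightarrow> mpol" where
  "swap_vars j k f = (\<Sum>\<kappa>\<in>Poly_Mapping.keys f.
     Const (Poly_Mapping.lookup f \<kappa>) * monom (act (Transposition.transpose j k) \<kappa>))"

definition word_perm :: "nat list \<Rightarrow> nat \<Rightarrow> nat" where
  "word_perm js = foldr (\<lambda>j w. Transposition.transpose j (j + 1) \<circ> w) js id"

text \<open>The generators are involutions, so the generated group consists of all words in them.\<close>

definition W :: "nat set \<Rightarrow> (nat \<Rightarrow> nat) set" where
  "W K = {word_perm js |js. set js \<subseteq> K}"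

text \<open>
  For \<open>I\<close> and \<open>J\<close> disjoint and without adjacent elements the sign below does not depend
  on the chosen word.
\<close>

definition det_J :: "nat set \<Rightarrow> nat set \<Rightarrow> (nat \<Rightarrow> nat) \<Rightarrow> real" where
  "det_J I J w = (THE e. \<exists>js. set js \<subseteq> I \<union> J \<and> w = word_perm js \<and>
     e = (if even (length (filter (\<lambda>j. j \<in> J) js)) then 1 else - 1))"

section \<open>Nonsymmetric Jack polynomials\<close>

definition cherednik :: "nat \<Rightarrow> real \<Rightarrow> nat \<Rightarrow> mpol \<Rightarrow> mpol" where
  "cherednik N \<alpha> i f =
     Const \<alpha> * Z i * partial_deriv i f
     + (\<Sum>p\<in>{1..<i}. Z i * exact_quotient (f - swap_vars i p f) (Z i - Z p))
     + (\<Sum>p\<in>{i<..N}. Z p * exact_quotient (f - swap_vars i p f) (Z i - Z p))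
     + Const (1 - real i) * f"

definition eta_bar :: "nat \<Rightarrow> real \<Rightarrow> comp \<Rightarrow> nat \<Rightarrow> real" where
  "eta_bar N \<alpha> \<eta> i = \<alpha> * real (Poly_Mapping.lookup \<eta> i)
     - real (card {k\<in>{1..<i}. Poly_Mapping.lookup \<eta> k \<ge> Poly_Mapping.lookup \<eta> i})
     - real (card {k\<in>{i<..N}. Poly_Mapping.lookup \<eta> k > Poly_Mapping.lookup \<eta> i})"

definition nonsym_jack :: "nat \<Rightarrow> real \<Rightarrow> comp \<Rightarrow> mpol" where
  "nonsym_jack N \<alpha> \<eta> = (THE E. monic_triangular N \<eta> E \<and>
     (\<forall>i\<in>{1..N}. cherednik N \<alpha> i E = Const (eta_bar N \<alpha> \<eta> i) * E))"

section \<open>Jack polynomials with prescribed symmetry\<close>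

text \<open>The maximal sets of consecutive integers contained in \<open>K\<close>, i.e. the sets \<open>I\<^sub>s\<close>, \<open>J\<^sub>s\<close>.\<close>

definition consecutive :: "nat set \<Rightarrow> bool" where
  "consecutive X \<longleftrightarrow> (\<exists>a b. a \<le> b \<and> X = {a..b})"

definition blocks :: "nat set \<Rightarrow> nat set set" where
  "blocks K = {X. consecutive X \<and> X \<subseteq> K \<and>
     (\<forall>Y. consecutive Y \<and> X \<subseteq> Y \<and> Y \<subseteq> K \<longrightarrow> Y = X)}"

definition tilde :: "nat set \<Rightarrow> nat set" where
  "tilde X = X \<union> {Max X + 1}"

definition sym_op :: "nat set \<Rightarrow> nat set \<Rightarrow> mpol \<Rightarrow> mpol" where
  "sym_op I J f = (\<Sum>\<kappa>\<in>Poly_Mapping.keys f. Const (Poly_Mapping.lookup f \<kappa>) *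
     (\<Sum>w\<in>W (I \<union> J). Const (det_J I J w) * monom (act w \<kappa>)))"

definition jack_S :: "nat \<Rightarrow> real \<Rightarrow> nat set \<Rightarrow> nat set \<Rightarrow> comp \<Rightarrow> mpol" where
  "jack_S N \<alpha> I J \<eta> = (THE S. (\<exists>c. S = Const c * sym_op I J (nonsym_jack N \<alpha> \<eta>)) \<and>
     monic_triangular N \<eta> S)"

definition vandermonde :: "nat set \<Rightarrow> mpol" where
  "vandermonde X = (\<Prod>(i, i')\<in>{(i, i'). i \<in> X \<and> i' \<in> X \<and> i < i'}. Z i - Z i')"

definition jack_U :: "nat \<Rightarrow> real \<Rightarrow> nat set \<Rightarrow> nat set \<Rightarrow> comp \<Rightarrow> mpol" where
  "jack_U N \<alpha> I J \<eta> =
     exact_quotient (jack_S N \<alpha> I J \<eta>) (\<Prod>X\<in>blocks J. vandermonde (tilde X))"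

section \<open>Quantities in the evaluation formula\<close>

definition stab_card :: "nat set \<Rightarrow> comp \<Rightarrow> nat" where
  "stab_card I \<eta> = card {\<sigma> \<in> W I. act \<sigma> \<eta> = \<eta>}"

definition minus_minus :: "nat set \<Rightarrow> nat set \<Rightarrow> comp \<Rightarrow> comp" where
  "minus_minus I J \<eta> = (THE \<mu>. (\<exists>w\<in>W (I \<union> J). \<mu> = act w \<eta>) \<and>
     (\<forall>i\<in>I. Poly_Mapping.lookup \<mu> i \<le> Poly_Mapping.lookup \<mu> (i + 1)) \<and>
     (\<forall>j\<in>J. Poly_Mapping.lookup \<mu> j < Poly_Mapping.lookup \<mu> (j + 1)))"

text \<open>The sets \<open>tilde X\<close> for \<open>X \<in> blocks J\<close> are pairwise disjoint.\<close>

definition delta :: "nat set \<Rightarrow> comp" where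
  "delta J = (\<Sum>X\<in>blocks J. \<Sum>j\<in>tilde X. Poly_Mapping.single j (Max (tilde X) - j))"

text \<open>The root \<open>e\<^sub>j - e\<^sub>k\<close> is represented by the pair \<open>(j, k)\<close>.\<close>

definition pos_roots :: "nat \<Rightarrow> nat set \<Rightarrow> (nat \<times> nat) set" where
  "pos_roots N J = {(j, k). 1 \<le> j \<and> j < k \<and> k \<le> N \<and> (\<exists>X\<in>blocks J. j \<in> tilde X \<and> k \<in> tilde X)}"

definition eta_bar_root :: "nat \<Rightarrow> real \<Rightarrow> comp \<Rightarrow> nat \<times> nat \<Rightarrow> real" where
  "eta_bar_root N \<alpha> \<eta> \<beta> = eta_bar N \<alpha> \<eta> (fst \<beta>) - eta_bar N \<alpha> \<eta> (snd \<beta>)"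

definition arm :: "comp \<Rightarrow> nat \<Rightarrow> nat \<Rightarrow> nat" where
  "arm \<eta> i j = Poly_Mapping.lookup \<eta> i - j"

definition leg :: "nat \<Rightarrow> comp \<Rightarrow> nat \<Rightarrow> nat \<Rightarrow> nat" where
  "leg N \<eta> i j =
     card {k\<in>{1..<i}. j \<le> Poly_Mapping.lookup \<eta> k + 1 \<and>
       Poly_Mapping.lookup \<eta> k + 1 \<le> Poly_Mapping.lookup \<eta> i}
     + card {k\<in>{i<..N}. j \<le> Poly_Mapping.lookup \<eta> k \<and>
       Poly_Mapping.lookup \<eta> k \<le> Poly_Mapping.lookup \<eta> i}"

definition d_comp :: "nat \<Rightarrow> real \<Rightarrow> comp \<Rightarrow> real" where
  "d_comp N \<alpha> \<eta> = (\<Prod>i=1..N. \<Prod>j=1..Poly_Mapping.lookup \<eta> i.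
     \<alpha> * (real (arm \<eta> i j) + 1) + real (leg N \<eta> i j) + 1)"

definition gen_pochhammer :: "nat \<Rightarrow> real \<Rightarrow> real \<Rightarrow> comp \<Rightarrow> real" where
  "gen_pochhammer N \<alpha> u \<kappa> = (\<Prod>j=1..N.
     Gamma (u - 1 / \<alpha> * (real j - 1) + real (Poly_Mapping.lookup \<kappa> j)) /
     Gamma (u - 1 / \<alpha> * (real j - 1)))"

definition e_part :: "nat \<Rightarrow> real \<Rightarrow> comp \<Rightarrow> real" where
  "e_part N \<alpha> \<kappa> = \<alpha> ^ weight N \<kappa> * gen_pochhammer N \<alpha> (1 + real N / \<alpha>) \<kappa>"

end

theory Submission
  imports Defs "HOL-Combinatorics.Permutations"
begin

text \<open>
  The Cherednik operators satisfy the relations of the degenerate affine Hecke algebra with the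
  adjacent transpositions and an affine raising operator \<open>\<Phi>\<close>, and they are triangular with
  distinct joint eigenvalues. Hence the \<open>E\<^sub>\<eta>\<close> can be built by induction from \<open>1\<close>, and the same induction
  gives \<open>E\<^sub>\<eta>(1) = e / d\<^sub>\<eta>\<close>.

  For the prescribed symmetry, apply \<open>P = \<Prod>(\<xi>\<^sub>j - \<xi>\<^sub>k + 1)\<close>, taken over the positive roots of \<open>J\<close>, to
  \<open>S = \<Delta> U\<close>. On the one hand each Cherednik operator lowers the order of vanishing at \<open>(1, \<dots>, 1)\<close> by at most
  one, so the value of \<open>P S\<close> there is \<open>U(1)\<close> times that of \<open>P \<Delta>\<close>. On the other hand \<open>P\<close> turns
  antisymmetry in \<open>J\<close> into symmetry, so \<open>P S\<close> is a multiple of the symmetrization of the \<open>E\<^sub>\<mu>\<close> with \<open>\<mu>\<close> the lowest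
  element of the orbit, whose value is known. The value of \<open>P \<Delta>\<close> follows from the case \<open>S = \<Delta>\<close>, that is, from
  \<open>\<eta>\<^sup>* = \<delta>\<close> and \<open>I = \<emptyset>\<close>.
\<close>

section \<open>Polynomials, permutations and divided differences\<close>

text \<open>For nonempty \<open>J\<close> the factor \<open>vdm J\<close> is zero at (1, ..., 1), so
  the value of \<open>jack_S\<close> there says nothing about U; P has one factor per positive root,
  which matches the order of vanishing of \<open>vdm J\<close>. On \<open>E \<mu>\<close> it acts by
  the scalar \<open>root_prod \<mu>\<close>. A simple reflection of \<open>J\<close> permutes all
  positive roots but its own, so \<open>root_prod\<close> changes by (1 - g) / (1 + g) with g the
  spectral gap. This is the quotient of the coefficient recursions of symmetric and antisymmetric
  combinations of the \<open>E \<mu>\<close>. Such combinations are determined by their coefficient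
  at \<open>E \<eta>\<close>, and comparing it fixes the constant; the stabilizer order enters as
  the coefficient of z^\<eta> in the symmetrization. Values at (1, ..., 1) can be followed because
  permuting variables preserves them: the raising operator keeps the value, and a swap step
  multiplies it by 1 + 1/h with h a hook length. For \<open>delta J\<close> the hook product of the
  lowest element equals \<open>root_prod\<close>, so only |W_J| e_\<delta> is left as the value of P
  applied to \<open>vdm J\<close>.\<close>

abbreviation "lookup \<equiv> Poly_Mapping.lookup"
abbreviation "keys \<equiv> Poly_Mapping.keys"
abbreviation "single \<equiv> Poly_Mapping.single"
abbreviation "tr \<equiv> Transposition.transpose"

lemma Const_0 [simp]: "Const 0 = 0" and Const_1 [simp]: "Const 1 = 1"
  and Const_add: "Const (a + b) = Const a + Const b"
  and Const_diff: "Const (a - b) = Const a - Const b"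
  and Const_minus: "Const (- a) = - Const a"
  and Const_mult: "Const (a * b) = Const a * Const b"
  by (simp_all add: Const_def single_add single_diff single_uminus mult_single)

lemma Const_of_nat: "Const (of_nat n) = of_nat n"
  by (simp add: Const_def)

lemma Const_mult_monom: "Const c * monom \<kappa> = single \<kappa> c"
  by (simp add: Const_def monom_def mult_single)

lemma lookup_monom: "lookup (monom \<kappa>) \<nu> = (if \<nu> = \<kappa> then 1 else 0)"
  by (auto simp: monom_def lookup_single when_def)

lemma keys_monom [simp]: "keys (monom \<kappa>) = {\<kappa>}"
  by (simp add: monom_def)

lemma monom_0 [simp]: "monom 0 = 1"
  by (simp add: monom_def)

lemma monom_add: "monom (\<kappa> + \<nu>) = monom \<kappa> * monom \<nu>"
  by (simp add: monom_def mult_single)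

lemma mpol_expand: "f = (\<Sum>\<kappa>\<in>keys f. Const (lookup f \<kappa>) * monom \<kappa>)"
proof (rule poly_mapping_eqI)
  fix k
  show "lookup f k = lookup (\<Sum>\<kappa>\<in>keys f. Const (lookup f \<kappa>) * monom \<kappa>) k"
    by (auto simp: lookup_sum Const_mult_monom lookup_single when_def in_keys_iff sum.delta)
qed

lemma mpol_induct [case_names zero add monom]:
  assumes "P 0" and "\<And>f g. P f \<Longrightarrow> P g \<Longrightarrow> P (f + g)" and "\<And>c \<kappa>. P (Const c * monom \<kappa>)"
  shows "P (f :: mpol)"
proof -
  have "P (\<Sum>\<kappa>\<in>A. Const (lookup f \<kappa>) * monom \<kappa>)" if "finite A" for A
    using that by induction (auto intro: assms)
  then show ?thesis
    by (subst mpol_expand) simp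
qed

lemma lookup_Const_mult: "lookup (Const c * f) \<kappa> = c * lookup f \<kappa>"
proof (induction f rule: mpol_induct)
  case (monom d \<nu>)
  have "Const c * (Const d * monom \<nu>) = Const (c * d) * monom \<nu>"
    by (simp add: Const_mult mult.assoc)
  then show ?case
    by (simp add: Const_mult_monom lookup_single when_def)
qed (simp_all add: lookup_add distrib_left)

lemma keys_Const_mult: "keys (Const c * f) \<subseteq> keys f"
  by (auto simp: in_keys_iff lookup_Const_mult)

text \<open>Linear extension of a map on exponents. Permutations of variables, Euler operators,
  substitutions and the symmetrizer are all of this form, so their linearity is settled
  once.\<close>

definition lin :: "(comp \<Rightarrow> mpol) \<Rightarrow> mpol \<Rightarrow> mpol" where
  "lin \<phi> f = (\<Sum>\<kappa>\<in>keys f. Const (lookup f \<kappa>) * \<phi> \<kappa>)"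

lemma lin_superset: "finite A \<Longrightarrow> keys f \<subseteq> A \<Longrightarrow> lin \<phi> f = (\<Sum>\<kappa>\<in>A. Const (lookup f \<kappa>) * \<phi> \<kappa>)"
  unfolding lin_def by (rule sum.mono_neutral_left) (auto simp: in_keys_iff)

lemma lin_add: "lin \<phi> (f + g) = lin \<phi> f + lin \<phi> g"
proof -
  have A: "finite (keys f \<union> keys g)" by simp
  show ?thesis
    using keys_add[of f g]
    by (simp add: lin_superset[OF A] lookup_add Const_add distrib_right sum.distrib)
qed

lemma lin_0 [simp]: "lin \<phi> 0 = 0"
  by (simp add: lin_def)

lemma lin_Const_mult: "lin \<phi> (Const c * f) = Const c * lin \<phi> f"
  by (subst lin_superset[of "keys f"])
     (simp_all add: keys_Const_mult lookup_Const_mult lin_def Const_mult sum_distrib_left mult.assoc)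

lemma lin_monom [simp]: "lin \<phi> (monom \<kappa>) = \<phi> \<kappa>"
  by (simp add: lin_def lookup_monom)

lemma lin_diff: "lin \<phi> (f - g) = lin \<phi> f - lin \<phi> g"
  using lin_add[of \<phi> "f - g" g] by simp

lemma lin_sum: "lin \<phi> (sum F A) = (\<Sum>a\<in>A. lin \<phi> (F a))"
  by (induction A rule: infinite_finite_induct) (auto simp: lin_add)

text \<open>A monoid homomorphism on exponents extends to a ring homomorphism; this serves both
  \<open>pact\<close> and the substitution \<open>subst_var\<close>.\<close>

lemma lin_mult:
  assumes "\<And>\<kappa> \<nu>. \<phi> (\<kappa> + \<nu>) = \<phi> \<kappa> * \<phi> \<nu>"
  shows "lin \<phi> (f * g) = lin \<phi> f * lin \<phi> g"
proof (induction f rule: mpol_induct)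
  case (monom c \<kappa>)
  show ?case
  proof (induction g rule: mpol_induct)
    case (monom d \<nu>)
    have "Const c * monom \<kappa> * (Const d * monom \<nu>) = Const (c * d) * monom (\<kappa> + \<nu>)"
      by (simp add: Const_mult monom_add algebra_simps)
    then have "lin \<phi> (Const c * monom \<kappa> * (Const d * monom \<nu>)) = Const (c * d) * (\<phi> \<kappa> * \<phi> \<nu>)"
      by (simp only: lin_Const_mult lin_monom assms)
    then show ?case
      by (simp only: lin_Const_mult lin_monom Const_mult mult_ac)
  qed (simp_all add: lin_add distrib_left)
qed (simp_all add: lin_add distrib_right)

lemma lookup_act: "bij w \<Longrightarrow> lookup (act w \<kappa>) i = lookup \<kappa> (inv w i)"
  unfolding act_def by (simp add: map_key.rep_eq bij_is_inj bij_imp_bij_inv)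

lemma act_add: "bij w \<Longrightarrow> act w (\<kappa> + \<nu>) = act w \<kappa> + act w \<nu>"
  by (rule poly_mapping_eqI) (simp add: lookup_act lookup_add)

lemma act_comp: "bij v \<Longrightarrow> bij w \<Longrightarrow> act (v \<circ> w) \<kappa> = act v (act w \<kappa>)"
  by (rule poly_mapping_eqI) (simp add: lookup_act bij_comp o_inv_distrib)

lemma act_id [simp]: "act id \<kappa> = \<kappa>" "act (\<lambda>x. x) \<kappa> = \<kappa>"
  using lookup_act[of id \<kappa>, OF bij_id] by (auto intro!: poly_mapping_eqI simp: id_def[symmetric] inv_id)

lemma act_inv_act: "bij w \<Longrightarrow> act (inv w) (act w \<kappa>) = \<kappa>"
  by (simp add: act_comp[symmetric] bij_imp_bij_inv inv_o_cancel bij_is_inj)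

lemma act_act_inv: "bij w \<Longrightarrow> act w (act (inv w) \<kappa>) = \<kappa>"
  using act_inv_act[of "inv w"] by (simp add: bij_imp_bij_inv inv_inv_eq)

lemma act_single: "bij w \<Longrightarrow> act w (single i c) = single (w i) c"
  by (rule poly_mapping_eqI)
     (auto simp: lookup_act lookup_single when_def bij_inv_eq_iff)

definition pact :: "(nat \<Rightarrow> nat) \<Rightarrow> mpol \<Rightarrow> mpol" where
  "pact w f = lin (\<lambda>\<kappa>. monom (act w \<kappa>)) f"

lemma pact_monom [simp]: "pact w (monom \<kappa>) = monom (act w \<kappa>)"
  and pact_add: "pact w (f + g) = pact w f + pact w g"
  and pact_diff: "pact w (f - g) = pact w f - pact w g"
  and pact_0 [simp]: "pact w 0 = 0"
  and pact_Const_mult: "pact w (Const c * f) = Const c * pact w f"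
  and pact_sum: "pact w (sum F A) = (\<Sum>a\<in>A. pact w (F a))"
  by (simp_all add: pact_def lin_add lin_diff lin_Const_mult lin_sum)

lemma pact_mult: "bij w \<Longrightarrow> pact w (f * g) = pact w f * pact w g"
  unfolding pact_def by (rule lin_mult) (simp add: act_add monom_add)

lemma act_0 [simp]: "bij w \<Longrightarrow> act w 0 = 0"
  by (rule poly_mapping_eqI) (simp add: lookup_act)

lemma pact_1 [simp]: "bij w \<Longrightarrow> pact w 1 = 1"
  using pact_monom[of w 0] by simp

lemma pact_Const [simp]: "bij w \<Longrightarrow> pact w (Const c) = Const c"
  using pact_Const_mult[of w c 1] by simp

lemma pact_Z [simp]: "bij w \<Longrightarrow> pact w (Z i) = Z (w i)"
  by (simp add: Z_def act_single)

lemma pact_comp: "bij v \<Longrightarrow> bij w \<Longrightarrow> pact (v \<circ> w) f = pact v (pact w f)"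
  by (induction f rule: mpol_induct)
     (simp_all add: pact_add pact_Const_mult act_comp)

lemma pact_id [simp]: "pact id f = f"
  by (induction f rule: mpol_induct) (simp_all add: pact_add pact_Const_mult)

lemma lookup_pact: "bij w \<Longrightarrow> lookup (pact w f) \<kappa> = lookup f (act (inv w) \<kappa>)"
proof (induction f rule: mpol_induct)
  case (monom c \<nu>)
  then have "\<kappa> = act w \<nu> \<longleftrightarrow> act (inv w) \<kappa> = \<nu>"
    using act_inv_act act_act_inv by metis
  with monom show ?case
    by (simp add: pact_Const_mult lookup_Const_mult lookup_monom)
qed (simp_all add: pact_add lookup_add)

lemma keys_pact: "bij w \<Longrightarrow> \<nu> \<in> keys (pact w f) \<Longrightarrow> \<exists>\<kappa>\<in>keys f. \<nu> = act w \<kappa>"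
  by (metis act_act_inv in_keys_iff lookup_pact)

lemma swap_vars_eq_pact: "swap_vars j k f = pact (tr j k) f"
  by (simp add: swap_vars_def pact_def lin_def)

lemma ev1_eq: "eval (\<lambda>_. 1) f = (\<Sum>\<kappa>\<in>keys f. lookup f \<kappa>)"
  by (simp add: eval_def)

definition ev1 :: "mpol \<Rightarrow> real" where
  "ev1 f = eval (\<lambda>_. 1) f"

lemma ev1_superset: "finite A \<Longrightarrow> keys f \<subseteq> A \<Longrightarrow> ev1 f = (\<Sum>\<kappa>\<in>A. lookup f \<kappa>)"
  unfolding ev1_def ev1_eq by (rule sum.mono_neutral_left) (auto simp: in_keys_iff)

lemma ev1_add: "ev1 (f + g) = ev1 f + ev1 g"
proof -
  have A: "finite (keys f \<union> keys g)" by simp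
  show ?thesis
    using keys_add[of f g] by (simp add: ev1_superset[OF A] lookup_add sum.distrib)
qed

lemma ev1_0 [simp]: "ev1 0 = 0"
  by (simp add: ev1_def ev1_eq)

lemma ev1_diff: "ev1 (f - g) = ev1 f - ev1 g"
  using ev1_add[of "f - g" g] by simp

lemma ev1_monom [simp]: "ev1 (monom \<kappa>) = 1"
  by (simp add: ev1_def ev1_eq lookup_monom)

lemma ev1_sum: "ev1 (sum F A) = (\<Sum>a\<in>A. ev1 (F a))"
  by (induction A rule: infinite_finite_induct) (auto simp: ev1_add)

lemma ev1_Const_mult: "ev1 (Const c * f) = c * ev1 f"
  by (subst ev1_superset[of "keys f"])
     (simp_all add: keys_Const_mult lookup_Const_mult ev1_def ev1_eq sum_distrib_left)

lemma ev1_1 [simp]: "ev1 1 = 1"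
  using ev1_monom[of 0] by simp

lemma ev1_Const [simp]: "ev1 (Const c) = c"
  using ev1_Const_mult[of c 1] by simp

lemma ev1_mult: "ev1 (f * g) = ev1 f * ev1 g"
proof (induction f rule: mpol_induct)
  case (monom c \<kappa>)
  show ?case
  proof (induction g rule: mpol_induct)
    case (monom d \<nu>)
    have "Const c * monom \<kappa> * (Const d * monom \<nu>) = Const (c * d) * monom (\<kappa> + \<nu>)"
      by (simp add: Const_mult monom_add algebra_simps)
    then show ?case
      by (simp add: ev1_Const_mult)
  qed (simp_all add: ev1_add distrib_left)
qed (simp_all add: ev1_add distrib_right)

lemma ev1_Z [simp]: "ev1 (Z i) = 1"
  by (simp add: Z_def)

lemma ev1_pact: "ev1 (pact w f) = ev1 f"
  by (induction f rule: mpol_induct) (simp_all add: pact_add ev1_add pact_Const_mult ev1_Const_mult)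

lemma comp_induct [case_names zero add]:
  assumes "P 0" and "\<And>\<kappa> i. P \<kappa> \<Longrightarrow> P (\<kappa> + single i 1)"
  shows "P (\<kappa> :: comp)"
proof (induction "\<Sum>i\<in>keys \<kappa>. lookup \<kappa> i" arbitrary: \<kappa> rule: less_induct)
  case less
  show ?case
  proof (cases "\<kappa> = 0")
    case False
    then obtain i where i: "i \<in> keys \<kappa>"
      by (meson keys_eq_empty ex_in_conv)
    define \<nu> where "\<nu> = \<kappa> - single i 1"
    have \<kappa>: "\<kappa> = \<nu> + single i 1"
      using i by (intro poly_mapping_eqI) (auto simp: \<nu>_def lookup_add lookup_minus lookup_single when_def in_keys_iff)
    have k: "keys \<nu> \<subseteq> keys \<kappa>"
      by (auto simp: in_keys_iff \<kappa> lookup_add)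
    have "(\<Sum>j\<in>keys \<nu>. lookup \<nu> j) = (\<Sum>j\<in>keys \<kappa>. lookup \<nu> j)"
      using k by (intro sum.mono_neutral_left) (auto simp: in_keys_iff)
    also have "\<dots> < (\<Sum>j\<in>keys \<kappa>. lookup \<kappa> j)"
      using i by (intro sum_strict_mono_ex1) (auto simp: \<nu>_def lookup_minus lookup_single when_def in_keys_iff intro!: bexI[of _ i])
    finally show ?thesis
      using less assms(2) \<kappa> by metis
  qed (use assms in auto)
qed

lemma monom_add_single: "monom (\<kappa> + single i 1) = Z i * monom \<kappa>"
  by (simp add: monom_add Z_def mult.commute)

lemma single_1_inj: "single i (1::nat) = single j 1 \<longleftrightarrow> i = j"
  by (metis lookup_single_eq lookup_single_not_eq zero_neq_one)

lemma Z_diff_nonzero: "i \<noteq> j \<Longrightarrow> Z i - Z j \<noteq> 0"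
  by (metis Z_def ev1_monom keys_monom right_minus_eq single_1_inj singleton_inject)

text \<open>The Euler operator z_i d/dz_i. It is diagonal on monomials and a derivation, which hides
  the truncated subtraction of exponents in \<open>partial_deriv\<close>.\<close>

definition eul :: "nat \<Rightarrow> mpol \<Rightarrow> mpol" where
  "eul i f = lin (\<lambda>\<kappa>. Const (real (lookup \<kappa> i)) * monom \<kappa>) f"

lemma partial_deriv_eq_lin:
  "partial_deriv i f = lin (\<lambda>\<kappa>. Const (real (lookup \<kappa> i)) * monom (\<kappa> - single i 1)) f"
  by (simp add: partial_deriv_def lin_def Const_mult mult.assoc)

lemma Z_mult_partial_deriv: "Z i * partial_deriv i f = eul i f"
proof (induction f rule: mpol_induct)
  case (monom c \<kappa>)
  have "Z i * (Const (real (lookup \<kappa> i)) * monom (\<kappa> - single i 1)) = Const (real (lookup \<kappa> i)) * monom \<kappa>"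
  proof (cases "lookup \<kappa> i = 0")
    case False
    then have "\<kappa> = (\<kappa> - single i 1) + single i 1"
      by (intro poly_mapping_eqI) (auto simp: lookup_add lookup_minus lookup_single when_def)
    then have "monom \<kappa> = Z i * monom (\<kappa> - single i 1)"
      by (metis monom_add_single)
    then show ?thesis by (simp add: algebra_simps)
  qed simp
  then show ?case
    by (simp add: eul_def partial_deriv_eq_lin lin_Const_mult mult.left_commute)
qed (simp_all add: eul_def partial_deriv_eq_lin lin_add distrib_left)

lemma eul_add: "eul i (f + g) = eul i f + eul i g"
  and eul_Const_mult: "eul i (Const c * f) = Const c * eul i f"
  and eul_monom [simp]: "eul i (monom \<kappa>) = Const (real (lookup \<kappa> i)) * monom \<kappa>"
  and eul_0 [simp]: "eul i 0 = 0"
  by (simp_all add: eul_def lin_add lin_Const_mult)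

lemma eul_mult: "eul i (f * g) = eul i f * g + f * eul i g"
proof (induction f rule: mpol_induct)
  case (monom c \<kappa>)
  show ?case
  proof (induction g rule: mpol_induct)
    case (monom d \<nu>)
    have "Const c * monom \<kappa> * (Const d * monom \<nu>) = Const (c * d) * monom (\<kappa> + \<nu>)"
      by (simp add: Const_mult monom_add algebra_simps)
    then have "eul i (Const c * monom \<kappa> * (Const d * monom \<nu>)) =
      Const (c * d) * (Const (real (lookup (\<kappa> + \<nu>) i)) * monom (\<kappa> + \<nu>))"
      by (simp only: eul_Const_mult eul_monom)
    then show ?case
      by (simp only: eul_Const_mult eul_monom lookup_add of_nat_add Const_add monom_add Const_mult algebra_simps)
  qed (simp_all add: eul_add distrib_left)
qed (simp_all add: eul_add distrib_right)

lemma pact_eul: "bij w \<Longrightarrow> pact w (eul i f) = eul (w i) (pact w f)"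
  by (induction f rule: mpol_induct)
     (simp_all add: pact_add eul_add pact_Const_mult eul_Const_mult lookup_act bij_is_inj inv_f_f)

section \<open>Divided differences\<close>

definition ddiff :: "nat \<Rightarrow> nat \<Rightarrow> mpol \<Rightarrow> mpol" where
  "ddiff i j f = exact_quotient (f - pact (tr i j) f) (Z i - Z j)"

text \<open>Peel off one variable at a time: z_l m - s(z_l m) = (z_l - s z_l) m + s(z_l) (m - s m),
  and z_l - s z_l is 0 or, up to sign, z_i - z_j. This justifies the exact quotient in
  \<open>ddiff\<close>.\<close>

lemma dvd_diff_swap: "Z i - Z j dvd f - pact (tr i j) f"
proof (induction f rule: mpol_induct)
  case (add f g)
  have "f + g - pact (tr i j) (f + g) =
    (f - pact (tr i j) f) + (g - pact (tr i j) g)"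
    by (simp add: pact_add)
  with add show ?case
    by (metis dvd_add)
next
  case (monom c \<kappa>)
  have "Z i - Z j dvd monom \<kappa> - pact (tr i j) (monom \<kappa>)"
  proof (induction \<kappa> rule: comp_induct)
    case zero
    show ?case by (simp del: pact_monom)
  next
    case (add \<kappa> l)
    have "monom (\<kappa> + single l 1) - pact (tr i j) (monom (\<kappa> + single l 1)) =
      (Z l - Z (tr i j l)) * monom \<kappa> +
      Z (tr i j l) * (monom \<kappa> - pact (tr i j) (monom \<kappa>))"
      by (simp add: monom_add_single pact_mult algebra_simps del: pact_monom One_nat_def)
    moreover have "Z i - Z j dvd Z l - Z (tr i j l)"
      using dvd_minus_iff[of "Z i - Z j" "Z i - Z j"] by (auto simp: Transposition.transpose_def)
    ultimately show ?case
      using add by (metis dvd_add dvd_mult dvd_mult2)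
  qed
  then show ?case
    by (metis dvd_mult pact_Const_mult right_diff_distrib)
qed simp

lemma ddiff_eq: "i \<noteq> j \<Longrightarrow> (Z i - Z j) * ddiff i j f = f - pact (tr i j) f"
  using dvd_diff_swap[of i j f] exact_quotient_mult[OF Z_diff_nonzero]
  by (metis ddiff_def dvdE)

lemma ddiff_unique: "i \<noteq> j \<Longrightarrow> (Z i - Z j) * g = f - pact (tr i j) f \<Longrightarrow> ddiff i j f = g"
  using ddiff_eq[of i j f] Z_diff_nonzero[of i j] by (metis mult_left_cancel)

lemma ddiff_add: "i \<noteq> j \<Longrightarrow> ddiff i j (f + g) = ddiff i j f + ddiff i j g"
  by (rule ddiff_unique) (simp_all add: distrib_left ddiff_eq pact_add)

lemma ddiff_Const_mult: "i \<noteq> j \<Longrightarrow> ddiff i j (Const c * f) = Const c * ddiff i j f"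
  by (rule ddiff_unique) (simp_all add: mult.left_commute[of _ "Const c"] ddiff_eq pact_Const_mult right_diff_distrib)

text \<open>Twisted Leibniz rule. It handles both multiplication by \<open>Z N\<close> in the
  raising operator and the loss of one order of vanishing.\<close>

lemma ddiff_mult: "i \<noteq> j \<Longrightarrow> ddiff i j (f * g) = ddiff i j f * g + pact (tr i j) f * ddiff i j g"
proof (rule ddiff_unique)
  assume ij: "i \<noteq> j"
  have "(Z i - Z j) * (ddiff i j f * g + pact (tr i j) f * ddiff i j g)
    = ((Z i - Z j) * ddiff i j f) * g + pact (tr i j) f * ((Z i - Z j) * ddiff i j g)"
    by (simp add: algebra_simps)
  also have "\<dots> = f * g - pact (tr i j) (f * g)"
    unfolding ddiff_eq[OF ij] by (simp add: pact_mult algebra_simps)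
  finally show "(Z i - Z j) * (ddiff i j f * g + pact (tr i j) f * ddiff i j g)
    = f * g - pact (tr i j) (f * g)" .
qed

lemma ddiff_0 [simp]: "i \<noteq> j \<Longrightarrow> ddiff i j 0 = 0"
  by (rule ddiff_unique) simp_all

lemma ddiff_Z: "i \<noteq> j \<Longrightarrow> ddiff i j (Z l) = (if l = i then 1 else if l = j then - 1 else 0)"
  by (rule ddiff_unique) (auto simp: Transposition.transpose_def)

lemma comp_tr: "inj w \<Longrightarrow> w \<circ> tr i j = tr (w i) (w j) \<circ> w"
  by (auto simp: fun_eq_iff Transposition.transpose_def inj_eq)

lemma pact_ddiff: "bij w \<Longrightarrow> i \<noteq> j \<Longrightarrow> pact w (ddiff i j f) = ddiff (w i) (w j) (pact w f)"
proof (rule sym, rule ddiff_unique)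
  assume w: "bij w" and ij: "i \<noteq> j"
  have "(Z (w i) - Z (w j)) * pact w (ddiff i j f) = pact w ((Z i - Z j) * ddiff i j f)"
    by (simp add: pact_mult pact_diff w)
  also have "\<dots> = pact w f - pact w (pact (tr i j) f)"
    by (simp add: ddiff_eq ij pact_diff)
  also have "pact w (pact (tr i j) f) = pact (tr (w i) (w j)) (pact w f)"
    using w comp_tr[OF bij_is_inj[OF w], of i j] by (simp flip: pact_comp)
  finally show "(Z (w i) - Z (w j)) * pact w (ddiff i j f) = pact w f - pact (tr (w i) (w j)) (pact w f)" .
qed (metis bij_pointE)

lemma cherednik_eq:
  "cherednik N \<alpha> i f = Const \<alpha> * eul i f
     + (\<Sum>p\<in>{1..<i}. Z i * ddiff i p f) + (\<Sum>p\<in>{i<..N}. Z p * ddiff i p f) + Const (1 - real i) * f"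
  by (simp add: cherednik_def ddiff_def swap_vars_eq_pact Z_mult_partial_deriv mult.assoc)

lemma cherednik_add: "cherednik N \<alpha> i (f + g) = cherednik N \<alpha> i f + cherednik N \<alpha> i g"
  by (simp add: cherednik_eq eul_add ddiff_add distrib_left sum.distrib)

lemma cherednik_Const_mult: "cherednik N \<alpha> i (Const c * f) = Const c * cherednik N \<alpha> i f"
  by (simp add: cherednik_eq eul_Const_mult ddiff_Const_mult distrib_left sum_distrib_left mult.left_commute)

lemma cherednik_0 [simp]: "cherednik N \<alpha> i 0 = 0"
  by (simp add: cherednik_eq)

lemma cherednik_diff: "cherednik N \<alpha> i (f - g) = cherednik N \<alpha> i f - cherednik N \<alpha> i g"
  using cherednik_add[of N \<alpha> i "f - g" g] by simp

lemma cherednik_sum: "cherednik N \<alpha> i (sum F A) = (\<Sum>a\<in>A. cherednik N \<alpha> i (F a))"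
  by (induction A rule: infinite_finite_induct) (auto simp: cherednik_add)

section \<open>Hecke relations and the dominance order\<close>

text \<open>The indices of the divided differences are relabelled by \<open>w\<close>, but the sums
  remain split at the old \<open>i\<close>. That mismatch is the source of the correction terms in
  the Hecke relations.\<close>

lemma pact_cherednik:
  assumes "bij w" "1 \<le> i"
  shows "pact w (cherednik N \<alpha> i f) = Const \<alpha> * eul (w i) (pact w f)
     + (\<Sum>p\<in>{1..<i}. Z (w i) * ddiff (w i) (w p) (pact w f))
     + (\<Sum>p\<in>{i<..N}. Z (w p) * ddiff (w i) (w p) (pact w f)) + Const (1 - real i) * pact w f"
  using assms by (simp add: cherednik_eq pact_add pact_mult pact_sum pact_eul pact_ddiff)

text \<open>The transposition maps each of the two index ranges of the operator to itself, so
  reindexing is enough.\<close>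

lemma swap_cherednik_other:
  assumes "1 \<le> j" "j \<noteq> i" "j \<noteq> Suc i" "1 \<le> i" "i < N"
  shows "pact (tr i (Suc i)) (cherednik N \<alpha> j f) = cherednik N \<alpha> j (pact (tr i (Suc i)) f)"
proof -
  have "bij_betw (tr i (Suc i)) {1..<j} {1..<j}" "bij_betw (tr i (Suc i)) {j<..N} {j<..N}"
    using assms by (auto intro!: bij_betw_transpose_iff)
  from sum.reindex_bij_betw[OF this(1), of "\<lambda>p. Z j * ddiff j p (pact (tr i (Suc i)) f)"]
    sum.reindex_bij_betw[OF this(2), of "\<lambda>p. Z p * ddiff j p (pact (tr i (Suc i)) f)"]
  show ?thesis
    using assms unfolding pact_cherednik[OF bij_transpose assms(1)] by (simp add: cherednik_eq)
qed

text \<open>Only the summand for the pair i, i + 1 changes range: it has prefactor z_i on one side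
  and z_{i+1} on the other. The difference (z_{i+1} - z_i) \<open>ddiff (Suc i) i g\<close> is g -
  f; the g is absorbed by the shift of the constant 1 - i, and f is the correction.\<close>

lemma swap_cherednik:
  assumes "1 \<le> i" "i < N"
  shows "pact (tr i (Suc i)) (cherednik N \<alpha> i f) = cherednik N \<alpha> (Suc i) (pact (tr i (Suc i)) f) + f"
proof -
  define g where "g = pact (tr i (Suc i)) f"
  have f: "f = pact (tr i (Suc i)) g"
    by (simp add: g_def flip: pact_comp)
  have A: "{i<..N} = insert (Suc i) {Suc i<..N}" "{1..<Suc i} = insert i {1..<i}"
    using assms by auto
  have sp: "(\<Sum>p\<in>{Suc i<..N}. Z (tr i (Suc i) p) * ddiff (Suc i) (tr i (Suc i) p) g)
     = (\<Sum>p\<in>{Suc i<..N}. Z p * ddiff (Suc i) p g)"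
    by (rule sum.cong) (auto simp: Transposition.transpose_def)
  have sq: "(\<Sum>p\<in>{1..<i}. Z (Suc i) * ddiff (Suc i) (tr i (Suc i) p) g)
     = (\<Sum>p\<in>{1..<i}. Z (Suc i) * ddiff (Suc i) p g)"
    by (rule sum.cong) (auto simp: Transposition.transpose_def)
  have "(Z (Suc i) - Z i) * ddiff (Suc i) i g = g - f"
    using ddiff_eq[of "Suc i" i g] f by (simp add: transpose_commute)
  then have key: "Z (Suc i) * ddiff (Suc i) i g = Z i * ddiff (Suc i) i g + g - f"
    by (simp add: algebra_simps)
  have "pact (tr i (Suc i)) (cherednik N \<alpha> i f) = Const \<alpha> * eul (Suc i) g
     + (\<Sum>p\<in>{1..<i}. Z (Suc i) * ddiff (Suc i) p g)
     + (Z i * ddiff (Suc i) i g + (\<Sum>p\<in>{Suc i<..N}. Z p * ddiff (Suc i) p g)) + Const (1 - real i) * g"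
    using assms by (simp add: pact_cherednik A sp sq flip: g_def)
  moreover have "cherednik N \<alpha> (Suc i) g = Const \<alpha> * eul (Suc i) g
     + (Z (Suc i) * ddiff (Suc i) i g + (\<Sum>p\<in>{1..<i}. Z (Suc i) * ddiff (Suc i) p g))
     + (\<Sum>p\<in>{Suc i<..N}. Z p * ddiff (Suc i) p g) + Const (1 - real (Suc i)) * g"
    using assms by (simp add: cherednik_eq A(2))
  moreover have "Const (1 - real i) = Const (1 - real (Suc i)) + 1"
    by (simp flip: Const_1 Const_add)
  ultimately show ?thesis
    unfolding g_def[symmetric] by (simp add: key algebra_simps)
qed

lemma cherednik_swap:
  assumes "1 \<le> i" "i < N"
  shows "cherednik N \<alpha> i (pact (tr i (Suc i)) f) = pact (tr i (Suc i)) (cherednik N \<alpha> (Suc i) f) + f"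
    and "cherednik N \<alpha> (Suc i) (pact (tr i (Suc i)) f) = pact (tr i (Suc i)) (cherednik N \<alpha> i f) - f"
proof -
  have "pact (tr i (Suc i)) (pact (tr i (Suc i)) h) = h" for h
    by (simp flip: pact_comp)
  then show "cherednik N \<alpha> i (pact (tr i (Suc i)) f) = pact (tr i (Suc i)) (cherednik N \<alpha> (Suc i) f) + f"
    using arg_cong[OF swap_cherednik[OF assms, of \<alpha> "pact (tr i (Suc i)) f"], of "pact (tr i (Suc i))"]
    by (simp add: pact_add)
qed (simp add: swap_cherednik[OF assms])

lemma sum_Suc_image: "(\<Sum>p\<in>Suc ` B. F p) = (\<Sum>p\<in>B. F (Suc p))"
  by (simp add: sum.reindex)

lemma eq_Suc_image:
  assumes "\<And>x. x \<in> A \<longleftrightarrow> 0 < x \<and> x - 1 \<in> B"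
  shows "A = Suc ` B"
proof (intro set_eqI iffI)
  fix x assume "x \<in> A"
  then have "x = Suc (x - 1)" "x - 1 \<in> B"
    by (simp_all add: assms)
  then show "x \<in> Suc ` B"
    by (rule image_eqI)
qed (auto simp: assms)

section \<open>The affine raising operator\<close>

definition cyc :: "nat \<Rightarrow> nat \<Rightarrow> nat" where
  "cyc N k = (if k = 0 \<or> k > N then k else if k = 1 then N else k - 1)"

lemma bij_cyc: "bij (cyc N)"
proof (rule o_bij)
  let ?d = "\<lambda>k. if k = 0 \<or> k > N then k else if k = N then 1 else k + 1"
  show "?d \<circ> cyc N = id" "cyc N \<circ> ?d = id"
    by (auto simp: cyc_def fun_eq_iff)
qed

text \<open>The Knop-Sahi raising operator f(z_1, ..., z_N) to z_N f(z_N, z_1, ...,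
  z_{N-1}).\<close>

definition Phi :: "nat \<Rightarrow> mpol \<Rightarrow> mpol" where
  "Phi N f = Z N * pact (cyc N) f"

lemma eul_Z: "eul i (Z j) = (if i = j then Z j else 0)"
  by (simp add: Z_def lookup_single when_def)

text \<open>The rotation turns index j + 1 into j and moves p = 1 from the lower range to p = N in
  the upper one. Multiplication by z_N affects only the divided difference at N, whose extra -g
  accounts for the shift of the constant term.\<close>

lemma cherednik_Phi:
  assumes "1 \<le> j" "j < N"
  shows "cherednik N \<alpha> j (Phi N f) = Phi N (cherednik N \<alpha> (Suc j) f)"
proof -
  define g where "g = pact (cyc N) f"
  have q: "ddiff j p (Z N * g) = Z N * ddiff j p g" if "p \<noteq> j" "p \<noteq> N" for p
    using that assms by (simp add: ddiff_mult ddiff_Z)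
  have qN: "ddiff j N (Z N * g) = Z j * ddiff j N g - g"
    using assms by (simp add: ddiff_mult ddiff_Z)
  have "{2..<Suc j} = Suc ` {1..<j}" "{Suc j<..N} = Suc ` {j<..<N}"
    by (auto intro!: eq_Suc_image)
  moreover have "{1..<Suc j} = insert 1 {2..<Suc j}" "{j<..N} = insert N {j<..<N}"
    using assms by auto
  ultimately have A: "{j<..N} = insert N {j<..<N}" "{1..<Suc j} = insert 1 (Suc ` {1..<j})"
      "{Suc j<..N} = Suc ` {j<..<N}"
    by simp_all
  have c: "cyc N (Suc p) = p" if "1 \<le> p" "p < N" for p
    using that by (simp add: cyc_def)
  have c1: "cyc N 1 = N"
    using assms by (simp add: cyc_def)
  have S1: "(\<Sum>p\<in>{1..<Suc j}. F (cyc N p)) = F N + (\<Sum>p\<in>{1..<j}. F p)" for F :: "nat \<Rightarrow> mpol"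
  proof -
    have "(\<Sum>p\<in>{1..<Suc j}. F (cyc N p)) = F (cyc N 1) + (\<Sum>p\<in>Suc ` {1..<j}. F (cyc N p))"
      unfolding A(2) by (subst sum.insert) auto
    then show ?thesis
      using assms unfolding c1 sum_Suc_image by (simp add: c)
  qed
  have S2: "(\<Sum>p\<in>{Suc j<..N}. F (cyc N p)) = (\<Sum>p\<in>{j<..<N}. F p)" for F :: "nat \<Rightarrow> mpol"
    using assms unfolding A(3) sum_Suc_image by (simp add: c)
  have "Phi N (cherednik N \<alpha> (Suc j) f) = Z N * (Const \<alpha> * eul j g
     + (Z j * ddiff j N g + (\<Sum>p\<in>{1..<j}. Z j * ddiff j p g))
     + (\<Sum>p\<in>{j<..<N}. Z p * ddiff j p g) + Const (1 - real (Suc j)) * g)"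
    using assms unfolding Phi_def
    by (simp only: S1[of "\<lambda>p. Z j * ddiff j p g"] S2[of "\<lambda>p. Z p * ddiff j p g"] c pact_cherednik[OF bij_cyc] le_SucI flip: g_def)
  also have "\<dots> = cherednik N \<alpha> j (Z N * g)"
  proof -
    have "Const (1 - real j) = Const (1 - real (Suc j)) + 1"
      by (simp flip: Const_1 Const_add)
    then show ?thesis
      using assms by (simp add: cherednik_eq A(1) q qN eul_mult eul_Z) (simp add: algebra_simps sum_distrib_left)
  qed
  finally show ?thesis
    by (simp add: Phi_def g_def)
qed

text \<open>Each of the N - 1 divided differences at index N contributes one extra g, which cancels
  the constant 1 - N; the remaining \<alpha> comes from the Euler operator acting on the factor
  z_N.\<close>

lemma cherednik_Phi_last:
  assumes "1 \<le> N"
  shows "cherednik N \<alpha> N (Phi N f) = Phi N (cherednik N \<alpha> 1 f) + Const \<alpha> * Phi N f"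
proof -
  define g where "g = pact (cyc N) f"
  have q: "ddiff N p (Z N * g) = Z p * ddiff N p g + g" if "p \<in> {1..<N}" for p
    using that assms by (simp add: ddiff_mult ddiff_Z)
  have A: "{1<..N} = Suc ` {1..<N}"
    by (auto intro!: eq_Suc_image)
  have c: "cyc N (Suc p) = p" if "1 \<le> p" "p < N" for p
    using that by (simp add: cyc_def)
  have c1: "cyc N 1 = N"
    using assms by (simp add: cyc_def)
  have S: "(\<Sum>p\<in>{1<..N}. F (cyc N p)) = (\<Sum>p\<in>{1..<N}. F p)" for F :: "nat \<Rightarrow> mpol"
    unfolding A sum_Suc_image by (simp add: c)
  have "Phi N (cherednik N \<alpha> 1 f) = Z N * (Const \<alpha> * eul N g + (\<Sum>p\<in>{1..<N}. Z p * ddiff N p g))"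
    using assms unfolding Phi_def
    by (simp add: pact_cherednik[OF bij_cyc] S[of "\<lambda>p. Z p * ddiff N p g", simplified] c1[simplified] flip: g_def)
  also have "\<dots> + Const \<alpha> * (Z N * g) = cherednik N \<alpha> N (Z N * g)"
  proof -
    have "Const (1 - real N) = - of_nat (N - 1)"
      using assms by (simp add: of_nat_diff flip: Const_of_nat Const_minus)
    then show ?thesis
      using assms by (simp add: cherednik_eq q eul_mult eul_Z) (simp add: algebra_simps sum_distrib_left sum.distrib)
  qed
  finally show ?thesis
    by (simp add: Phi_def g_def)
qed

section \<open>Sorting and the dominance order\<close>

lemma lookup_sort_comp:
  "lookup (sort_comp N \<eta>) j =
     (if j \<in> {1..N} then rev (sort (map (lookup \<eta>) [1..<Suc N])) ! (j - 1) else 0)"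
  unfolding sort_comp_def by (simp add: lookup_sum lookup_single when_def sum.delta' cong: if_cong)

lemma composition_sort_comp: "composition N (sort_comp N \<eta>)"
  by (auto simp: composition_def in_keys_iff lookup_sort_comp split: if_splits)

lemma sort_comp_antimono:
  assumes "1 \<le> i" "i \<le> j" "j \<le> N"
  shows "lookup (sort_comp N \<eta>) j \<le> lookup (sort_comp N \<eta>) i"
proof -
  let ?xs = "sort (map (lookup \<eta>) [1..<Suc N])"
  have "rev ?xs ! (j - 1) \<le> rev ?xs ! (i - 1)"
    using assms by (subst (1 2) rev_nth) (auto intro!: sorted_nth_mono)
  then show ?thesis
    using assms by (simp add: lookup_sort_comp)
qed

text \<open>Sorting only rearranges entries. It is used with the identity for weights, with
  truncated differences for dominance, and with squares for strictness.\<close>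

lemma sum_sort_comp:
  "(\<Sum>j=1..N. F (lookup (sort_comp N \<eta>) j)) = (\<Sum>j=1..N. F (lookup \<eta> j) :: 'a::comm_monoid_add)"
proof -
  let ?xs = "sort (map (lookup \<eta>) [1..<Suc N])"
  have "(\<Sum>j=1..N. F (lookup (sort_comp N \<eta>) j)) = (\<Sum>j=1..N. F (rev ?xs ! (j - 1)))"
    by (rule sum.cong) (auto simp: lookup_sort_comp)
  also have "\<dots> = (\<Sum>j<N. F (rev ?xs ! j))"
    by (rule sum.reindex_bij_witness[of _ "\<lambda>j. j + 1" "\<lambda>j. j - 1"]) auto
  also have "\<dots> = sum_list (map F (rev ?xs))"
    by (subst sum_list_sum_nth) (auto simp: atLeast0LessThan simp del: upt_Suc intro!: sum.cong)
  also have "\<dots> = sum_list (map F (map (lookup \<eta>) [1..<Suc N]))"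
    by (simp only: sum_mset_sum_list[symmetric] mset_map mset_rev mset_sort)
  also have "\<dots> = (\<Sum>j=1..N. F (lookup \<eta> j))"
    by (simp del: upt_Suc add: interv_sum_list_conv_sum_set_nat atLeastLessThanSuc_atLeastAtMost flip: o_def)
  finally show ?thesis .
qed

lemma sort_comp_cong:
  assumes "bij_betw \<sigma> {1..N} {1..N}" "\<And>j. j \<in> {1..N} \<Longrightarrow> lookup \<nu> j = lookup \<eta> (\<sigma> j)"
  shows "sort_comp N \<nu> = sort_comp N \<eta>"
proof -
  have m: "mset (map (lookup \<kappa>) [1..<Suc N]) = image_mset (lookup \<kappa>) (mset_set {1..N})" for \<kappa>
    by (simp del: upt_Suc add: atLeastLessThanSuc_atLeastAtMost)
  have "image_mset (lookup \<nu>) (mset_set {1..N}) = image_mset (lookup \<eta>) (image_mset \<sigma> (mset_set {1..N}))"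
    unfolding multiset.map_comp by (rule image_mset_cong) (use assms in auto)
  also have "image_mset \<sigma> (mset_set {1..N}) = mset_set {1..N}"
    using assms(1) by (simp add: image_mset_mset_set bij_betw_def)
  finally have "sort (map (lookup \<nu>) [1..<Suc N]) = sort (map (lookup \<eta>) [1..<Suc N])"
    using m[of \<nu>] m[of \<eta>] by (simp only: sorted_list_of_multiset_mset[symmetric])
  then show ?thesis
    unfolding sort_comp_def by (simp only:)
qed

lemma sort_comp_act:
  assumes "bij w" "w ` {1..N} = {1..N}"
  shows "sort_comp N (act w \<eta>) = sort_comp N \<eta>"
proof (rule sort_comp_cong[of "inv w"])
  have "bij_betw w {1..N} {1..N}"
    using assms by (auto simp: bij_betw_def bij_def inj_on_def)
  then show "bij_betw (inv w) {1..N} {1..N}"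
    using assms by (metis bij_betw_def bij_def bij_imp_bij_inv image_inv_f_f inj_on_subset subset_UNIV)
qed (simp add: assms lookup_act)

text \<open>Majorization criterion: dominance of sorted vectors follows from inequalities between
  sums of positive parts, which natural-number subtraction provides.\<close>

lemma sum_sort_prefix_mono:
  assumes le: "\<And>t. (\<Sum>j=1..N. lookup \<nu> j - t) \<le> (\<Sum>j=1..N. lookup \<eta> j - t)" and p: "p \<in> {1..N}"
  shows "(\<Sum>j=1..p. lookup (sort_comp N \<nu>) j) \<le> (\<Sum>j=1..p. lookup (sort_comp N \<eta>) j)"
proof -
  \<comment> \<open>At this threshold the entries of the sorted \<open>\<eta>\<close> beyond
    \<open>p\<close> contribute 0 and the first \<open>p\<close> satisfy t + (x - t) = x, so the
    final estimate is an equality.\<close>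
  define t where "t = lookup (sort_comp N \<eta>) p"
  have s: "{1..p} \<subseteq> {1..N}" using p by auto
  have "(\<Sum>j=1..p. lookup (sort_comp N \<nu>) j) \<le> (\<Sum>j=1..p. t + (lookup (sort_comp N \<nu>) j - t))"
    by (intro sum_mono) auto
  also have "\<dots> = p * t + (\<Sum>j=1..p. lookup (sort_comp N \<nu>) j - t)"
    by (simp add: sum.distrib)
  also have "\<dots> \<le> p * t + (\<Sum>j=1..N. lookup (sort_comp N \<nu>) j - t)"
    using s by (intro add_left_mono sum_mono2) auto
  also have "\<dots> \<le> p * t + (\<Sum>j=1..N. lookup (sort_comp N \<eta>) j - t)"
    using le[of t] by (simp only: sum_sort_comp[where F = "\<lambda>x. x - t"] add_left_mono)
  also have "(\<Sum>j=1..N. lookup (sort_comp N \<eta>) j - t) = (\<Sum>j=1..p. lookup (sort_comp N \<eta>) j - t)"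
    using s p sort_comp_antimono[of p _ N \<eta>] by (intro sum.mono_neutral_right) (auto simp: t_def)
  also have "p * t + \<dots> = (\<Sum>j=1..p. t + (lookup (sort_comp N \<eta>) j - t))"
    by (simp add: sum.distrib)
  also have "\<dots> = (\<Sum>j=1..p. lookup (sort_comp N \<eta>) j)"
    using p sort_comp_antimono[of _ p N \<eta>] by (intro sum.cong) (auto simp: t_def)
  finally show ?thesis .
qed

lemma weight_sort_comp: "weight N (sort_comp N \<eta>) = weight N \<eta>"
  unfolding weight_def using sum_sort_comp[of "\<lambda>x. x"] by simp

lemma dom_less_irrefl: "\<not> dom_less N \<eta> \<eta>"
  by (simp add: dom_less_def)

lemma composition_eqI:
  assumes "composition N \<eta>" "composition N \<nu>" "\<And>i. i \<in> {1..N} \<Longrightarrow> lookup \<eta> i = lookup \<nu> i"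
  shows "\<eta> = \<nu>"
proof (rule poly_mapping_eqI)
  fix i show "lookup \<eta> i = lookup \<nu> i"
    using assms unfolding composition_def by (metis in_keys_iff subsetD)
qed

lemma dom_antisym:
  assumes "composition N \<eta>" "composition N \<nu>"
    and "\<And>p. p \<in> {1..N} \<Longrightarrow> (\<Sum>j=1..p. lookup \<nu> j) = (\<Sum>j=1..p. lookup \<eta> j)"
  shows "\<eta> = \<nu>"
  using assms(1,2)
proof (rule composition_eqI)
  fix i assume i: "i \<in> {1..N}"
  then obtain k where k: "i = Suc k"
    by (cases i) auto
  have "(\<Sum>j=1..k. lookup \<nu> j) = (\<Sum>j=1..k. lookup \<eta> j)"
    using assms(3)[of k] i k by (cases k) auto
  then show "lookup \<eta> i = lookup \<nu> i"
    using assms(3)[OF i] k by simp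
qed

lemma dom_less_trans:
  assumes "dom_less N \<kappa> \<nu>" "dom_less N \<nu> \<eta>" "composition N \<kappa>" "composition N \<nu>"
  shows "dom_less N \<kappa> \<eta>"
proof -
  have le: "(\<Sum>j=1..p. lookup \<kappa> j) \<le> (\<Sum>j=1..p. lookup \<nu> j)"
     "(\<Sum>j=1..p. lookup \<nu> j) \<le> (\<Sum>j=1..p. lookup \<eta> j)" if "p \<in> {1..N}" for p
    using assms that by (auto simp: dom_less_def)
  have "\<kappa> \<noteq> \<eta>"
  proof
    assume "\<kappa> = \<eta>"
    then have "\<kappa> = \<nu>"
      using le by (intro dom_antisym[of N] assms) (auto intro: antisym)
    then show False
      using assms by (simp add: dom_less_def)
  qed
  then show ?thesis
    using assms le unfolding dom_less_def by (auto intro: order_trans)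
qed

lemma comp_prec_irrefl: "\<not> comp_prec N \<eta> \<eta>"
  by (simp add: comp_prec_def)

lemma comp_prec_trans:
  assumes "comp_prec N \<kappa> \<nu>" "comp_prec N \<nu> \<eta>"
  shows "comp_prec N \<kappa> \<eta>"
proof -
  have "dom_less N (sort_comp N \<kappa>) (sort_comp N \<eta>) \<or> sort_comp N \<kappa> = sort_comp N \<eta> \<and> dom_less N \<kappa> \<eta>"
    using assms dom_less_trans composition_sort_comp unfolding comp_prec_def by metis
  moreover from this have "\<kappa> \<noteq> \<eta>"
    using dom_less_irrefl by auto
  ultimately show ?thesis
    using assms unfolding comp_prec_def by auto
qed

text \<open>The exponents in a divided difference of z^\<eta> in z_i and z_p differ from
  \<open>\<eta>\<close> only at these two places. Meant for \<open>i\<close> different from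
  \<open>p\<close>.\<close>

definition cfg :: "comp \<Rightarrow> nat \<Rightarrow> nat \<Rightarrow> nat \<Rightarrow> nat \<Rightarrow> comp" where
  "cfg \<eta> i p c d = Poly_Mapping.update i 0 (Poly_Mapping.update p 0 \<eta>) + single i c + single p d"

lemma lookup_cfg: "i \<noteq> p \<Longrightarrow> lookup (cfg \<eta> i p c d) k = (if k = i then c else if k = p then d else lookup \<eta> k)"
  by (auto simp: cfg_def lookup_add lookup_update lookup_single when_def)

lemma cfg_self: "i \<noteq> p \<Longrightarrow> cfg \<eta> i p (lookup \<eta> i) (lookup \<eta> p) = \<eta>"
  by (rule poly_mapping_eqI) (auto simp: lookup_cfg)

lemma composition_cfg:
  "composition N \<eta> \<Longrightarrow> i \<in> {1..N} \<Longrightarrow> p \<in> {1..N} \<Longrightarrow> i \<noteq> p \<Longrightarrow> composition N (cfg \<eta> i p c d)"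
  unfolding composition_def by (auto simp: in_keys_iff lookup_cfg subset_iff split: if_splits)

lemma sum_cfg:
  assumes "i \<in> {1..N}" "p \<in> {1..N}" "i \<noteq> p"
  shows "(\<Sum>j=1..N. F (lookup (cfg \<eta> i p c d) j)) = F c + F d + (\<Sum>j\<in>{1..N}-{i,p}. F (lookup \<eta> j) :: nat)"
proof -
  have "{1..N} = insert i (insert p ({1..N}-{i,p}))"
    using assms by auto
  then have "(\<Sum>j=1..N. F (lookup (cfg \<eta> i p c d) j)) = (\<Sum>j\<in>insert i (insert p ({1..N}-{i,p})). F (lookup (cfg \<eta> i p c d) j))"
    by simp
  also have "\<dots> = F c + F d + (\<Sum>j\<in>{1..N}-{i,p}. F (lookup \<eta> j))"
    using assms by (simp add: lookup_cfg)
  finally show ?thesis .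
qed

text \<open>Moving two entries closer with fixed sum lowers every convex symmetric sum. Positive
  parts give dominance of the sorted vectors, and the sum of squares, which drops strictly, shows
  that they differ.\<close>

lemma comp_prec_closer:
  assumes "composition N \<eta>" and ip: "i \<in> {1..N}" "p \<in> {1..N}" "i \<noteq> p"
    and cd: "c + d = lookup \<eta> i + lookup \<eta> p"
    and c: "min (lookup \<eta> i) (lookup \<eta> p) < c" "c < max (lookup \<eta> i) (lookup \<eta> p)"
  shows "comp_prec N (cfg \<eta> i p c d) \<eta>"
proof -
  let ?\<nu> = "cfg \<eta> i p c d"
  define a b where "a = lookup \<eta> i" and "b = lookup \<eta> p"
  have S: "(\<Sum>j=1..N. F (lookup \<eta> j)) = F a + F b + (\<Sum>j\<in>{1..N}-{i,p}. F (lookup \<eta> j) :: nat)" for F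
    using sum_cfg[OF ip, of F \<eta> a b] cfg_self[OF ip(3)] by (simp add: a_def b_def)
  have w: "weight N ?\<nu> = weight N \<eta>"
    unfolding weight_def using sum_cfg[OF ip, of "\<lambda>x. x" \<eta> c d] S[of "\<lambda>x. x"] cd
    by (simp add: a_def b_def)
  have "(c - t) + (d - t) \<le> (a - t) + (b - t)" for t
    using cd c unfolding a_def[symmetric] b_def[symmetric] by (auto simp: min_def max_def split: if_splits)
  then have le: "(\<Sum>j=1..N. lookup ?\<nu> j - t) \<le> (\<Sum>j=1..N. lookup \<eta> j - t)" for t
    using sum_cfg[OF ip, of "\<lambda>x. x - t" \<eta> c d] S[of "\<lambda>x. x - t"] by simp
  have ne: "sort_comp N ?\<nu> \<noteq> sort_comp N \<eta>"
  proof
    assume "sort_comp N ?\<nu> = sort_comp N \<eta>"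
    then have "(\<Sum>j=1..N. (lookup ?\<nu> j)\<^sup>2) = (\<Sum>j=1..N. (lookup \<eta> j)\<^sup>2)"
      by (metis sum_sort_comp[where F = "\<lambda>x. x\<^sup>2"])
    then have e: "c\<^sup>2 + d\<^sup>2 = a\<^sup>2 + b\<^sup>2"
      using sum_cfg[OF ip, of "\<lambda>x. x\<^sup>2" \<eta> c d] S[of "\<lambda>x. x\<^sup>2"] by simp
    \<comment> \<open>With d = a + b - c, twice this product is c^2 + d^2 - a^2 - b^2.\<close>
    have "(int c - a) * (int c - b) < 0"
      using c unfolding a_def[symmetric] b_def[symmetric]
      by (auto simp: min_def max_def mult_less_0_iff split: if_splits)
    moreover have d: "int d = int a + int b - int c"
      using cd by (simp add: a_def b_def)
    have "2 * ((int c - a) * (int c - b)) = (int c)\<^sup>2 + (int d)\<^sup>2 - (int a)\<^sup>2 - (int b)\<^sup>2"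
      unfolding d by (simp add: power2_eq_square algebra_simps)
    moreover have "(int c)\<^sup>2 + (int d)\<^sup>2 = (int a)\<^sup>2 + (int b)\<^sup>2"
      using e by (metis of_nat_add of_nat_power)
    ultimately show False by simp
  qed
  then have "dom_less N (sort_comp N ?\<nu>) (sort_comp N \<eta>)"
    unfolding dom_less_def weight_sort_comp using w sum_sort_prefix_mono[OF le] by blast
  moreover have "?\<nu> \<noteq> \<eta>"
    using ne by auto
  ultimately show ?thesis
    using assms(1) ip w by (auto simp: comp_prec_def composition_cfg)
qed

text \<open>The sorted vectors agree, and moving the larger entry to the right reduces exactly the
  prefix sums that end before \<open>p\<close>.\<close>

lemma comp_prec_swap:
  assumes "composition N \<eta>" "1 \<le> i" "i < p" "p \<le> N" "lookup \<eta> p < lookup \<eta> i" 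
    and "\<nu> = act (tr i p) \<eta>"
  shows "comp_prec N \<nu> \<eta>"
proof -
  have l: "lookup \<nu> k = (if k = i then lookup \<eta> p else if k = p then lookup \<eta> i else lookup \<eta> k)" for k
    using assms by (auto simp: lookup_act Transposition.transpose_def)
  have ne: "\<nu> \<noteq> \<eta>"
    using l[of i] assms by auto
  have c: "composition N \<nu>"
    using assms l by (auto simp: composition_def in_keys_iff subset_iff split: if_splits)
  have so: "sort_comp N \<nu> = sort_comp N \<eta>"
    using assms by (auto intro!: sort_comp_cong[of "tr i p"] simp: lookup_act)
  then have w: "weight N \<nu> = weight N \<eta>"
    by (metis weight_sort_comp)
  have "(\<Sum>j=1..q. lookup \<nu> j) \<le> (\<Sum>j=1..q. lookup \<eta> j)" for q
  proof (cases "p \<le> q")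
    case True
    then have "(\<Sum>j=1..q. lookup \<nu> j) = (\<Sum>j=1..q. lookup \<eta> j)"
      using assms by (subst sum.reindex_bij_betw[of "tr i p" "{1..q}" "{1..q}", symmetric]) (auto simp: lookup_act)
    then show ?thesis by simp
  next
    case False
    then show ?thesis
      using assms(2-5) by (intro sum_mono) (auto simp: l)
  qed
  then show ?thesis
    using assms(1) ne c so w by (auto simp: comp_prec_def dom_less_def)
qed

section \<open>Triangularity and uniqueness\<close>

lemma monom_single: "monom (single i c) = Z i ^ c"
proof (induction c)
  case (Suc c)
  have "single i (Suc c) = single i c + single i 1"
    by (simp flip: single_add)
  with Suc show ?case
    by (simp only: monom_add_single power_Suc)
qed simp

lemma monom_cfg: "monom (cfg \<eta> i p c d) =
    monom (Poly_Mapping.update i 0 (Poly_Mapping.update p 0 \<eta>)) * Z i ^ c * Z p ^ d"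
  by (simp add: cfg_def monom_add monom_single)

lemma act_tr_cfg: "i \<noteq> p \<Longrightarrow> act (tr i p) (cfg \<eta> i p c d) = cfg \<eta> i p d c"
  by (rule poly_mapping_eqI) (auto simp: lookup_act lookup_cfg Transposition.transpose_def)

text \<open>Geometric sum for (z_i^n - z_p^n) / (z_i - z_p) with n = c - d, after the common powers
  are taken out.\<close>

lemma ddiff_monom_ge:
  assumes "i \<noteq> p" "d \<le> c"
  shows "ddiff i p (monom (cfg \<eta> i p c d)) = (\<Sum>k<c - d. monom (cfg \<eta> i p (d + k) (c - Suc k)))"
proof (rule ddiff_unique[OF assms(1)])
  define m where "m = monom (Poly_Mapping.update i 0 (Poly_Mapping.update p 0 \<eta>))"
  define n where "n = c - d"
  have c: "c = d + n" using assms by (simp add: n_def)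
  have "monom (cfg \<eta> i p c d) - pact (tr i p) (monom (cfg \<eta> i p c d))
    = m * Z i ^ d * Z p ^ d * (Z i ^ n - Z p ^ n)"
    unfolding pact_monom act_tr_cfg[OF assms(1)]
    unfolding monom_cfg m_def[symmetric] c power_add
    by (simp add: algebra_simps)
  also have "Z i ^ n - Z p ^ n = (Z i - Z p) * (\<Sum>k<n. Z p ^ (n - Suc k) * Z i ^ k)"
    by (rule power_diff_sumr2)
  also have "m * Z i ^ d * Z p ^ d * ((Z i - Z p) * (\<Sum>k<n. Z p ^ (n - Suc k) * Z i ^ k)) =
    (Z i - Z p) * (\<Sum>k<n. m * (Z i ^ d * Z i ^ k) * (Z p ^ d * Z p ^ (n - Suc k)))"
    by (simp add: sum_distrib_left mult_ac)
  also have "(\<Sum>k<n. m * (Z i ^ d * Z i ^ k) * (Z p ^ d * Z p ^ (n - Suc k))) =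
    (\<Sum>k<c - d. monom (cfg \<eta> i p (d + k) (c - Suc k)))"
    by (rule sum.cong) (auto simp: monom_cfg m_def c simp flip: power_add)
  finally show "(Z i - Z p) * (\<Sum>k<c - d. monom (cfg \<eta> i p (d + k) (c - Suc k))) =
    monom (cfg \<eta> i p c d) - pact (tr i p) (monom (cfg \<eta> i p c d))" ..
qed

lemma ddiff_swap: 
  assumes "i \<noteq> p" shows "ddiff i p (pact (tr i p) f) = - ddiff i p f"
proof (rule ddiff_unique[OF assms])
  have "pact (tr i p) (pact (tr i p) f) = f"
    by (simp flip: pact_comp)
  then show "(Z i - Z p) * - ddiff i p f = pact (tr i p) f - pact (tr i p) (pact (tr i p) f)"
    using ddiff_eq[OF assms, of f] by simp
qed

lemma ddiff_monom_le:
  assumes "i \<noteq> p" "c \<le> d"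
  shows "ddiff i p (monom (cfg \<eta> i p c d)) = - (\<Sum>k<d - c. monom (cfg \<eta> i p (c + k) (d - Suc k)))"
  using ddiff_swap[OF assms(1), of "monom (cfg \<eta> i p d c)"] ddiff_monom_ge[OF assms, of \<eta>] assms
  by (simp add: act_tr_cfg)

lemma Z_mult_cfg: "Z i * monom (cfg \<eta> i p c d) = monom (cfg \<eta> i p (Suc c) d)"
  "Z p * monom (cfg \<eta> i p c d) = monom (cfg \<eta> i p c (Suc d))"
  by (simp_all add: monom_cfg mult_ac)

definition lower_terms :: "nat \<Rightarrow> comp \<Rightarrow> mpol \<Rightarrow> bool" where
  "lower_terms N \<eta> g \<longleftrightarrow> (\<forall>\<nu>\<in>keys g. comp_prec N \<nu> \<eta>)"

lemma lower_terms_iff: "lower_terms N \<eta> g \<longleftrightarrow> (\<forall>\<nu>. lookup g \<nu> \<noteq> 0 \<longrightarrow> comp_prec N \<nu> \<eta>)"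
  by (simp add: lower_terms_def Ball_def in_keys_iff)

lemma lower_terms_0 [simp]: "lower_terms N \<eta> 0"
  and lower_terms_add: "lower_terms N \<eta> f \<Longrightarrow> lower_terms N \<eta> g \<Longrightarrow> lower_terms N \<eta> (f + g)"
  and lower_terms_uminus: "lower_terms N \<eta> f \<Longrightarrow> lower_terms N \<eta> (- f)"
  and lower_terms_monom: "comp_prec N \<nu> \<eta> \<Longrightarrow> lower_terms N \<eta> (monom \<nu>)"
  unfolding lower_terms_iff by (auto simp: lookup_add lookup_Const_mult lookup_monom split: if_splits) (metis add_0)

lemma lower_terms_sum: "(\<And>a. a \<in> A \<Longrightarrow> lower_terms N \<eta> (F a)) \<Longrightarrow> lower_terms N \<eta> (sum F A)"
  by (induction A rule: infinite_finite_induct) (auto intro: lower_terms_add)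

text \<open>After multiplication by z_i one end of the geometric sum is an extreme exponent:
  \<open>\<eta>\<close> itself if the entry at \<open>i\<close> is larger, the swapped composition
  if it is smaller. As \<open>p\<close> is left of \<open>i\<close>, the latter is lower; all other
  terms have the two entries closer together.\<close>

lemma lower_terms_ddiff_less:
  assumes \<eta>: "composition N \<eta>" and ip: "1 \<le> p" "p < i" "i \<le> N"
  shows "lower_terms N \<eta> (Z i * ddiff i p (monom \<eta>) - Const (if lookup \<eta> i > lookup \<eta> p then 1 else 0) * monom \<eta>)"
proof -
  define a b where "a = lookup \<eta> i" and "b = lookup \<eta> p"
  have e: "monom \<eta> = monom (cfg \<eta> i p a b)"
    using ip by (simp add: a_def b_def cfg_self)
  consider "a = b" | "a > b" | "a < b" by linarith
  then show ?thesis
  proof cases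
    case 1
    then have "ddiff i p (monom \<eta>) = 0"
      using ddiff_monom_ge[of i p b a \<eta>] ip e by simp
    then show ?thesis using 1 by (simp add: a_def b_def)
  next
    case 2
    then obtain n where n: "a - b = Suc n" by (cases "a - b") auto
    have "Z i * ddiff i p (monom \<eta>) = (\<Sum>k<Suc n. monom (cfg \<eta> i p (Suc (b + k)) (a - Suc k)))"
      unfolding e using ddiff_monom_ge[of i p b a \<eta>] ip 2 by (simp only: n sum_distrib_left Z_mult_cfg)
    also have "\<dots> = (\<Sum>k<n. monom (cfg \<eta> i p (Suc (b + k)) (a - Suc k))) + monom (cfg \<eta> i p a b)"
    proof -
      have "Suc (b + n) = a" "a - Suc n = b" using n 2 by auto
      then show ?thesis by simp
    qed
    finally have "Z i * ddiff i p (monom \<eta>) - monom \<eta> = (\<Sum>k<n. monom (cfg \<eta> i p (Suc (b + k)) (a - Suc k)))"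
      by (simp add: e)
    moreover have "lower_terms N \<eta> (\<Sum>k<n. monom (cfg \<eta> i p (Suc (b + k)) (a - Suc k)))"
      using ip n by (intro lower_terms_sum lower_terms_monom comp_prec_closer \<eta>) (auto simp flip: a_def b_def)
    ultimately show ?thesis using 2 by (simp add: a_def b_def)
  next
    case 3
    then obtain n where n: "b - a = Suc n" by (cases "b - a") auto
    have "Z i * ddiff i p (monom \<eta>) = - (\<Sum>k<Suc n. monom (cfg \<eta> i p (Suc (a + k)) (b - Suc k)))"
      unfolding e using ddiff_monom_le[of i p a b \<eta>] ip 3 by (simp only: n sum_distrib_left Z_mult_cfg mult_minus_right)
    also have "\<dots> = - ((\<Sum>k<n. monom (cfg \<eta> i p (Suc (a + k)) (b - Suc k))) + monom (cfg \<eta> i p b a))"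
    proof -
      have "Suc (a + n) = b" "b - Suc n = a" using n 3 by auto
      then show ?thesis by simp
    qed
    finally have *: "Z i * ddiff i p (monom \<eta>) = - ((\<Sum>k<n. monom (cfg \<eta> i p (Suc (a + k)) (b - Suc k))) + monom (cfg \<eta> i p b a))" .
    have "lower_terms N \<eta> (\<Sum>k<n. monom (cfg \<eta> i p (Suc (a + k)) (b - Suc k)))"
      using ip n by (intro lower_terms_sum lower_terms_monom comp_prec_closer \<eta>) (auto simp flip: a_def b_def)
    moreover have "cfg \<eta> i p b a = act (tr p i) \<eta>"
      using act_tr_cfg[of i p \<eta> a b] ip by (simp add: a_def b_def cfg_self transpose_commute)
    then have "lower_terms N \<eta> (monom (cfg \<eta> i p b a))"
      using ip 3 by (intro lower_terms_monom comp_prec_swap[OF \<eta>, of p i]) (auto simp flip: a_def b_def)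
    ultimately have "lower_terms N \<eta> (Z i * ddiff i p (monom \<eta>))"
      unfolding * by (intro lower_terms_uminus lower_terms_add)
    then show ?thesis using 3 by (simp add: a_def b_def)
  qed
qed

text \<open>Mirror case: with prefactor z_p the extreme term is the first one, and it is
  \<open>\<eta>\<close>, with coefficient -1, exactly when the entry at \<open>p\<close> is
  larger.\<close>

lemma lower_terms_ddiff_greater:
  assumes \<eta>: "composition N \<eta>" and ip: "1 \<le> i" "i < p" "p \<le> N"
  shows "lower_terms N \<eta> (Z p * ddiff i p (monom \<eta>) + Const (if lookup \<eta> p > lookup \<eta> i then 1 else 0) * monom \<eta>)"
proof -
  define a b where "a = lookup \<eta> i" and "b = lookup \<eta> p"
  have e: "monom \<eta> = monom (cfg \<eta> i p a b)"
    using ip by (simp add: a_def b_def cfg_self)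
  consider "a = b" | "a > b" | "a < b" by linarith
  then show ?thesis
  proof cases
    case 1
    then have "ddiff i p (monom \<eta>) = 0"
      using ddiff_monom_ge[of i p b a \<eta>] ip e by simp
    then show ?thesis using 1 by (simp add: a_def b_def)
  next
    case 2
    then obtain n where n: "a - b = Suc n" by (cases "a - b") auto
    have "Z p * ddiff i p (monom \<eta>) = (\<Sum>k<Suc n. monom (cfg \<eta> i p (b + k) (Suc (a - Suc k))))"
      unfolding e using ddiff_monom_ge[of i p b a \<eta>] ip 2 by (simp only: n sum_distrib_left Z_mult_cfg)
    also have "\<dots> = monom (cfg \<eta> i p b a) + (\<Sum>k<n. monom (cfg \<eta> i p (b + Suc k) (Suc (a - Suc (Suc k)))))"
      using 2 by (subst sum.lessThan_Suc_shift) simp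
    finally have *: "Z p * ddiff i p (monom \<eta>) = monom (cfg \<eta> i p b a) + (\<Sum>k<n. monom (cfg \<eta> i p (b + Suc k) (Suc (a - Suc (Suc k)))))" .
    have "lower_terms N \<eta> (\<Sum>k<n. monom (cfg \<eta> i p (b + Suc k) (Suc (a - Suc (Suc k)))))"
      using ip n by (intro lower_terms_sum lower_terms_monom comp_prec_closer \<eta>) (auto simp flip: a_def b_def)
    moreover have "cfg \<eta> i p b a = act (tr i p) \<eta>"
      using act_tr_cfg[of i p \<eta> a b] ip by (simp add: a_def b_def cfg_self)
    then have "lower_terms N \<eta> (monom (cfg \<eta> i p b a))"
      using ip 2 by (intro lower_terms_monom comp_prec_swap[OF \<eta>, of i p]) (auto simp flip: a_def b_def)
    ultimately have "lower_terms N \<eta> (Z p * ddiff i p (monom \<eta>))"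
      unfolding * by (intro lower_terms_add)
    then show ?thesis using 2 by (simp add: a_def b_def)
  next
    case 3
    then obtain n where n: "b - a = Suc n" by (cases "b - a") auto
    have "Z p * ddiff i p (monom \<eta>) = - (\<Sum>k<Suc n. monom (cfg \<eta> i p (a + k) (Suc (b - Suc k))))"
      unfolding e using ddiff_monom_le[of i p a b \<eta>] ip 3 by (simp only: n sum_distrib_left Z_mult_cfg mult_minus_right)
    also have "(\<Sum>k<Suc n. monom (cfg \<eta> i p (a + k) (Suc (b - Suc k)))) =
      monom (cfg \<eta> i p a b) + (\<Sum>k<n. monom (cfg \<eta> i p (a + Suc k) (Suc (b - Suc (Suc k)))))"
      using 3 by (subst sum.lessThan_Suc_shift) simp
    finally have "Z p * ddiff i p (monom \<eta>) + monom \<eta> = - (\<Sum>k<n. monom (cfg \<eta> i p (a + Suc k) (Suc (b - Suc (Suc k)))))"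
      by (simp add: e)
    moreover have "lower_terms N \<eta> (- (\<Sum>k<n. monom (cfg \<eta> i p (a + Suc k) (Suc (b - Suc (Suc k))))))"
      using ip n by (intro lower_terms_uminus lower_terms_sum lower_terms_monom comp_prec_closer \<eta>) (auto simp flip: a_def b_def)
    ultimately show ?thesis using 3 by (simp add: a_def b_def)
  qed
qed

lemma sum_if_card: "finite A \<Longrightarrow> (\<Sum>p\<in>A. if P p then 1 else 0) = real (card {p\<in>A. P p})"
  by (simp add: sum.If_cases Int_def)

lemma Const_sum: "Const (sum F A) = (\<Sum>a\<in>A. Const (F a))"
  by (induction A rule: infinite_finite_induct) (auto simp: Const_add)

text \<open>Triangularity. The diagonal coefficient collects 1 for every p < i with a smaller entry;
  together with 1 - i this leaves minus the number of p < i with an entry at least as large, which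
  is the first count in \<open>eta_bar\<close>.\<close>

lemma lower_terms_cherednik:
  assumes \<eta>: "composition N \<eta>" and i: "i \<in> {1..N}"
  shows "lower_terms N \<eta> (cherednik N \<alpha> i (monom \<eta>) - Const (eta_bar N \<alpha> \<eta> i) * monom \<eta>)"
proof -
  let ?A = "\<lambda>p. Const (if lookup \<eta> i > lookup \<eta> p then 1 else 0)"
  let ?B = "\<lambda>p. Const (if lookup \<eta> p > lookup \<eta> i then 1 else 0)"
  have "card ({k\<in>{1..<i}. lookup \<eta> k \<ge> lookup \<eta> i} \<union> {k\<in>{1..<i}. lookup \<eta> i > lookup \<eta> k}) =
     card {k\<in>{1..<i}. lookup \<eta> k \<ge> lookup \<eta> i} + card {k\<in>{1..<i}. lookup \<eta> i > lookup \<eta> k}"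
    by (rule card_Un_disjoint) auto
  moreover have "{k\<in>{1..<i}. lookup \<eta> k \<ge> lookup \<eta> i} \<union> {k\<in>{1..<i}. lookup \<eta> i > lookup \<eta> k} = {1..<i}"
    by auto
  ultimately have c: "real (i - 1) =
     real (card {k\<in>{1..<i}. lookup \<eta> k \<ge> lookup \<eta> i}) + real (card {k\<in>{1..<i}. lookup \<eta> i > lookup \<eta> k})"
    by simp
  have "eta_bar N \<alpha> \<eta> i = \<alpha> * real (lookup \<eta> i) + (\<Sum>p\<in>{1..<i}. if lookup \<eta> i > lookup \<eta> p then 1 else 0)
     - (\<Sum>p\<in>{i<..N}. if lookup \<eta> p > lookup \<eta> i then 1 else 0) + (1 - real i)"
    using c i by (simp add: eta_bar_def sum_if_card of_nat_diff)
  then have b: "Const (eta_bar N \<alpha> \<eta> i) = Const \<alpha> * Const (real (lookup \<eta> i)) + (\<Sum>p\<in>{1..<i}. ?A p)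
     - (\<Sum>p\<in>{i<..N}. ?B p) + Const (1 - real i)"
    by (simp only: Const_add Const_diff Const_sum Const_mult)
  have "cherednik N \<alpha> i (monom \<eta>) - Const (eta_bar N \<alpha> \<eta> i) * monom \<eta> =
     (\<Sum>p\<in>{1..<i}. Z i * ddiff i p (monom \<eta>) - ?A p * monom \<eta>)
     + (\<Sum>p\<in>{i<..N}. Z p * ddiff i p (monom \<eta>) + ?B p * monom \<eta>)"
  proof -
    have gen: "(a * (b * m) + X + Y + c * m) - (a * b + SA - SB + c) * m = (X - SA * m) + (Y + SB * m)"
      for a b c X Y SA SB m :: mpol
      by (simp add: algebra_simps)
    show ?thesis
      unfolding b cherednik_eq eul_monom sum.distrib sum_subtractf sum_distrib_right[symmetric]
      by (rule gen)
  qed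
  also have "lower_terms N \<eta> \<dots>"
    using i by (intro lower_terms_add lower_terms_sum lower_terms_ddiff_less lower_terms_ddiff_greater \<eta>) auto
  finally show ?thesis .
qed

section \<open>Joint eigenfunctions and their maximal exponents\<close>

definition composition_support :: "nat \<Rightarrow> mpol \<Rightarrow> bool" where
  "composition_support N f \<longleftrightarrow> (\<forall>\<nu>\<in>keys f. composition N \<nu>)"

lemma composition_support_add: "composition_support N f \<Longrightarrow> composition_support N g \<Longrightarrow> composition_support N (f + g)"
  and composition_support_diff: "composition_support N f \<Longrightarrow> composition_support N g \<Longrightarrow> composition_support N (f - g)"
  and composition_support_Const_mult: "composition_support N f \<Longrightarrow> composition_support N (Const c * f)"
  by (fastforce simp: composition_support_def in_keys_iff lookup_add lookup_minus lookup_Const_mult)+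

text \<open>By triangularity the coefficient at \<mu> receives contributions only from \<mu> and
  from exponents above it, and the latter are absent.\<close>

lemma lookup_cherednik_maximal:
  assumes "composition_support N f" and i: "i \<in> {1..N}" and max: "\<And>\<kappa>. \<kappa> \<in> keys f \<Longrightarrow> \<not> comp_prec N \<mu> \<kappa>"
  shows "lookup (cherednik N \<alpha> i f) \<mu> = eta_bar N \<alpha> \<mu> i * lookup f \<mu>"
proof -
  have 1: "lookup (cherednik N \<alpha> i (monom \<kappa>)) \<mu> = (if \<kappa> = \<mu> then eta_bar N \<alpha> \<mu> i else 0)" if "\<kappa> \<in> keys f" for \<kappa>
  proof -
    have "lower_terms N \<kappa> (cherednik N \<alpha> i (monom \<kappa>) - Const (eta_bar N \<alpha> \<kappa> i) * monom \<kappa>)"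
      using assms that by (intro lower_terms_cherednik) (auto simp: composition_support_def)
    then have "lookup (cherednik N \<alpha> i (monom \<kappa>) - Const (eta_bar N \<alpha> \<kappa> i) * monom \<kappa>) \<mu> = 0"
      using max[OF that] unfolding lower_terms_iff by blast
    then show ?thesis
      by (auto simp: lookup_minus lookup_Const_mult lookup_monom split: if_splits)
  qed
  have "cherednik N \<alpha> i f = (\<Sum>\<kappa>\<in>keys f. Const (lookup f \<kappa>) * cherednik N \<alpha> i (monom \<kappa>))"
    by (subst mpol_expand[of f]) (simp add: cherednik_sum cherednik_Const_mult)
  then have "lookup (cherednik N \<alpha> i f) \<mu> = (\<Sum>\<kappa>\<in>keys f. lookup f \<kappa> * (if \<kappa> = \<mu> then eta_bar N \<alpha> \<mu> i else 0))"
    by (simp add: lookup_sum lookup_Const_mult 1)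
  also have "\<dots> = (\<Sum>\<kappa>\<in>keys f. if \<kappa> = \<mu> then lookup f \<kappa> * eta_bar N \<alpha> \<mu> i else 0)"
    by (rule sum.cong) auto
  also have "\<dots> = eta_bar N \<alpha> \<mu> i * lookup f \<mu>"
    by (simp add: in_keys_iff)
  finally show ?thesis .
qed

text \<open>The spectrum \<open>x\<close> is arbitrary because one argument below produces an
  eigenfunction whose spectrum belongs to no composition and concludes that it vanishes.\<close>

definition eigen :: "nat \<Rightarrow> real \<Rightarrow> (nat \<Rightarrow> real) \<Rightarrow> mpol \<Rightarrow> bool" where
  "eigen N \<alpha> x f \<longleftrightarrow> composition_support N f \<and> (\<forall>i\<in>{1..N}. cherednik N \<alpha> i f = Const (x i) * f)"

lemma eigen_maximal:
  assumes "eigen N \<alpha> x f" "\<mu> \<in> keys f" "\<And>\<kappa>. \<kappa> \<in> keys f \<Longrightarrow> \<not> comp_prec N \<mu> \<kappa>" "i \<in> {1..N}"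
  shows "x i = eta_bar N \<alpha> \<mu> i"
proof -
  have "lookup (cherednik N \<alpha> i f) \<mu> = x i * lookup f \<mu>"
    using assms by (simp add: eigen_def lookup_Const_mult)
  then show ?thesis
    using lookup_cherednik_maximal[of N f i \<mu> \<alpha>] assms by (simp add: eigen_def in_keys_iff)
qed

lemma exists_maximal_above:
  assumes "\<nu> \<in> keys f"
  obtains \<mu> where "\<mu> \<in> keys f" "\<mu> = \<nu> \<or> comp_prec N \<nu> \<mu>" "\<And>\<kappa>. \<kappa> \<in> keys f \<Longrightarrow> \<not> comp_prec N \<mu> \<kappa>"
proof -
  let ?A = "{\<mu>\<in>keys f. \<mu> = \<nu> \<or> comp_prec N \<nu> \<mu>}"
  have "\<exists>m\<in>?A. \<forall>x\<in>?A. x \<noteq> m \<longrightarrow> \<not> comp_prec N m x"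
    using assms
    by (intro Finite_Set.bex_max_element asymp_onI transp_onI)
       (auto dest: comp_prec_trans simp: comp_prec_irrefl)
  then obtain \<mu> where \<mu>: "\<mu> \<in> ?A" "\<And>x. x \<in> ?A \<Longrightarrow> x \<noteq> \<mu> \<Longrightarrow> \<not> comp_prec N \<mu> x" 
    by blast
  moreover have "\<not> comp_prec N \<mu> \<kappa>" if "\<kappa> \<in> keys f" for \<kappa>
    using \<mu> that comp_prec_irrefl comp_prec_trans by blast
  ultimately show ?thesis using that by blast
qed

text \<open>The strict total order of positions under a stable decreasing sort. The two counts in
  \<open>eta_bar\<close> together are the rank of \<open>i\<close> in this order.\<close>

definition before :: "comp \<Rightarrow> nat \<Rightarrow> nat \<Rightarrow> bool" where
  "before \<eta> k i \<longleftrightarrow> lookup \<eta> k > lookup \<eta> i \<or> lookup \<eta> k = lookup \<eta> i \<and> k < i"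

lemma eta_bar_before:
  assumes "i \<in> {1..N}"
  shows "eta_bar N \<alpha> \<eta> i = \<alpha> * real (lookup \<eta> i) - real (card {k\<in>{1..N}. before \<eta> k i})"
proof -
  let ?A = "{k\<in>{1..<i}. lookup \<eta> k \<ge> lookup \<eta> i}" and ?B = "{k\<in>{i<..N}. lookup \<eta> k > lookup \<eta> i}"
  have "k \<in> {1..N} \<and> before \<eta> k i \<longleftrightarrow> k \<in> ?A \<union> ?B" for k
    using assms by (cases "k = i") (auto simp: before_def)
  then have "{k\<in>{1..N}. before \<eta> k i} = ?A \<union> ?B"
    by blast
  moreover have "card (?A \<union> ?B) = card ?A + card ?B"
    by (rule card_Un_disjoint) auto
  ultimately show ?thesis
    by (simp add: eta_bar_def)
qed

lemma before_trans: "before \<eta> k l \<Longrightarrow> before \<eta> l i \<Longrightarrow> before \<eta> k i"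
  by (auto simp: before_def)

lemma before_total: "k \<noteq> i \<Longrightarrow> before \<eta> k i \<or> before \<eta> i k"
  by (auto simp: before_def)

lemma before_irrefl: "\<not> before \<eta> i i"
  by (auto simp: before_def)

text \<open>Along \<open>before\<close> the entry does not increase while the rank strictly
  increases, and both effects lower the eigenvalue.\<close>

lemma eta_bar_less:
  assumes "\<alpha> > 0" "i \<in> {1..N}" "k \<in> {1..N}" "before \<eta> k i"
  shows "eta_bar N \<alpha> \<eta> i < eta_bar N \<alpha> \<eta> k"
proof -
  have "{l\<in>{1..N}. before \<eta> l k} \<subset> {l\<in>{1..N}. before \<eta> l i}"
    using assms before_trans before_irrefl by blast
  then have "card {l\<in>{1..N}. before \<eta> l k} < card {l\<in>{1..N}. before \<eta> l i}"
    by (rule psubset_card_mono[rotated]) simp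
  then have "real (card {l\<in>{1..N}. before \<eta> l k}) < real (card {l\<in>{1..N}. before \<eta> l i})"
    by (simp only: of_nat_less_iff)
  moreover have "\<alpha> * real (lookup \<eta> i) \<le> \<alpha> * real (lookup \<eta> k)"
    using assms by (auto simp: before_def)
  ultimately show ?thesis
    unfolding eta_bar_before[OF assms(2)] eta_bar_before[OF assms(3)] by linarith
qed

lemma eta_bar_less_iff:
  assumes "\<alpha> > 0" "i \<in> {1..N}" "k \<in> {1..N}"
  shows "eta_bar N \<alpha> \<eta> i < eta_bar N \<alpha> \<eta> k \<longleftrightarrow> before \<eta> k i"
  using assms eta_bar_less[of \<alpha>] before_total[of k i \<eta>] by (metis less_asym less_irrefl)

text \<open>The order of the eigenvalues recovers \<open>before\<close>, hence the ranks, hence the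
  entries. So joint spectra are distinct for every \<alpha> > 0, not only for generic
  values.\<close>

lemma eta_bar_inj:
  assumes "\<alpha> > 0" "composition N \<eta>" "composition N \<nu>"
    and eq: "\<And>i. i \<in> {1..N} \<Longrightarrow> eta_bar N \<alpha> \<eta> i = eta_bar N \<alpha> \<nu> i"
  shows "\<eta> = \<nu>"
  using assms(2,3)
proof (rule composition_eqI)
  fix i assume i: "i \<in> {1..N}"
  have "{k\<in>{1..N}. before \<eta> k i} = {k\<in>{1..N}. before \<nu> k i}"
    using i eq eta_bar_less_iff[OF assms(1) i] by (metis (lifting))
  then have "\<alpha> * real (lookup \<eta> i) = \<alpha> * real (lookup \<nu> i)"
    using eq[OF i] i by (simp add: eta_bar_before)
  then show "lookup \<eta> i = lookup \<nu> i"
    using assms(1) by simp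
qed

text \<open>Every exponent of \<open>f\<close> lies below a maximal one, and a maximal exponent
  carries the spectrum of \<open>f\<close>, so it must be \<open>\<eta>\<close>.\<close>

lemma eigen_monic_triangular:
  assumes "\<alpha> > 0" "composition N \<eta>" "eigen N \<alpha> (eta_bar N \<alpha> \<eta>) f" "lookup f \<eta> = 1"
  shows "monic_triangular N \<eta> f"
  unfolding monic_triangular_def
proof (intro conjI ballI)
  fix \<nu> assume "\<nu> \<in> keys f"
  then obtain \<mu> where \<mu>: "\<mu> \<in> keys f" "\<mu> = \<nu> \<or> comp_prec N \<nu> \<mu>" "\<And>\<kappa>. \<kappa> \<in> keys f \<Longrightarrow> \<not> comp_prec N \<mu> \<kappa>"
    by (rule exists_maximal_above[where N = N]) blast
  have "\<eta> = \<mu>"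
    using assms \<mu> eigen_maximal[OF assms(3) \<mu>(1,3)] by (intro eta_bar_inj[of \<alpha> N]) (auto simp: eigen_def composition_support_def)
  with \<mu> show "\<nu> = \<eta> \<or> comp_prec N \<nu> \<eta>" by auto
qed fact

lemma eigen_zero:
  assumes "\<alpha> > 0" "composition N \<eta>" "eigen N \<alpha> (eta_bar N \<alpha> \<eta>) f" "lookup f \<eta> = 0"
  shows "f = 0"
proof (rule ccontr)
  assume "f \<noteq> 0"
  then obtain \<nu> where "\<nu> \<in> keys f" by (meson keys_eq_empty ex_in_conv)
  then obtain \<mu> where \<mu>: "\<mu> \<in> keys f" "\<And>\<kappa>. \<kappa> \<in> keys f \<Longrightarrow> \<not> comp_prec N \<mu> \<kappa>"
    by (rule exists_maximal_above[where N = N]) blast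
  have "\<eta> = \<mu>"
    using assms \<mu> eigen_maximal[OF assms(3) \<mu>] by (intro eta_bar_inj[of \<alpha> N]) (auto simp: eigen_def composition_support_def)
  with \<mu> assms show False by (simp add: in_keys_iff)
qed

lemma eigen_not_eta_bar:
  assumes "eigen N \<alpha> x f" and "\<And>\<mu>. composition N \<mu> \<Longrightarrow> \<exists>i\<in>{1..N}. x i \<noteq> eta_bar N \<alpha> \<mu> i"
  shows "f = 0"
proof (rule ccontr)
  assume "f \<noteq> 0"
  then obtain \<nu> where "\<nu> \<in> keys f" by (meson keys_eq_empty ex_in_conv)
  then obtain \<mu> where \<mu>: "\<mu> \<in> keys f" "\<And>\<kappa>. \<kappa> \<in> keys f \<Longrightarrow> \<not> comp_prec N \<mu> \<kappa>"
    by (rule exists_maximal_above[where N = N]) blast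
  moreover have "composition N \<mu>"
    using \<mu> assms by (auto simp: eigen_def composition_support_def)
  ultimately show False
    using assms(2) eigen_maximal[OF assms(1) \<mu>] by metis
qed

text \<open>The difference of two candidates has the same spectrum and no coefficient at
  \<open>\<eta>\<close>, so it is 0; this makes the definite description usable.\<close>

lemma nonsym_jack_eqI:
  assumes "\<alpha> > 0" "composition N \<eta>" "eigen N \<alpha> (eta_bar N \<alpha> \<eta>) f" "lookup f \<eta> = 1"
  shows "nonsym_jack N \<alpha> \<eta> = f"
  unfolding nonsym_jack_def
proof (rule the_equality)
  show "monic_triangular N \<eta> f \<and> (\<forall>i\<in>{1..N}. cherednik N \<alpha> i f = Const (eta_bar N \<alpha> \<eta> i) * f)"
    using assms eigen_monic_triangular by (auto simp: eigen_def)
next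
  fix g assume g: "monic_triangular N \<eta> g \<and> (\<forall>i\<in>{1..N}. cherednik N \<alpha> i g = Const (eta_bar N \<alpha> \<eta> i) * g)"
  then have "composition_support N g"
    using assms(2) by (auto simp: monic_triangular_def composition_support_def comp_prec_def)
  with g assms have "eigen N \<alpha> (eta_bar N \<alpha> \<eta>) (g - f)"
    by (auto simp: eigen_def composition_support_diff cherednik_diff right_diff_distrib)
  then have "g - f = 0"
    using assms g by (intro eigen_zero[of \<alpha> N \<eta>]) (auto simp: lookup_minus monic_triangular_def)
  then show "g = f" by simp
qed

section \<open>Recursions for the hook product\<close>

definition column_length :: "nat \<Rightarrow> comp \<Rightarrow> nat \<Rightarrow> nat" where
  "column_length N \<eta> c = card {j\<in>{1..N}. c \<le> lookup \<eta> j}"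

text \<open>The quantity e of the sorted composition as a product over boxes, arranged by columns:
  the box in column c and row r + 1 gives N + \<alpha> c - r. Only column heights enter, so it is
  invariant under sorting; columns beyond the weight are empty.\<close>

definition eprod :: "nat \<Rightarrow> real \<Rightarrow> comp \<Rightarrow> real" where
  "eprod N \<alpha> \<eta> = (\<Prod>c=1..weight N \<eta>. \<Prod>r<column_length N \<eta> c. real N + \<alpha> * real c - real r)"

lemma lookup_le_weight: "composition N \<eta> \<Longrightarrow> lookup \<eta> j \<le> weight N \<eta>"
proof (cases "j \<in> {1..N}")
  case True
  then show ?thesis unfolding weight_def by (intro member_le_sum) auto
next
  case False
  assume "composition N \<eta>"
  with False have "lookup \<eta> j = 0"
    unfolding composition_def by (metis in_keys_iff subsetD)
  then show ?thesis by simp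
qed

lemma eprod_extend:
  assumes "composition N \<eta>" "weight N \<eta> \<le> M"
  shows "eprod N \<alpha> \<eta> = (\<Prod>c=1..M. \<Prod>r<column_length N \<eta> c. real N + \<alpha> * real c - real r)"
  unfolding eprod_def
proof (rule prod.mono_neutral_left)
  show "\<forall>c\<in>{1..M} - {1..weight N \<eta>}. (\<Prod>r<column_length N \<eta> c. real N + \<alpha> * real c - real r) = 1"
  proof
    fix c assume "c \<in> {1..M} - {1..weight N \<eta>}"
    then have "{j\<in>{1..N}. c \<le> lookup \<eta> j} = {}"
      using lookup_le_weight[OF assms(1)] by (auto simp: not_le) (meson le_trans not_less)
    then show "(\<Prod>r<column_length N \<eta> c. real N + \<alpha> * real c - real r) = 1"
      by (simp only: column_length_def) simp
  qed
qed (use assms in auto)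

lemma column_length_le: "column_length N \<eta> c \<le> N"
proof -
  have "column_length N \<eta> c \<le> card {1..N}"
    unfolding column_length_def by (rule card_mono) auto
  then show ?thesis by simp
qed

lemma eprod_pos: "\<alpha> > 0 \<Longrightarrow> eprod N \<alpha> \<eta> > 0"
  unfolding eprod_def
proof (intro prod_pos ballI)
  fix c r assume "\<alpha> > 0" "c \<in> {1..weight N \<eta>}" "r \<in> {..<column_length N \<eta> c}"
  then have "real r \<le> real N" "\<alpha> * real c > 0"
    using column_length_le[of N \<eta> c] by auto
  then show "0 < real N + \<alpha> * real c - real r" by linarith
qed

lemma column_length_eq_sum: "column_length N \<eta> c = (\<Sum>j=1..N. if c \<le> lookup \<eta> j then 1 else 0)"
  unfolding column_length_def by (simp add: sum.If_cases Int_def)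

lemma eprod_sort: "eprod N \<alpha> (sort_comp N \<eta>) = eprod N \<alpha> \<eta>"
proof -
  have "column_length N (sort_comp N \<eta>) c = column_length N \<eta> c" for c
    unfolding column_length_eq_sum by (rule sum_sort_comp)
  then show ?thesis
    by (simp add: eprod_def weight_sort_comp)
qed

lemma down_closed_eq:
  assumes "A \<subseteq> {1..N::nat}" "\<And>i j. j \<in> A \<Longrightarrow> 1 \<le> i \<Longrightarrow> i \<le> j \<Longrightarrow> i \<in> A"
  shows "A = {1..card A}"
proof (cases "A = {}")
  case False
  have fin: "finite A" using assms(1) finite_subset by blast
  have "A = {1..Max A}"
    using assms Max_in[OF fin False] Max_ge[OF fin] by fastforce
  then show ?thesis
    by (metis card_atLeastAtMost diff_Suc_1)
qed auto

text \<open>Each Gamma quotient is a rising factorial, its argument being positive; with one power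
  of \<alpha> per box this is a product along a row. Exchanging rows and columns gives
  \<open>eprod\<close>, because the columns of a partition are initial segments.\<close>

lemma e_part_eq_eprod:
  assumes \<alpha>: "\<alpha> > 0" and c: "composition N \<kappa>"
    and mono: "\<And>i j. 1 \<le> i \<Longrightarrow> i \<le> j \<Longrightarrow> j \<le> N \<Longrightarrow> lookup \<kappa> j \<le> lookup \<kappa> i"
  shows "e_part N \<alpha> \<kappa> = eprod N \<alpha> \<kappa>"
proof -
  define M where "M = weight N \<kappa>"
  let ?u = "\<lambda>j. 1 + real N / \<alpha> - 1 / \<alpha> * (real j - 1)"
  have row: "\<alpha> ^ n * (Gamma (?u j + real n) / Gamma (?u j)) = (\<Prod>c=1..n. real N + \<alpha> * real c - real (j - 1))"
    if "j \<in> {1..N}" for j n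
  proof -
    have "(real j - 1) / \<alpha> \<le> real N / \<alpha>"
      using that \<alpha> by (intro divide_right_mono) auto
    then have "?u j > 0"
      by simp
    then have u: "?u j \<notin> \<int>\<^sub>\<le>\<^sub>0"
      using nonpos_Ints_nonpos by fastforce
    have "Gamma (?u j + real n) / Gamma (?u j) = (\<Prod>i=0..<n. ?u j + real i)"
      unfolding pochhammer_Gamma[OF u, symmetric] by (rule pochhammer_prod)
    then have "\<alpha> ^ n * (Gamma (?u j + real n) / Gamma (?u j)) = (\<Prod>i=0..<n. \<alpha> * (?u j + real i))"
      by (simp add: prod.distrib)
    also have "\<dots> = (\<Prod>c=1..n. real N + \<alpha> * real c - real (j - 1))"
      using \<alpha> that
      by (intro prod.reindex_bij_witness[of _ "\<lambda>c. c - 1" Suc]) (auto simp: field_simps of_nat_diff)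
    finally show ?thesis .
  qed
  have "e_part N \<alpha> \<kappa> = (\<Prod>j=1..N. \<alpha> ^ lookup \<kappa> j * (Gamma (?u j + real (lookup \<kappa> j)) / Gamma (?u j)))"
    unfolding e_part_def gen_pochhammer_def weight_def power_sum prod.distrib by (rule refl)
  also have "\<dots> = (\<Prod>j=1..N. \<Prod>c=1..lookup \<kappa> j. real N + \<alpha> * real c - real (j - 1))"
    by (rule prod.cong) (use row in auto)
  also have "\<dots> = (\<Prod>j=1..N. \<Prod>c | c \<in> {1..M} \<and> c \<le> lookup \<kappa> j. real N + \<alpha> * real c - real (j - 1))"
    using lookup_le_weight[OF c] by (intro prod.cong) (auto simp: M_def intro: order_trans)
  also have "\<dots> = (\<Prod>c=1..M. \<Prod>j | j \<in> {1..N} \<and> c \<le> lookup \<kappa> j. real N + \<alpha> * real c - real (j - 1))"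
    by (rule prod.swap_restrict) auto
  also have "\<dots> = (\<Prod>c=1..M. \<Prod>r<column_length N \<kappa> c. real N + \<alpha> * real c - real r)"
  proof (rule prod.cong)
    fix c assume "c \<in> {1..M}"
    have "{j\<in>{1..N}. c \<le> lookup \<kappa> j} = {1..column_length N \<kappa> c}"
      unfolding column_length_def by (rule down_closed_eq[of _ N]) (use mono in \<open>fastforce intro: order_trans\<close>)+
    then have "(\<Prod>j | j \<in> {1..N} \<and> c \<le> lookup \<kappa> j. real N + \<alpha> * real c - real (j - 1)) =
       (\<Prod>j\<in>{1..column_length N \<kappa> c}. real N + \<alpha> * real c - real (j - 1))"
      by (rule arg_cong)
    also have "\<dots> = (\<Prod>r<column_length N \<kappa> c. real N + \<alpha> * real c - real r)"
      by (rule prod.reindex_bij_witness[of _ Suc "\<lambda>j. j - 1"]) auto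
    finally show "(\<Prod>j | j \<in> {1..N} \<and> c \<le> lookup \<kappa> j. real N + \<alpha> * real c - real (j - 1)) =
       (\<Prod>r<column_length N \<kappa> c. real N + \<alpha> * real c - real r)" .
  qed simp
  also have "\<dots> = eprod N \<alpha> \<kappa>"
    by (simp add: eprod_def M_def)
  finally show ?thesis .
qed

lemma e_part_sort: "\<alpha> > 0 \<Longrightarrow> e_part N \<alpha> (sort_comp N \<eta>) = eprod N \<alpha> \<eta>"
  using e_part_eq_eprod[OF _ composition_sort_comp sort_comp_antimono] eprod_sort by metis

section \<open>Raising and swapping on eigenvalues, columns and hooks\<close>

definition PhiC :: "nat \<Rightarrow> comp \<Rightarrow> comp" where
  "PhiC N \<eta> = act (cyc N) \<eta> + single N 1"

lemma Phi_monom: "Phi N (monom \<eta>) = monom (PhiC N \<eta>)"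
  by (simp only: Phi_def PhiC_def pact_monom monom_add_single)

lemma lookup_Phi: "lookup (Phi N f) (PhiC N \<eta>) = lookup f \<eta>"
proof -
  have inj: "PhiC N \<kappa> = PhiC N \<nu> \<longleftrightarrow> \<kappa> = \<nu>" for \<kappa> \<nu>
    unfolding PhiC_def by (metis act_inv_act add_right_cancel bij_cyc)
  show ?thesis
  proof (induction f rule: mpol_induct)
    case (monom c \<kappa>)
    have "Phi N (Const c * monom \<kappa>) = Const c * monom (PhiC N \<kappa>)"
      unfolding Phi_monom[symmetric] by (simp add: Phi_def pact_Const_mult mult.left_commute)
    then show ?case
      by (simp add: lookup_Const_mult lookup_monom inj)
  qed (simp_all add: Phi_def pact_add distrib_left lookup_add)
qed

lemma lookup_PhiC_cyc: "1 \<le> N \<Longrightarrow> k \<in> {1..N} \<Longrightarrow>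
    lookup (PhiC N \<eta>) (cyc N k) = lookup \<eta> k + (if k = 1 then 1 else 0)"
proof -
  assume "1 \<le> N" "k \<in> {1..N}"
  moreover have "inv (cyc N) (cyc N k) = k"
    by (simp add: bij_cyc bij_is_inj)
  ultimately show ?thesis
    by (auto simp: PhiC_def lookup_add lookup_act[OF bij_cyc] lookup_single when_def cyc_def)
qed

lemma bij_betw_cyc: "1 \<le> N \<Longrightarrow> bij_betw (cyc N) {1..N} {1..N}"
  by (rule bij_betw_byWitness[where f' = "\<lambda>k. if k = N then 1 else k + 1"]) (auto simp: cyc_def)

lemma composition_PhiC:
  assumes "1 \<le> N" "composition N \<eta>" shows "composition N (PhiC N \<eta>)"
  unfolding composition_def
proof
  fix k assume k: "k \<in> keys (PhiC N \<eta>)"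
  show "k \<in> {1..N}"
  proof (rule ccontr)
    assume n: "k \<notin> {1..N}"
    then have "cyc N k = k" by (auto simp: cyc_def)
    then have "inv (cyc N) k = k"
      by (metis bij_cyc bij_inv_eq_iff)
    then have "lookup (PhiC N \<eta>) k = lookup \<eta> k"
      using n assms(1) by (auto simp: PhiC_def lookup_add lookup_act[OF bij_cyc] lookup_single when_def)
    with k n assms(2) show False
      unfolding composition_def by (metis in_keys_iff subsetD)
  qed
qed

text \<open>\<open>PhiC\<close> sends \<eta> to (\<eta>_2, ..., \<eta>_N, \<eta>_1 + 1). The old
  first entry loses its advantage in ties by becoming last, and the added 1 compensates exactly for
  that.\<close>

lemma before_PhiC:
  assumes "1 \<le> N" "k \<in> {1..N}" "i \<in> {1..N}"
  shows "before (PhiC N \<eta>) (cyc N k) (cyc N i) \<longleftrightarrow> before \<eta> k i"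
  unfolding before_def lookup_PhiC_cyc[OF assms(1,2)] lookup_PhiC_cyc[OF assms(1,3)]
  using assms by (auto simp: cyc_def)

lemma bij_betw_remove: "bij_betw f A B \<Longrightarrow> i \<in> A \<Longrightarrow> bij_betw f (A - {i}) (B - {f i})"
  unfolding bij_betw_def using inj_on_image_set_diff[of f A A "{i}"] by (auto intro: inj_on_subset)

lemma card_bij_Collect:
  assumes "bij_betw f A B" "\<And>x. x \<in> A \<Longrightarrow> P (f x) \<longleftrightarrow> R x"
  shows "card {y\<in>B. P y} = card {x\<in>A. R x}"
proof -
  have "bij_betw f {x\<in>A. R x} {y\<in>B. P y}"
    using assms unfolding bij_betw_def inj_on_def by auto
  then show ?thesis by (simp add: bij_betw_same_card)
qed

lemma eta_bar_PhiC:
  assumes "1 \<le> N" "i \<in> {1..N}"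
  shows "eta_bar N \<alpha> (PhiC N \<eta>) (cyc N i) = eta_bar N \<alpha> \<eta> i + (if i = 1 then \<alpha> else 0)"
proof -
  have c: "cyc N i \<in> {1..N}"
    using assms by (auto simp: cyc_def)
  have "card {k\<in>{1..N}. before (PhiC N \<eta>) k (cyc N i)} = card {k\<in>{1..N}. before \<eta> k i}"
    by (rule card_bij_Collect[OF bij_betw_cyc]) (use assms before_PhiC in auto)
  then show ?thesis
    unfolding eta_bar_before[OF c] eta_bar_before[OF assms(2)] lookup_PhiC_cyc[OF assms]
    by (simp add: algebra_simps)
qed

lemma eigen_Phi:
  assumes N: "1 \<le> N" and "eigen N \<alpha> (eta_bar N \<alpha> \<eta>) f"
  shows "eigen N \<alpha> (eta_bar N \<alpha> (PhiC N \<eta>)) (Phi N f)"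
  unfolding eigen_def
proof (intro conjI ballI)
  show "composition_support N (Phi N f)"
    unfolding composition_support_def
  proof
    fix \<nu> assume "\<nu> \<in> keys (Phi N f)"
    then have "\<nu> \<in> keys (monom (single N 1) * pact (cyc N) f)"
      by (simp add: Phi_def Z_def)
    then have "\<nu> \<in> {a + b |a b. a \<in> keys (monom (single N 1)) \<and> b \<in> keys (pact (cyc N) f)}"
      by (rule subsetD[OF keys_mult])
    then obtain \<kappa> where \<kappa>: "\<nu> = single N 1 + \<kappa>" "\<kappa> \<in> keys (pact (cyc N) f)"
      unfolding keys_monom by blast
    then obtain \<kappa>' where "\<kappa>' \<in> keys f" "\<kappa> = act (cyc N) \<kappa>'"
      using keys_pact[OF bij_cyc] by blast
    then show "composition N \<nu>"
      using assms \<kappa> composition_PhiC[OF N, of \<kappa>'] by (auto simp: eigen_def composition_support_def PhiC_def add.commute)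
  qed
next
  fix j assume j: "j \<in> {1..N}"
  have P: "Phi N (Const c * f) = Const c * Phi N f" for c
    by (simp add: Phi_def pact_Const_mult mult.left_commute)
  show "cherednik N \<alpha> j (Phi N f) = Const (eta_bar N \<alpha> (PhiC N \<eta>) j) * Phi N f"
  proof (cases "j = N")
    case True
    have "cyc N 1 = N" using N by (simp add: cyc_def)
    then have "eta_bar N \<alpha> (PhiC N \<eta>) N = eta_bar N \<alpha> \<eta> 1 + \<alpha>"
      using eta_bar_PhiC[OF N, of 1 \<alpha> \<eta>] N by simp
    then show ?thesis
      using True cherednik_Phi_last[OF N] assms N by (simp add: eigen_def P Const_add distrib_right)
  next
    case False
    then have c: "cyc N (Suc j) = j" "Suc j \<in> {1..N}" "1 \<le> j" "j < N" using j by (auto simp: cyc_def)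
    then have "eta_bar N \<alpha> (PhiC N \<eta>) j = eta_bar N \<alpha> \<eta> (Suc j)"
      using eta_bar_PhiC[OF N c(2), of \<alpha> \<eta>] by simp
    then show ?thesis
      using c cherednik_Phi[of j N] assms N by (simp add: eigen_def P)
  qed
qed

lemma weight_PhiC: "1 \<le> N \<Longrightarrow> weight N (PhiC N \<eta>) = Suc (weight N \<eta>)"
proof -
  assume N: "1 \<le> N"
  have "weight N (PhiC N \<eta>) = (\<Sum>k=1..N. lookup (PhiC N \<eta>) (cyc N k))"
    unfolding weight_def by (rule sum.reindex_bij_betw[OF bij_betw_cyc[OF N], symmetric])
  also have "\<dots> = (\<Sum>k=1..N. lookup \<eta> k + (if k = 1 then 1 else 0))"
    by (rule sum.cong) (use N lookup_PhiC_cyc in auto)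
  finally have "weight N (PhiC N \<eta>) = (\<Sum>k=1..N. lookup \<eta> k + (if k = 1 then 1 else 0))" .
  then show ?thesis
    using N by (simp add: sum.distrib weight_def)
qed

lemma eta_bar_1: "1 \<le> N \<Longrightarrow> eta_bar N \<alpha> \<eta> 1 = \<alpha> * real (lookup \<eta> 1) - real (column_length N \<eta> (Suc (lookup \<eta> 1)))"
  by (subst eta_bar_before) (auto simp: before_def column_length_def Suc_le_eq intro!: arg_cong[where f = card])

text \<open>Exactly one column grows, that of index \<eta>_1 + 1, and the factor of its new box is
  the stated one because the old height of this column is the rank of position 1.\<close>

lemma eprod_PhiC:
  assumes N: "1 \<le> N" and \<eta>: "composition N \<eta>"
  shows "eprod N \<alpha> (PhiC N \<eta>) = eprod N \<alpha> \<eta> * (eta_bar N \<alpha> \<eta> 1 + \<alpha> + real N)"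
proof -
  define a where "a = Suc (lookup \<eta> 1)"
  define x where "x = real N + \<alpha> * real a - real (column_length N \<eta> a)"
  have column_length: "column_length N (PhiC N \<eta>) c = column_length N \<eta> c + (if c = a then 1 else 0)" for c
  proof -
    have "column_length N (PhiC N \<eta>) c = (\<Sum>k=1..N. if c \<le> lookup (PhiC N \<eta>) (cyc N k) then 1 else 0)"
      unfolding column_length_eq_sum by (rule sum.reindex_bij_betw[OF bij_betw_cyc[OF N], symmetric])
    also have "\<dots> = (\<Sum>k=1..N. (if c \<le> lookup \<eta> k then 1 else 0) + (if k = 1 then (if c = a then 1 else 0) else 0))"
      by (rule sum.cong) (use N lookup_PhiC_cyc in \<open>auto simp: a_def\<close>)
    also have "\<dots> = column_length N \<eta> c + (if c = a then 1 else 0)"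
      unfolding sum.distrib column_length_eq_sum using N by simp
    finally show ?thesis .
  qed
  have "eprod N \<alpha> (PhiC N \<eta>) = (\<Prod>c=1..Suc (weight N \<eta>). \<Prod>r<column_length N (PhiC N \<eta>) c. real N + \<alpha> * real c - real r)"
    by (simp add: eprod_def weight_PhiC[OF N])
  also have "\<dots> = (\<Prod>c=1..Suc (weight N \<eta>). (\<Prod>r<column_length N \<eta> c. real N + \<alpha> * real c - real r) * (if c = a then x else 1))"
    by (rule prod.cong) (auto simp: column_length x_def)
  also have "\<dots> = (\<Prod>c=1..Suc (weight N \<eta>). (\<Prod>r<column_length N \<eta> c. real N + \<alpha> * real c - real r)) * x"
    using lookup_le_weight[OF \<eta>, of 1] by (simp only: prod.distrib prod.delta finite_atLeastAtMost) (simp add: a_def)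
  also have "\<dots> = eprod N \<alpha> \<eta> * x"
    by (subst eprod_extend[OF \<eta>, of "Suc (weight N \<eta>)"]) auto
  also have "x = eta_bar N \<alpha> \<eta> 1 + \<alpha> + real N"
    unfolding eta_bar_1[OF N] x_def a_def by (simp add: algebra_simps)
  finally show ?thesis .
qed

text \<open>Uniform form of the two counts in \<open>leg\<close>: rows above \<open>i\<close> are
  compared with their length increased by one. Bijections of positions can then be applied in one
  go.\<close>

lemma leg_eq:
  assumes "i \<in> {1..N}"
  shows "leg N \<eta> i j = card {k\<in>{1..N}-{i}. j \<le> lookup \<eta> k + of_bool (k < i) \<and> lookup \<eta> k + of_bool (k < i) \<le> lookup \<eta> i}"
proof -
  let ?A = "{k\<in>{1..<i}. j \<le> lookup \<eta> k + 1 \<and> lookup \<eta> k + 1 \<le> lookup \<eta> i}"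
    and ?B = "{k\<in>{i<..N}. j \<le> lookup \<eta> k \<and> lookup \<eta> k \<le> lookup \<eta> i}"
  have "{k\<in>{1..N}-{i}. j \<le> lookup \<eta> k + of_bool (k < i) \<and> lookup \<eta> k + of_bool (k < i) \<le> lookup \<eta> i} = ?A \<union> ?B"
    using assms by (auto simp: of_bool_def split: if_splits)
  moreover have "card (?A \<union> ?B) = card ?A + card ?B"
    by (rule card_Un_disjoint) auto
  ultimately show ?thesis
    by (simp add: leg_def)
qed

definition hook :: "nat \<Rightarrow> real \<Rightarrow> comp \<Rightarrow> nat \<Rightarrow> nat \<Rightarrow> real" where
  "hook N \<alpha> \<eta> i j = \<alpha> * (real (arm \<eta> i j) + 1) + real (leg N \<eta> i j) + 1"

lemma d_comp_hook: "d_comp N \<alpha> \<eta> = (\<Prod>i=1..N. \<Prod>j=1..lookup \<eta> i. hook N \<alpha> \<eta> i j)"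
  by (simp add: d_comp_def hook_def)

lemma d_comp_pos: "\<alpha> > 0 \<Longrightarrow> d_comp N \<alpha> \<eta> > 0"
  unfolding d_comp_hook hook_def by (intro prod_pos ballI) (simp add: add_nonneg_pos add_pos_nonneg)

text \<open>Row 1 becomes row N and its boxes shift one column to the right, so j = 0 stands for the
  newly created first box; its leg counts all other rows of length at most \<eta>_1.\<close>

lemma leg_PhiC:
  assumes N: "1 \<le> N" and i: "i \<in> {1..N}"
  shows "leg N (PhiC N \<eta>) (cyc N i) (if i = 1 then Suc j else j) = (if i = 1 \<and> j = 0 then N - 1 - column_length N \<eta> (Suc (lookup \<eta> 1)) else leg N \<eta> i j)"
proof -
  let ?j' = "if i = 1 then Suc j else j"
  have c: "cyc N i \<in> {1..N}"
    using assms by (auto simp: cyc_def)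
  have b: "bij_betw (cyc N) ({1..N}-{i}) ({1..N}-{cyc N i})"
    by (rule bij_betw_remove[OF bij_betw_cyc[OF N] i])
  have "leg N (PhiC N \<eta>) (cyc N i) ?j' = card {k\<in>{1..N}-{i}. j \<le> lookup \<eta> k + of_bool (k < i) \<and> lookup \<eta> k + of_bool (k < i) \<le> lookup \<eta> i}"
    unfolding leg_eq[OF c]
  proof (rule card_bij_Collect[OF b])
    fix k assume k: "k \<in> {1..N} - {i}"
    then have k': "k \<in> {1..N}" by auto
    show "?j' \<le> lookup (PhiC N \<eta>) (cyc N k) + of_bool (cyc N k < cyc N i) \<and>
        lookup (PhiC N \<eta>) (cyc N k) + of_bool (cyc N k < cyc N i) \<le> lookup (PhiC N \<eta>) (cyc N i) \<longleftrightarrow>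
        j \<le> lookup \<eta> k + of_bool (k < i) \<and> lookup \<eta> k + of_bool (k < i) \<le> lookup \<eta> i"
      unfolding lookup_PhiC_cyc[OF N i] lookup_PhiC_cyc[OF N k']
      using k i by (auto simp: cyc_def of_bool_def split: if_splits)
  qed
  moreover have "card {k\<in>{1..N}-{i}. j \<le> lookup \<eta> k + of_bool (k < i) \<and> lookup \<eta> k + of_bool (k < i) \<le> lookup \<eta> i}
     = N - 1 - column_length N \<eta> (Suc (lookup \<eta> 1))" if "i = 1" "j = 0"
  proof -
    have "{k\<in>{1..N}-{i}. j \<le> lookup \<eta> k + of_bool (k < i) \<and> lookup \<eta> k + of_bool (k < i) \<le> lookup \<eta> i}
      = ({1..N}-{1}) - {k\<in>{1..N}. Suc (lookup \<eta> 1) \<le> lookup \<eta> k}"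
      using that by auto
    moreover have "{k\<in>{1..N}. Suc (lookup \<eta> 1) \<le> lookup \<eta> k} \<subseteq> {1..N}-{1}"
      by auto
    ultimately show ?thesis
      using N by (simp add: card_Diff_subset column_length_def)
  qed
  ultimately show ?thesis
    using leg_eq[OF i] by simp
qed

text \<open>All old hooks survive and the new box has hook \<alpha> (\<eta>_1 + 1) + leg + 1. This
  equals the factor gained by \<open>eprod\<close>, so \<open>eprod\<close> / \<open>d_comp\<close>
  is unchanged, in agreement with \<open>Phi\<close> preserving values at (1, ..., 1).\<close>

lemma d_comp_PhiC:
  assumes N: "1 \<le> N"
  shows "d_comp N \<alpha> (PhiC N \<eta>) = d_comp N \<alpha> \<eta> * (eta_bar N \<alpha> \<eta> 1 + \<alpha> + real N)"
proof -
  define x where "x = eta_bar N \<alpha> \<eta> 1 + \<alpha> + real N"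
  have "d_comp N \<alpha> (PhiC N \<eta>) = (\<Prod>i=1..N. \<Prod>j=1..lookup (PhiC N \<eta>) (cyc N i). hook N \<alpha> (PhiC N \<eta>) (cyc N i) j)"
    unfolding d_comp_hook by (rule prod.reindex_bij_betw[OF bij_betw_cyc[OF N], symmetric])
  also have "\<dots> = (\<Prod>i=1..N. (\<Prod>j=1..lookup \<eta> i. hook N \<alpha> \<eta> i j) * (if i = 1 then x else 1))"
  proof (rule prod.cong)
    fix i assume i: "i \<in> {1..N}"
    show "(\<Prod>j=1..lookup (PhiC N \<eta>) (cyc N i). hook N \<alpha> (PhiC N \<eta>) (cyc N i) j) =
       (\<Prod>j=1..lookup \<eta> i. hook N \<alpha> \<eta> i j) * (if i = 1 then x else 1)"
    proof (cases "i = 1")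
      case False
      then have "hook N \<alpha> (PhiC N \<eta>) (cyc N i) j = hook N \<alpha> \<eta> i j" for j
        using leg_PhiC[OF N i, of \<eta> j] lookup_PhiC_cyc[OF N i, of \<eta>] by (simp add: hook_def arm_def)
      then show ?thesis
        using False lookup_PhiC_cyc[OF N i, of \<eta>] by simp
    next
      case True
      have "hook N \<alpha> (PhiC N \<eta>) (cyc N i) (Suc j) = (if j = 0 then x else hook N \<alpha> \<eta> i j)" for j
      proof -
        have "column_length N \<eta> (Suc (lookup \<eta> 1)) \<le> card ({1..N} - {1})"
          unfolding column_length_def by (rule card_mono) (auto simp: not_less_eq_eq)
        then have "column_length N \<eta> (Suc (lookup \<eta> 1)) \<le> N - 1"
          using N by simp
        then show ?thesis
        using True N leg_PhiC[OF N i, of \<eta> j] lookup_PhiC_cyc[OF N i, of \<eta>]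
        by (auto simp: hook_def arm_def x_def eta_bar_1[OF N, simplified] of_nat_diff algebra_simps)
      qed
      moreover have "{1..lookup (PhiC N \<eta>) (cyc N i)} = Suc ` (insert 0 {1..lookup \<eta> i})"
        using True lookup_PhiC_cyc[OF N i, of \<eta>] by (intro eq_Suc_image) auto
      ultimately have "(\<Prod>j=1..lookup (PhiC N \<eta>) (cyc N i). hook N \<alpha> (PhiC N \<eta>) (cyc N i) j) =
          (\<Prod>j\<in>insert 0 {1..lookup \<eta> i}. if j = 0 then x else hook N \<alpha> \<eta> i j)"
        by (simp only: prod.reindex[OF inj_on_subset[OF inj_Suc subset_UNIV]] o_def)
      also have "\<dots> = x * (\<Prod>j=1..lookup \<eta> i. hook N \<alpha> \<eta> i j)"
        by (subst prod.insert) (auto intro!: prod.cong)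
      finally show ?thesis
        using True by simp
    qed
  qed simp
  also have "\<dots> = d_comp N \<alpha> \<eta> * x"
    unfolding prod.distrib d_comp_hook using N by simp
  finally show ?thesis
    by (simp add: x_def)
qed

text \<open>The positions strictly between \<open>i\<close> and \<open>k\<close> in the order
  \<open>before\<close> are the ones counted by the leg of the box in row i and column \<eta>_k + 1.
  The last hypothesis excludes ties with \<open>k\<close> that would count for the rank but not for
  the leg.\<close>

lemma eta_bar_diff:
  assumes ik: "1 \<le> i" "i < k" "k \<le> N" and g: "lookup \<eta> k < lookup \<eta> i"
    and no: "\<And>l. i < l \<Longrightarrow> l < k \<Longrightarrow> lookup \<eta> l \<noteq> lookup \<eta> k"
  shows "eta_bar N \<alpha> \<eta> i - eta_bar N \<alpha> \<eta> k = hook N \<alpha> \<eta> i (Suc (lookup \<eta> k))"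
proof -
  have i: "i \<in> {1..N}" and k: "k \<in> {1..N}" using ik by auto
  let ?L = "{l\<in>{1..N}-{i}. Suc (lookup \<eta> k) \<le> lookup \<eta> l + of_bool (l < i) \<and> lookup \<eta> l + of_bool (l < i) \<le> lookup \<eta> i}"
  have "l \<in> {1..N} \<and> before \<eta> l k \<longleftrightarrow> l \<in> insert i ({l\<in>{1..N}. before \<eta> l i} \<union> ?L)" for l
    using ik g no[of l] by (cases l i rule: linorder_cases; cases l k rule: linorder_cases)
      (auto simp: before_def)
  then have "{l\<in>{1..N}. before \<eta> l k} = insert i ({l\<in>{1..N}. before \<eta> l i} \<union> ?L)"
    by blast
  moreover have "card (insert i ({l\<in>{1..N}. before \<eta> l i} \<union> ?L)) = Suc (card {l\<in>{1..N}. before \<eta> l i} + card ?L)"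
    by (subst card_insert_disjoint, simp, simp add: before_def, subst card_Un_disjoint)
       (auto simp: before_def of_bool_def split: if_splits)
  ultimately have c: "card {l\<in>{1..N}. before \<eta> l k} = Suc (card {l\<in>{1..N}. before \<eta> l i} + leg N \<eta> i (Suc (lookup \<eta> k)))"
    by (simp only: leg_eq[OF i])
  show ?thesis
    unfolding eta_bar_before[OF i] eta_bar_before[OF k] c hook_def arm_def
    using g by (simp add: of_nat_diff algebra_simps)
qed

lemma lookup_swap: "lookup (act (tr i j) \<eta>) k = lookup \<eta> (tr i j k)"
  by (simp add: lookup_act)

lemma before_swap:
  assumes "lookup \<eta> i \<noteq> lookup \<eta> (Suc i)"
  shows "before (act (tr i (Suc i)) \<eta>) (tr i (Suc i) k) (tr i (Suc i) l) \<longleftrightarrow> before \<eta> k l"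
  using assms unfolding before_def lookup_swap by (auto simp: Transposition.transpose_def)

lemma bij_betw_tr: "1 \<le> i \<Longrightarrow> i < N \<Longrightarrow> bij_betw (tr i (Suc i)) {1..N} {1..N}"
  by auto

lemma tr_mem: "1 \<le> i \<Longrightarrow> i < N \<Longrightarrow> k \<in> {1..N} \<Longrightarrow> tr i (Suc i) k \<in> {1..N}"
  by (auto simp: Transposition.transpose_def)

lemma eta_bar_swap:
  assumes "1 \<le> i" "i < N" "k \<in> {1..N}" "lookup \<eta> i \<noteq> lookup \<eta> (Suc i)"
  shows "eta_bar N \<alpha> (act (tr i (Suc i)) \<eta>) k = eta_bar N \<alpha> \<eta> (tr i (Suc i) k)"
proof -
  have "card {l\<in>{1..N}. before (act (tr i (Suc i)) \<eta>) l k} = card {l\<in>{1..N}. before \<eta> l (tr i (Suc i) k)}"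
    by (rule card_bij_Collect[OF bij_betw_tr[OF assms(1,2)]])
       (use before_swap[OF assms(4), of _ "tr i (Suc i) k"] in auto)
  then show ?thesis
    using assms by (simp only: eta_bar_before tr_mem lookup_swap)
qed

text \<open>For the longer row its neighbour changes sides, so that \<eta>_{i+1} + 1 is compared
  instead of \<eta>_{i+1}; this matters in the single column \<eta>_{i+1} + 1. For the shorter row
  the longer neighbour is never counted.\<close>

lemma leg_swap:
  assumes i: "1 \<le> i" "i < N" and g: "lookup \<eta> (Suc i) < lookup \<eta> i" and k: "k \<in> {1..N}"
  shows "leg N (act (tr i (Suc i)) \<eta>) (tr i (Suc i) k) j = leg N \<eta> k j + (if k = i \<and> j = Suc (lookup \<eta> (Suc i)) then 1 else 0)"
proof -
  let ?s = "tr i (Suc i)" and ?\<mu> = "act (tr i (Suc i)) \<eta>"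
  have k': "?s k \<in> {1..N}" using i k by (rule tr_mem)
  have b: "bij_betw ?s ({1..N}-{k}) ({1..N}-{?s k})"
    by (rule bij_betw_remove[OF bij_betw_tr[OF i] k])
  let ?A = "{l\<in>{1..N}-{k}. j \<le> lookup \<eta> l + of_bool (l < k) \<and> lookup \<eta> l + of_bool (l < k) \<le> lookup \<eta> k}"
  let ?X = "if k = i \<and> j = Suc (lookup \<eta> (Suc i)) then {Suc i} else {}"
  have "leg N ?\<mu> (?s k) j = card {l\<in>{1..N}-{k}. l \<in> ?A \<union> ?X}"
    unfolding leg_eq[OF k']
  proof (rule card_bij_Collect[OF b])
    fix l assume l: "l \<in> {1..N}-{k}"
    show "j \<le> lookup ?\<mu> (?s l) + of_bool (?s l < ?s k) \<and>
        lookup ?\<mu> (?s l) + of_bool (?s l < ?s k) \<le> lookup ?\<mu> (?s k) \<longleftrightarrow> l \<in> ?A \<union> ?X"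
      using l g i by (simp add: lookup_swap) (auto simp: Transposition.transpose_def of_bool_def)
  qed
  also have "{l\<in>{1..N}-{k}. l \<in> ?A \<union> ?X} = ?A \<union> ?X"
    using i by auto
  also have "card (?A \<union> ?X) = card ?A + card ?X"
    by (rule card_Un_disjoint) auto
  finally show ?thesis
    by (simp add: leg_eq[OF k])
qed

text \<open>The eigenvalue gap is the hook of the only box whose leg changes, and that hook grows by
  one.\<close>

lemma d_comp_swap:
  assumes \<alpha>: "\<alpha> > 0" and i: "1 \<le> i" "i < N" and g: "lookup \<eta> (Suc i) < lookup \<eta> i"
    and \<delta>: "\<delta> = eta_bar N \<alpha> \<eta> i - eta_bar N \<alpha> \<eta> (Suc i)"
  shows "d_comp N \<alpha> (act (tr i (Suc i)) \<eta>) = d_comp N \<alpha> \<eta> * ((\<delta> + 1) / \<delta>)" and "\<delta> > 1"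
proof -
  let ?s = "tr i (Suc i)" and ?\<mu> = "act (tr i (Suc i)) \<eta>" and ?b = "Suc (lookup \<eta> (Suc i))"
  have h: "\<delta> = hook N \<alpha> \<eta> i ?b"
    using eta_bar_diff[of i "Suc i" N \<eta> \<alpha>] i g \<delta> by simp
  show d1: "\<delta> > 1"
    using h \<alpha> by (simp add: hook_def add_pos_nonneg)
  have "d_comp N \<alpha> ?\<mu> = (\<Prod>k=1..N. \<Prod>j=1..lookup ?\<mu> (?s k). hook N \<alpha> ?\<mu> (?s k) j)"
    unfolding d_comp_hook by (rule prod.reindex_bij_betw[OF bij_betw_tr[OF i], symmetric])
  also have "\<dots> = (\<Prod>k=1..N. (\<Prod>j=1..lookup \<eta> k. hook N \<alpha> \<eta> k j) * (if k = i then (\<delta> + 1) / \<delta> else 1))"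
  proof (rule prod.cong)
    fix k assume k: "k \<in> {1..N}"
    have "hook N \<alpha> ?\<mu> (?s k) j = hook N \<alpha> \<eta> k j * (if j = ?b then if k = i then (\<delta> + 1) / \<delta> else 1 else 1)" for j
      using leg_swap[OF i g k, of j] h d1 by (auto simp: hook_def arm_def lookup_swap)
    then have "(\<Prod>j=1..lookup ?\<mu> (?s k). hook N \<alpha> ?\<mu> (?s k) j) =
      (\<Prod>j=1..lookup \<eta> k. hook N \<alpha> \<eta> k j) * (\<Prod>j=1..lookup \<eta> k. if j = ?b then if k = i then (\<delta> + 1) / \<delta> else 1 else 1)"
      by (simp only: prod.distrib lookup_swap transpose_involutory)
    also have "(\<Prod>j=1..lookup \<eta> k. if j = ?b then if k = i then (\<delta> + 1) / \<delta> else 1 else 1) = (if k = i then (\<delta> + 1) / \<delta> else 1)"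
      using g by (auto simp: prod.delta)
    finally show "(\<Prod>j=1..lookup ?\<mu> (?s k). hook N \<alpha> ?\<mu> (?s k) j) =
       (\<Prod>j=1..lookup \<eta> k. hook N \<alpha> \<eta> k j) * (if k = i then (\<delta> + 1) / \<delta> else 1)" .
  qed simp
  also have "\<dots> = d_comp N \<alpha> \<eta> * ((\<delta> + 1) / \<delta>)"
    unfolding prod.distrib d_comp_hook using i by simp
  finally show "d_comp N \<alpha> ?\<mu> = d_comp N \<alpha> \<eta> * ((\<delta> + 1) / \<delta>)" .
qed

section \<open>Existence and evaluation of nonsymmetric Jack polynomials\<close>

lemma composition_swap:
  assumes "1 \<le> i" "i < N" "composition N \<eta>"
  shows "composition N (act (tr i (Suc i)) \<eta>)"
  unfolding composition_def
proof
  fix k assume "k \<in> keys (act (tr i (Suc i)) \<eta>)"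
  then have "tr i (Suc i) k \<in> {1..N}"
    using assms(3) unfolding composition_def by (metis in_keys_iff lookup_swap subsetD)
  then show "k \<in> {1..N}"
    using tr_mem[OF assms(1,2), of "tr i (Suc i) k"] by simp
qed

lemma composition_support_pact_swap: 
  assumes "1 \<le> i" "i < N" "composition_support N f"
  shows "composition_support N (pact (tr i (Suc i)) f)"
  unfolding composition_support_def
proof
  fix \<nu> assume "\<nu> \<in> keys (pact (tr i (Suc i)) f)"
  then obtain \<kappa> where "\<kappa> \<in> keys f" "\<nu> = act (tr i (Suc i)) \<kappa>"
    using keys_pact[OF bij_transpose] by blast
  then show "composition N \<nu>"
    using composition_swap[OF assms(1,2)] assms(3) by (auto simp: composition_support_def)
qed

lemma act_swap_swap [simp]: "act (tr i j) (act (tr i j) \<eta>) = \<eta>"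
  by (rule poly_mapping_eqI) (simp add: lookup_swap)

lemma pact_swap_swap [simp]: "pact (tr i j) (pact (tr i j) f) = f"
  by (simp flip: pact_comp)

lemma lookup_pact_swap: "lookup (pact (tr i j) f) \<kappa> = lookup f (act (tr i j) \<kappa>)"
  by (simp add: lookup_pact)

text \<open>The coefficient is forced: applying the operator of index i to s E + c E produces an
  extra E from the Hecke relation, so c must satisfy c x_i + 1 = c x_{i+1} for the eigenvalues x of
  \<open>E\<close>.\<close>

lemma eigen_swap:
  assumes i: "1 \<le> i" "i < N" and E: "eigen N \<alpha> (eta_bar N \<alpha> \<mu>) E" and ne: "lookup \<mu> i \<noteq> lookup \<mu> (Suc i)"
    and \<delta>: "\<delta> = eta_bar N \<alpha> \<mu> (Suc i) - eta_bar N \<alpha> \<mu> i" "\<delta> \<noteq> 0"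
  shows "eigen N \<alpha> (eta_bar N \<alpha> (act (tr i (Suc i)) \<mu>)) (pact (tr i (Suc i)) E + Const (1 / \<delta>) * E)"
proof -
  let ?s = "tr i (Suc i)"
  let ?F = "pact ?s E + Const (1 / \<delta>) * E"
  have ev: "cherednik N \<alpha> j E = Const (eta_bar N \<alpha> \<mu> j) * E" if "j \<in> {1..N}" for j
    using E that by (simp add: eigen_def)
  have "cherednik N \<alpha> j ?F = Const (eta_bar N \<alpha> (act ?s \<mu>) j) * ?F" if j: "j \<in> {1..N}" for j
  proof -
    consider "j = i" | "j = Suc i" | "j \<noteq> i" "j \<noteq> Suc i" by blast
    then show ?thesis
    proof cases
      case 1
      have "Const (eta_bar N \<alpha> \<mu> (Suc i)) * Const (1 / \<delta>) = Const (1 / \<delta>) * Const (eta_bar N \<alpha> \<mu> i) + 1"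
        using \<delta> by (simp add: field_simps flip: Const_1 Const_add Const_mult)
      moreover have "cherednik N \<alpha> i ?F = Const (eta_bar N \<alpha> \<mu> (Suc i)) * pact ?s E + E
          + Const (1 / \<delta>) * (Const (eta_bar N \<alpha> \<mu> i) * E)"
        using i ev[of i] ev[of "Suc i"] cherednik_swap(1)[OF i, of \<alpha> E]
        by (simp add: cherednik_add cherednik_Const_mult pact_Const_mult)
      ultimately have "cherednik N \<alpha> i ?F = Const (eta_bar N \<alpha> \<mu> (Suc i)) * ?F"
        by (simp only: distrib_left mult.assoc[symmetric] distrib_right mult_1) (simp only: ac_simps)
      then show ?thesis
        using 1 eta_bar_swap[OF i j ne, of \<alpha>] by simp
    next
      case 2
      have "Const (1 / \<delta>) * Const (eta_bar N \<alpha> \<mu> (Suc i)) = Const (eta_bar N \<alpha> \<mu> i) * Const (1 / \<delta>) + 1"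
        using \<delta> by (simp add: field_simps flip: Const_1 Const_add Const_mult)
      moreover have "cherednik N \<alpha> (Suc i) ?F = Const (eta_bar N \<alpha> \<mu> i) * pact ?s E - E
          + Const (1 / \<delta>) * (Const (eta_bar N \<alpha> \<mu> (Suc i)) * E)"
        using i ev[of i] ev[of "Suc i"] cherednik_swap(2)[OF i, of \<alpha> E]
        by (simp add: cherednik_add cherednik_Const_mult pact_Const_mult)
      ultimately have "cherednik N \<alpha> (Suc i) ?F = Const (eta_bar N \<alpha> \<mu> i) * ?F"
        by (simp only: distrib_left mult.assoc[symmetric] distrib_right mult_1) simp
      then show ?thesis
        using 2 eta_bar_swap[OF i j ne, of \<alpha>] by simp
    next
      case 3
      then have "tr i (Suc i) j = j" by simp
      then show ?thesis
        using 3 i j ev[of j] eta_bar_swap[OF i j ne, of \<alpha>] swap_cherednik_other[of j i N \<alpha> E]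
        by (simp add: cherednik_add cherednik_Const_mult pact_Const_mult) (simp add: algebra_simps)
    qed
  qed
  moreover have "composition_support N ?F"
    using E i by (intro composition_support_add composition_support_Const_mult composition_support_pact_swap) (auto simp: eigen_def)
  ultimately show ?thesis
    by (simp add: eigen_def)
qed

lemma lookup_E_swap_less:
  assumes i: "1 \<le> i" "i < N" and "composition N \<mu>" and E: "monic_triangular N \<mu> E" and lt: "lookup \<mu> i < lookup \<mu> (Suc i)"
  shows "lookup E (act (tr i (Suc i)) \<mu>) = 0"
proof -
  let ?\<eta> = "act (tr i (Suc i)) \<mu>"
  have "comp_prec N \<mu> ?\<eta>"
    using assms by (intro comp_prec_swap[of N ?\<eta> i "Suc i"] composition_swap) (auto simp: lookup_swap)
  then have "\<not> (?\<eta> = \<mu> \<or> comp_prec N ?\<eta> \<mu>)"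
    using comp_prec_irrefl comp_prec_trans by metis
  then show ?thesis
    using E unfolding monic_triangular_def by (metis in_keys_iff)
qed

lemma zero_cases:
  assumes "composition N \<eta>" "lookup \<eta> N = 0" "\<eta> \<noteq> 0"
  obtains i where "1 \<le> i" "i < N" "lookup \<eta> i > 0" "lookup \<eta> (Suc i) = 0"
proof -
  let ?A = "{i. lookup \<eta> i \<noteq> 0}"
  have ne: "?A \<noteq> {}"
    using assms(3) by (metis (mono_tags, lifting) empty_Collect_eq lookup_zero poly_mapping_eqI)
  have fin: "finite ?A" by simp
  have "Max ?A \<in> ?A" by (rule Max_in[OF fin ne])
  then have m: "lookup \<eta> (Max ?A) \<noteq> 0" by simp
  then have "Max ?A \<in> {1..N}"
    using assms(1) unfolding composition_def by (metis in_keys_iff subsetD)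
  moreover have "Max ?A \<noteq> N" using m assms(2) by metis
  moreover have "lookup \<eta> (Suc (Max ?A)) = 0"
    using Max_ge[OF fin, of "Suc (Max ?A)"] by fastforce
  ultimately show ?thesis using that[of "Max ?A"] m by auto
qed

text \<open>Existence and value are proved together, since each construction step changes the value
  at (1, ..., 1) by a known scalar that \<open>eprod\<close> / \<open>d_comp\<close>
  follows.\<close>

lemma exists_jack:
  assumes N: "1 \<le> N" and \<alpha>: "\<alpha> > 0"
  shows "composition N \<eta> \<Longrightarrow> \<exists>E. eigen N \<alpha> (eta_bar N \<alpha> \<eta>) E \<and> lookup E \<eta> = 1 \<and>
    ev1 E = eprod N \<alpha> \<eta> / d_comp N \<alpha> \<eta>"
\<comment> \<open>Inverting \<open>PhiC\<close> lowers the weight if the last entry is positive.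
  Otherwise a positive entry is moved right past a zero, which keeps the weight and lowers the
  second measure.\<close>
proof (induction \<eta> rule: wf_induct_rule[OF wf_measures[of "[weight N, \<lambda>\<eta>. \<Sum>j=1..N. lookup \<eta> j * (N - j)]"]])
  case (1 \<eta>)
  note IH = 1(1) and \<eta> = 1(2)
  consider "\<eta> = 0" | "lookup \<eta> N > 0" | "lookup \<eta> N = 0" "\<eta> \<noteq> 0" by auto
  then show ?case
  proof cases
    case 1
    have "{k. Suc 0 \<le> k \<and> k < i} = {1..<i}" for i by auto
    then have "eta_bar N \<alpha> 0 i = 1 - real i" if "i \<in> {1..N}" for i
      using that by (simp add: eta_bar_def of_nat_diff)
    moreover have "eul i 1 = 0" for i
      using eul_monom[of i 0] by (simp del: eul_monom)
    moreover have "ddiff i j 1 = 0" if "i \<noteq> j" for i j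
      using that by (intro ddiff_unique) auto
    ultimately have "eigen N \<alpha> (eta_bar N \<alpha> \<eta>) 1"
      using 1 by (auto simp: eigen_def composition_support_def composition_def cherednik_eq)
    moreover have "ev1 1 = eprod N \<alpha> \<eta> / d_comp N \<alpha> \<eta>"
      using 1 by (simp add: eprod_def weight_def d_comp_def)
    ultimately show ?thesis
      using 1 by (auto intro!: exI[of _ 1])
  next
    case 2
    \<comment> \<open>Inverse of \<open>PhiC\<close>: remove a box from the last entry, then rotate
      it to the front.\<close>
    define \<nu> where "\<nu> = act (inv (cyc N)) (\<eta> - single N 1)"
    have "\<eta> - single N 1 + single N 1 = \<eta>"
      using 2 by (intro poly_mapping_eqI) (auto simp: lookup_add lookup_minus lookup_single when_def)
    then have P: "PhiC N \<nu> = \<eta>"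
      by (simp add: PhiC_def \<nu>_def act_act_inv[OF bij_cyc])
    have "composition N \<nu>"
      unfolding composition_def
    proof
      fix k assume k: "k \<in> keys \<nu>"
      then have l: "lookup \<eta> (cyc N k) \<noteq> 0"
        by (auto simp: \<nu>_def in_keys_iff lookup_act bij_imp_bij_inv bij_cyc inv_inv_eq lookup_minus lookup_single when_def split: if_splits)
      show "k \<in> {1..N}"
      proof (rule ccontr)
        assume n: "k \<notin> {1..N}"
        then have "cyc N k = k" by (auto simp: cyc_def)
        with l n \<eta> show False
          unfolding composition_def by (metis in_keys_iff subsetD)
      qed
    qed
    moreover have "weight N \<nu> < weight N \<eta>"
      using weight_PhiC[OF N, of \<nu>] P by simp
    ultimately obtain E where E: "eigen N \<alpha> (eta_bar N \<alpha> \<nu>) E" "lookup E \<nu> = 1"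
       "ev1 E = eprod N \<alpha> \<nu> / d_comp N \<alpha> \<nu>"
      using IH[of \<nu>] by auto
    have "eigen N \<alpha> (eta_bar N \<alpha> \<eta>) (Phi N E)"
      using eigen_Phi[OF N E(1)] P by simp
    moreover have "lookup (Phi N E) \<eta> = 1"
      using lookup_Phi[of N E \<nu>] E P by simp
    moreover have "ev1 (Phi N E) = eprod N \<alpha> \<eta> / d_comp N \<alpha> \<eta>"
    proof -
      have "eta_bar N \<alpha> \<nu> 1 + \<alpha> + real N \<noteq> 0"
        using d_comp_PhiC[OF N, of \<alpha> \<nu>] d_comp_pos[OF \<alpha>, of N \<eta>] P by auto
      then show ?thesis
        using eprod_PhiC[OF N \<open>composition N \<nu>\<close>, of \<alpha>] d_comp_PhiC[OF N, of \<alpha> \<nu>] P E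
        by (simp add: Phi_def ev1_mult ev1_pact)
    qed
    ultimately show ?thesis by blast
  next
    case 3
    then obtain i where i: "1 \<le> i" "i < N" "lookup \<eta> i > 0" "lookup \<eta> (Suc i) = 0"
      using zero_cases[OF \<eta>] by blast
    let ?s = "tr i (Suc i)"
    define \<mu> where "\<mu> = act ?s \<eta>"
    have \<mu>: "composition N \<mu>" "act ?s \<mu> = \<eta>"
      using i \<eta> by (auto simp: \<mu>_def composition_swap)
    have w: "weight N \<mu> = weight N \<eta>"
      unfolding weight_def \<mu>_def lookup_swap by (rule sum.reindex_bij_betw[OF bij_betw_tr[OF i(1,2)]])
    have "(\<Sum>j=1..N. lookup \<mu> j * (N - j)) = (\<Sum>j=1..N. lookup \<mu> (?s j) * (N - ?s j))"
      by (rule sum.reindex_bij_betw[OF bij_betw_tr[OF i(1,2)], symmetric])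
    also have "\<dots> < (\<Sum>j=1..N. lookup \<eta> j * (N - j))"
    proof (rule sum_strict_mono_ex1)
      show "\<forall>j\<in>{1..N}. lookup \<mu> (?s j) * (N - ?s j) \<le> lookup \<eta> j * (N - j)"
        using i by (auto simp: \<mu>_def lookup_swap) (auto simp: Transposition.transpose_def intro!: mult_le_mono2)
      show "\<exists>j\<in>{1..N}. lookup \<mu> (?s j) * (N - ?s j) < lookup \<eta> j * (N - j)"
        using i by (intro bexI[of _ i]) (auto simp: \<mu>_def lookup_swap)
    qed simp
    finally obtain E where E: "eigen N \<alpha> (eta_bar N \<alpha> \<mu>) E" "lookup E \<mu> = 1"
       "ev1 E = eprod N \<alpha> \<mu> / d_comp N \<alpha> \<mu>"
      using IH[of \<mu>] \<mu> w by auto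
    define \<delta> where "\<delta> = eta_bar N \<alpha> \<eta> i - eta_bar N \<alpha> \<eta> (Suc i)"
    have d: "d_comp N \<alpha> \<mu> = d_comp N \<alpha> \<eta> * ((\<delta> + 1) / \<delta>)" and d1: "\<delta> > 1"
      using d_comp_swap[OF \<alpha> i(1,2) _ \<delta>_def] i by (auto simp: \<mu>_def)
    have ne: "lookup \<mu> i \<noteq> lookup \<mu> (Suc i)"
      using i by (auto simp: \<mu>_def lookup_swap)
    have \<delta>': "\<delta> = eta_bar N \<alpha> \<mu> (Suc i) - eta_bar N \<alpha> \<mu> i"
      using eta_bar_swap[OF i(1,2) _ ne, of i \<alpha>] eta_bar_swap[OF i(1,2) _ ne, of "Suc i" \<alpha>] \<mu> i
      by (simp add: \<delta>_def)
    have ep: "eprod N \<alpha> \<mu> = eprod N \<alpha> \<eta>"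
    proof -
      have "sort_comp N \<mu> = sort_comp N \<eta>"
        by (rule sort_comp_cong[OF bij_betw_tr[OF i(1,2)]]) (simp add: \<mu>_def lookup_swap)
      then show ?thesis by (metis eprod_sort)
    qed
    let ?F = "pact ?s E + Const (1 / \<delta>) * E"
    have "eigen N \<alpha> (eta_bar N \<alpha> \<eta>) ?F"
      using eigen_swap[OF i(1,2) E(1) ne \<delta>'] d1 \<mu> by simp
    moreover have "lookup ?F \<eta> = 1"
    proof -
      have "lookup E \<eta> = 0"
        using lookup_E_swap_less[OF i(1,2) \<mu>(1) eigen_monic_triangular[OF \<alpha> \<mu>(1) E(1,2)]] i \<mu>
        by (simp add: \<mu>_def lookup_swap)
      then show ?thesis
        using E by (simp add: lookup_add lookup_Const_mult lookup_pact_swap flip: \<mu>_def)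
    qed
    moreover have "ev1 ?F = eprod N \<alpha> \<eta> / d_comp N \<alpha> \<eta>"
    proof -
      \<comment> \<open>The factor 1 + 1/\<delta> is the ratio by which the hook product of
        \<open>\<mu>\<close> exceeds that of \<open>\<eta>\<close>.\<close>
      have "ev1 ?F = ev1 E + 1 / \<delta> * ev1 E"
        by (simp only: ev1_add ev1_pact ev1_Const_mult)
      also have "\<dots> = eprod N \<alpha> \<eta> / d_comp N \<alpha> \<eta>"
        unfolding E(3) ep d using d1 d_comp_pos[OF \<alpha>, of N \<eta>] by (simp add: divide_simps) (simp add: algebra_simps)
      finally show ?thesis .
    qed
    ultimately show ?thesis by blast
  qed
qed

lemma nonsym_jack_props:
  assumes N: "1 \<le> N" and \<alpha>: "\<alpha> > 0" and \<eta>: "composition N \<eta>"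
  shows nonsym_jack_eigen: "eigen N \<alpha> (eta_bar N \<alpha> \<eta>) (nonsym_jack N \<alpha> \<eta>)"
    and lookup_nonsym_jack: "lookup (nonsym_jack N \<alpha> \<eta>) \<eta> = 1"
    and ev1_nonsym_jack: "ev1 (nonsym_jack N \<alpha> \<eta>) = eprod N \<alpha> \<eta> / d_comp N \<alpha> \<eta>"
    and nonsym_jack_triangular: "monic_triangular N \<eta> (nonsym_jack N \<alpha> \<eta>)"
  using exists_jack[OF N \<alpha> \<eta>] nonsym_jack_eqI[OF \<alpha> \<eta>] eigen_monic_triangular[OF \<alpha> \<eta>] by metis+

lemma nonsym_jack_swap:
  assumes N: "1 \<le> N" and \<alpha>: "\<alpha> > 0" and \<mu>: "composition N \<mu>" and i: "1 \<le> i" "i < N"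
    and lt: "lookup \<mu> i < lookup \<mu> (Suc i)" and \<delta>: "\<delta> = eta_bar N \<alpha> \<mu> (Suc i) - eta_bar N \<alpha> \<mu> i"
  shows "nonsym_jack N \<alpha> (act (tr i (Suc i)) \<mu>) =
     pact (tr i (Suc i)) (nonsym_jack N \<alpha> \<mu>) + Const (1 / \<delta>) * nonsym_jack N \<alpha> \<mu>"
proof (rule nonsym_jack_eqI[OF \<alpha>])
  have "\<delta> > 0"
    unfolding \<delta> using i lt by (simp add: eta_bar_less[OF \<alpha>] before_def)
  then show "eigen N \<alpha> (eta_bar N \<alpha> (act (tr i (Suc i)) \<mu>))
      (pact (tr i (Suc i)) (nonsym_jack N \<alpha> \<mu>) + Const (1 / \<delta>) * nonsym_jack N \<alpha> \<mu>)"
    using lt by (intro eigen_swap[OF i _ _ \<delta>] nonsym_jack_eigen N \<alpha> \<mu>) auto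
  show "lookup (pact (tr i (Suc i)) (nonsym_jack N \<alpha> \<mu>) + Const (1 / \<delta>) * nonsym_jack N \<alpha> \<mu>) (act (tr i (Suc i)) \<mu>) = 1"
    using lookup_E_swap_less[OF i \<mu> nonsym_jack_triangular[OF N \<alpha> \<mu>] lt] lookup_nonsym_jack[OF N \<alpha> \<mu>]
    by (simp add: lookup_add lookup_Const_mult lookup_pact_swap)
qed (use \<mu> i in \<open>simp add: composition_swap\<close>)

lemma eta_bar_adjacent:
  assumes "1 \<le> i" "i < N" "lookup \<mu> i = lookup \<mu> (Suc i)"
  shows "eta_bar N \<alpha> \<mu> i = eta_bar N \<alpha> \<mu> (Suc i) + 1"
proof -
  have "{k\<in>{1..N}. before \<mu> k (Suc i)} = insert i {k\<in>{1..N}. before \<mu> k i}"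
    using assms by (auto simp: before_def)
  then have "card {k\<in>{1..N}. before \<mu> k (Suc i)} = Suc (card {k\<in>{1..N}. before \<mu> k i})"
    by (simp add: before_irrefl)
  then show ?thesis
    using assms eta_bar_before[of i N \<alpha> \<mu>] eta_bar_before[of "Suc i" N \<alpha> \<mu>] by simp
qed

text \<open>The difference s E - E is an eigenfunction with eigenvalues i and i + 1 exchanged. A
  composition with that spectrum would again have equal entries at i and i + 1, but then its
  eigenvalue at i would be the larger one, contrary to the exchange; so the difference
  vanishes.\<close>

lemma nonsym_jack_swap_fixed:
  assumes N: "1 \<le> N" and \<alpha>: "\<alpha> > 0" and \<mu>: "composition N \<mu>" and i: "1 \<le> i" "i < N"
    and eq: "lookup \<mu> i = lookup \<mu> (Suc i)"
  shows "pact (tr i (Suc i)) (nonsym_jack N \<alpha> \<mu>) = nonsym_jack N \<alpha> \<mu>"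
proof -
  let ?E = "nonsym_jack N \<alpha> \<mu>" and ?s = "tr i (Suc i)"
  let ?F = "pact ?s ?E - ?E"
  have E: "eigen N \<alpha> (eta_bar N \<alpha> \<mu>) ?E"
    by (rule nonsym_jack_eigen[OF N \<alpha> \<mu>])
  have ev: "cherednik N \<alpha> j ?E = Const (eta_bar N \<alpha> \<mu> j) * ?E" if "j \<in> {1..N}" for j
    using E that by (simp add: eigen_def)
  have b: "eta_bar N \<alpha> \<mu> i = eta_bar N \<alpha> \<mu> (Suc i) + 1"
    by (rule eta_bar_adjacent[OF i eq])
  have "cherednik N \<alpha> j ?F = Const (eta_bar N \<alpha> \<mu> (?s j)) * ?F" if j: "j \<in> {1..N}" for j
  proof -
    consider "j = i" | "j = Suc i" | "j \<noteq> i" "j \<noteq> Suc i" by blast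
    then show ?thesis
    proof cases
      case 1
      then show ?thesis
        using i ev[of i] ev[of "Suc i"] b cherednik_swap(1)[OF i, of \<alpha> ?E]
        by (simp add: cherednik_diff pact_Const_mult Const_add) (simp add: pact_add pact_Const_mult algebra_simps)
    next
      case 2
      have "cherednik N \<alpha> (Suc i) (pact ?s ?E) = Const (eta_bar N \<alpha> \<mu> i) * pact ?s ?E - ?E"
        using i ev[of i] cherednik_swap(2)[OF i, of \<alpha> ?E] by (simp add: pact_Const_mult)
      then show ?thesis
        using 2 i ev[of "Suc i"] b by (simp add: cherednik_diff Const_add) (simp add: algebra_simps)
    next
      case 3
      then have "tr i (Suc i) j = j" by simp
      then show ?thesis
        using 3 i j ev[of j] swap_cherednik_other[of j i N \<alpha> ?E]
        by (simp add: cherednik_diff pact_Const_mult) (simp add: algebra_simps)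
    qed
  qed
  moreover have "composition_support N ?F"
    using E i by (intro composition_support_diff composition_support_pact_swap) (auto simp: eigen_def)
  ultimately have "eigen N \<alpha> (\<lambda>j. eta_bar N \<alpha> \<mu> (?s j)) ?F"
    by (simp add: eigen_def)
  then have "?F = 0"
  proof (rule eigen_not_eta_bar)
    fix \<nu>
    show "\<exists>j\<in>{1..N}. eta_bar N \<alpha> \<mu> (?s j) \<noteq> eta_bar N \<alpha> \<nu> j" if \<nu>: "composition N \<nu>"
    proof (rule ccontr)
      assume "\<not> (\<exists>j\<in>{1..N}. eta_bar N \<alpha> \<mu> (?s j) \<noteq> eta_bar N \<alpha> \<nu> j)"
      then have e: "eta_bar N \<alpha> \<mu> (?s j) = eta_bar N \<alpha> \<nu> j" if "j \<in> {1..N}" for j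
        using that by blast
      have "before \<nu> k j \<longleftrightarrow> before \<mu> (?s k) (?s j)" if "k \<in> {1..N}" "j \<in> {1..N}" for k j
        using eta_bar_less_iff[OF \<alpha>, of j N k \<nu>] eta_bar_less_iff[OF \<alpha>, of "?s j" N "?s k" \<mu>] e that tr_mem[OF i] by metis
      then have "card {k\<in>{1..N}. before \<mu> k (?s j)} = card {k\<in>{1..N}. before \<nu> k j}" if "j \<in> {1..N}" for j
        using that by (intro card_bij_Collect[OF bij_betw_tr[OF i]]) auto
      then have "lookup \<nu> j = lookup \<mu> (?s j)" if "j \<in> {1..N}" for j
        using e[OF that] that \<alpha> eta_bar_before[of j N \<alpha> \<nu>] eta_bar_before[of "?s j" N \<alpha> \<mu>] tr_mem[OF i that] by simp
      then have "lookup \<nu> i = lookup \<nu> (Suc i)"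
        using i eq by simp
      then have "eta_bar N \<alpha> \<nu> i = eta_bar N \<alpha> \<nu> (Suc i) + 1"
        by (rule eta_bar_adjacent[OF i])
      then show False
        using e[of i] e[of "Suc i"] b i by simp
    qed
  qed
  then show ?thesis by simp
qed

section \<open>Parabolic subgroups\<close>

lemma word_perm_Nil [simp]: "word_perm [] = id"
  and word_perm_Cons [simp]: "word_perm (j # js) = tr j (Suc j) \<circ> word_perm js"
  by (simp_all add: word_perm_def)

lemma word_perm_append: "word_perm (js @ ks) = word_perm js \<circ> word_perm ks"
  by (induction js) (auto simp: o_assoc)

lemma bij_word_perm: "bij (word_perm js)"
proof (induction js)
  case (Cons j js)
  then show ?case
    unfolding word_perm_Cons by (rule bij_comp[OF _ bij_transpose])
qed (unfold word_perm_Nil, rule bij_id)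

lemma word_perm_rev: "word_perm (rev js) \<circ> word_perm js = id"
proof (induction js)
  case (Cons j js)
  have "word_perm (rev (j # js)) \<circ> word_perm (j # js) = word_perm (rev js) \<circ> ((tr j (Suc j) \<circ> tr j (Suc j)) \<circ> word_perm js)"
    by (simp only: rev.simps word_perm_append word_perm_Cons word_perm_Nil comp_id o_assoc)
  with Cons show ?case by (simp only: transpose_comp_involutory id_comp)
qed simp

lemma W_id: "id \<in> W K"
  unfolding W_def by (rule CollectI, rule exI[of _ "[]"]) simp

lemma W_Cons: "k \<in> K \<Longrightarrow> w \<in> W K \<Longrightarrow> tr k (Suc k) \<circ> w \<in> W K"
  unfolding W_def by (clarsimp, rule_tac x = "k # js" in exI) simp

lemma W_generator: "k \<in> K \<Longrightarrow> tr k (Suc k) \<in> W K"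
  using W_Cons[OF _ W_id] by simp

lemma W_comp: "v \<in> W K \<Longrightarrow> w \<in> W K \<Longrightarrow> v \<circ> w \<in> W K"
  unfolding W_def by (clarsimp, rule_tac x = "js @ jsa" in exI) (simp add: word_perm_append)

lemma W_bij: "w \<in> W K \<Longrightarrow> bij w"
  unfolding W_def using bij_word_perm by auto

lemma W_inv: "w \<in> W K \<Longrightarrow> inv w \<in> W K"
proof -
  assume "w \<in> W K"
  then obtain js where js: "set js \<subseteq> K" "w = word_perm js" by (auto simp: W_def)
  have "inv w = word_perm (rev js)"
    using word_perm_rev[of js] word_perm_rev[of "rev js"] js by (intro inv_unique_comp) auto
  then show ?thesis
    unfolding W_def using js by (intro CollectI exI[of _ "rev js"]) auto
qed

lemma W_induct [consumes 1, case_names id step]: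
  assumes "w \<in> W K" "P id" "\<And>k w. k \<in> K \<Longrightarrow> w \<in> W K \<Longrightarrow> P w \<Longrightarrow> P (tr k (Suc k) \<circ> w)"
  shows "P w"
proof -
  obtain js where "set js \<subseteq> K" "w = word_perm js" using assms(1) by (auto simp: W_def)
  moreover have "set js \<subseteq> K \<Longrightarrow> P (word_perm js)"
  proof (induction js)
    case (Cons j js)
    moreover have "word_perm js \<in> W K"
      using Cons by (auto simp: W_def)
    ultimately show ?case
      unfolding word_perm_Cons by (intro assms(3)) simp_all
  qed (use assms(2) in \<open>simp only: word_perm_Nil\<close>)
  ultimately show ?thesis by simp
qed

lemma tr_image_atMost: "q \<noteq> k \<Longrightarrow> tr k (Suc k) ` {..q} = {..q}"
  by (rule transpose_image_eq) auto

text \<open>A generator crosses the cut between q and q + 1 only if it is the one with index q.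
  Together with the converse below, this describes \<open>W K\<close> by invariant initial segments
  instead of words.\<close>

lemma W_cut: "w \<in> W K \<Longrightarrow> q \<notin> K \<Longrightarrow> w ` {..q} = {..q}"
proof (induction rule: W_induct)
  case (step k w)
  then have "k \<noteq> q" by auto
  have "(tr k (Suc k) \<circ> w) ` {..q} = tr k (Suc k) ` (w ` {..q})"
    by (simp only: image_comp)
  also have "\<dots> = {..q}"
    using step \<open>k \<noteq> q\<close> tr_image_atMost[of q k] by auto
  finally show ?case .
qed simp

lemma strict_mono_bij_nat:
  assumes "bij (w :: nat \<Rightarrow> nat)" "strict_mono w" shows "w = id"
proof -
  have "strict_mono (inv w)"
  proof (rule strict_monoI, rule ccontr)
    fix x y :: nat assume "x < y" and "\<not> inv w x < inv w y"
    then have "w (inv w y) \<le> w (inv w x)"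
      using strict_mono_less_eq[OF assms(2)] by simp
    with \<open>x < y\<close> show False
      using surj_f_inv_f[OF bij_is_surj[OF assms(1)]] by simp
  qed
  have "w x = x" for x
    using strict_mono_imp_increasing[OF assms(2), of x] strict_mono_imp_increasing[OF \<open>strict_mono (inv w)\<close>, of "w x"] assms(1)
    by (simp add: bij_is_inj)
  then show ?thesis by auto
qed

text \<open>Bubble sort: composing with the transposition at a descent keeps the invariant cuts and
  raises the sum of x w(x), which is bounded. A bijection without descents is the identity.\<close>

lemma cut_W:
  assumes K: "K \<subseteq> {1..N - 1}"
  shows "bij w \<Longrightarrow> (\<And>q. q \<notin> K \<Longrightarrow> w ` {..q} = {..q}) \<Longrightarrow> w \<in> W K"
proof (induction "N * N * Suc N - (\<Sum>x\<le>N. x * w x)" arbitrary: w rule: less_induct)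
  case less
  show ?case
  proof (cases "\<forall>k. w k < w (Suc k)")
    case True
    then have "w = id"
      using less by (intro strict_mono_bij_nat) (auto simp: strict_mono_Suc_iff)
    then show ?thesis using W_id by simp
  next
    case False
    then obtain k where "\<not> w k < w (Suc k)" by auto
    moreover have "w k \<noteq> w (Suc k)"
      using less(2) bij_is_inj[THEN injD, of w k "Suc k"] by auto
    ultimately have k: "w (Suc k) < w k" by simp
    \<comment> \<open>No descent sits at a cut: if k were outside \<open>K\<close>, then w would
      preserve {..k}, forcing w(k) below w(k + 1).\<close>
    have kK: "k \<in> K"
    proof (rule ccontr)
      assume "k \<notin> K"
      then have c: "w ` {..k} = {..k}" by (rule less(3))
      then have "w k \<le> k" by (metis atMost_iff imageI order_refl)
      then have "w (Suc k) \<in> w ` {..k}" using k c by simp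
      then have "Suc k \<in> {..k}"
        using bij_is_inj[OF less(2)] by (simp only: inj_image_mem_iff)
      then show False by simp
    qed
    then have kN: "k < N" "1 \<le> k" using K by force+
    define v where "v = w \<circ> tr k (Suc k)"
    have NK: "w ` {..N} = {..N}"
      using K by (intro less(3)) force
    then have wN: "w x \<le> N" if "x \<le> N" for x
      using that by (metis atMost_iff imageI)
    have vN: "v x \<le> N" if "x \<le> N" for x
      using that kN wN by (auto simp: v_def Transposition.transpose_def)
    have bound: "(\<Sum>x\<le>N. x * v x) \<le> N * N * Suc N"
    proof -
      have "(\<Sum>x\<le>N. x * v x) \<le> (\<Sum>x\<le>N. N * N)"
        using vN by (intro sum_mono mult_le_mono) auto
      then show ?thesis by (simp add: algebra_simps)
    qed
    have "(\<Sum>x\<le>N. x * w x) < (\<Sum>x\<le>N. x * v x)"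
    proof -
      have d: "{..N} = insert k (insert (Suc k) ({..N} - {k, Suc k}))"
        using kN by auto
      have s: "(\<Sum>x\<le>N. x * u x) = k * u k + Suc k * u (Suc k) + (\<Sum>x\<in>{..N} - {k, Suc k}. x * u x)" for u
        by (subst d) (simp add: add.assoc)
      have e: "(\<Sum>x\<in>{..N} - {k, Suc k}. x * v x) = (\<Sum>x\<in>{..N} - {k, Suc k}. x * w x)"
        by (rule sum.cong) (auto simp: v_def)
      show ?thesis
        unfolding s[of w] s[of v] e using k by (simp add: v_def)
    qed
    moreover have "bij v"
      unfolding v_def by (rule bij_comp) (use less in auto)
    moreover have "v ` {..q} = {..q}" if "q \<notin> K" for q
    proof -
      have "v ` {..q} = w ` (tr k (Suc k) ` {..q})"
        unfolding v_def by (simp only: image_comp)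
      moreover have "q \<noteq> k" using that kK by blast
      ultimately show ?thesis
        using less(3)[OF that] tr_image_atMost by metis
    qed
    ultimately have "v \<in> W K"
      using bound by (intro less(1)) auto
    moreover have "w = v \<circ> tr k (Suc k)"
      by (simp add: v_def fun_eq_iff)
    ultimately show ?thesis
      using W_comp W_generator[OF kK] by metis
  qed
qed

lemma W_fix: "w \<in> W K \<Longrightarrow> x \<notin> K \<Longrightarrow> x = 0 \<or> x - 1 \<notin> K \<Longrightarrow> w x = x"
proof -
  assume w: "w \<in> W K" and x: "x \<notin> K" "x = 0 \<or> x - 1 \<notin> K"
  have 1: "w ` {..x} = {..x}" using W_cut w x by auto
  show ?thesis
  proof (cases "x = 0")
    case True
    then show ?thesis using 1 by auto
  next
    case False
    then have 2: "w ` {..x - 1} = {..x - 1}" using W_cut w x by auto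
    have "w x \<le> x" using 1 by (metis atMost_iff imageI order_refl)
    moreover have "w x \<notin> w ` {..x - 1}"
      using bij_is_inj[OF W_bij[OF w]] False by (simp add: inj_image_mem_iff)
    ultimately show ?thesis using 2 by simp
  qed
qed

lemma bij_permutesI: "bij w \<Longrightarrow> (\<And>x. x \<notin> S \<Longrightarrow> w x = x) \<Longrightarrow> w permutes S"
  unfolding permutes_def bij_iff by simp

lemma W_permutes: "K \<subseteq> {1..N - 1} \<Longrightarrow> w \<in> W K \<Longrightarrow> w permutes {1..N}"
proof -
  assume K: "K \<subseteq> {1..N - 1}" and w: "w \<in> W K"
  have "w x = x" if "x \<notin> {1..N}" for x
    using that K by (intro W_fix[OF w]) force+
  then show ?thesis
    by (intro bij_permutesI W_bij[OF w])
qed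

lemma finite_W: "K \<subseteq> {1..N - 1} \<Longrightarrow> finite (W K)"
  by (rule finite_subset[OF _ finite_permutations[of "{1..N}"]]) (use W_permutes in blast)+

lemma W_image: "K \<subseteq> {1..N - 1} \<Longrightarrow> w \<in> W K \<Longrightarrow> w ` {1..N} = {1..N}"
  using W_permutes permutes_image by metis

text \<open>Such a permutation splits uniquely into its restriction to one set and its restriction
  to the union of the others.\<close>

lemma card_family_perms:
  assumes "finite F" "\<And>A. A \<in> F \<Longrightarrow> finite A" "\<And>A B. A \<in> F \<Longrightarrow> B \<in> F \<Longrightarrow> A \<noteq> B \<Longrightarrow> A \<inter> B = {}"
  shows "card {w. w permutes \<Union>F \<and> (\<forall>A\<in>F. w ` A = A)} = (\<Prod>A\<in>F. fact (card A))"
  using assms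
proof (induction F)
  case empty
  have "{w. w permutes {}} = {id :: 'a \<Rightarrow> 'a}" by auto
  then show ?case by simp
next
  case (insert A F)
  let ?G = "{v. v permutes \<Union>F \<and> (\<forall>A\<in>F. v ` A = A)}"
  have dis: "A \<inter> B = {}" if "B \<in> F" for B
    using insert that by blast
  then have disU: "A \<inter> \<Union>F = {}" by blast
  have "bij_betw (\<lambda>(u, v). u \<circ> v) ({u. u permutes A} \<times> ?G)
     {w. w permutes \<Union>(insert A F) \<and> (\<forall>B\<in>insert A F. w ` B = B)}"
  proof (rule bij_betw_byWitness[where f' = "\<lambda>w. (restrict_id w A, restrict_id w (\<Union>F))"])
    have key: "(u \<circ> v) ` A = A \<and> (\<forall>B\<in>F. (u \<circ> v) ` B = B)" if "u permutes A" "v \<in> ?G" for u v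
    proof -
      have "v x = x" if "x \<in> A" for x
        using \<open>v \<in> ?G\<close> that disU by (intro permutes_not_in[of v "\<Union>F"]) auto
      then have "v ` A = A"
        by (simp cong: image_cong_simp)
      moreover have "u ` B = B" if "B \<in> F" for B
      proof -
        have "u x = x" if "x \<in> B" for x
          using \<open>u permutes A\<close> dis[OF \<open>B \<in> F\<close>] that by (intro permutes_not_in[of u A]) auto
        then show ?thesis
          by (simp cong: image_cong_simp)
      qed
      ultimately show ?thesis
        using that(1) permutes_image[OF that(1)] that(2) unfolding image_comp[symmetric] by simp
    qed
    show "(\<lambda>(u, v). u \<circ> v) ` ({u. u permutes A} \<times> ?G) \<subseteq> {w. w permutes \<Union>(insert A F) \<and> (\<forall>B\<in>insert A F. w ` B = B)}"
    proof clarify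
      fix u v assume uv: "u permutes A" "v permutes \<Union>F" "\<forall>B\<in>F. v ` B = B"
      have "u permutes \<Union>(insert A F)" "v permutes \<Union>(insert A F)"
        by (rule permutes_subset[OF uv(1)], blast) (rule permutes_subset[OF uv(2)], blast)
      then show "u \<circ> v permutes \<Union>(insert A F) \<and> (\<forall>B\<in>insert A F. (u \<circ> v) ` B = B)"
        using key[OF uv(1), of v] uv(2,3) permutes_compose[of v _ u] by simp
    qed
    have r: "restrict_id w B permutes B" if "w permutes C" "w ` B = B" for w :: "'a \<Rightarrow> 'a" and B C
      using that by (intro permutes_restrict_id)
        (auto simp: bij_betw_def intro: inj_on_subset[OF permutes_inj])
    show "(\<lambda>w. (restrict_id w A, restrict_id w (\<Union>F))) `
       {w. w permutes \<Union>(insert A F) \<and> (\<forall>B\<in>insert A F. w ` B = B)} \<subseteq> {u. u permutes A} \<times> ?G"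
    proof (rule image_subsetI)
      fix w assume "w \<in> {w. w permutes \<Union>(insert A F) \<and> (\<forall>B\<in>insert A F. w ` B = B)}"
      then have w: "w permutes \<Union>(insert A F)" "\<forall>B\<in>insert A F. w ` B = B" by simp_all
      have "w ` \<Union>F = \<Union>F"
        using w(2) by (auto simp: image_iff) (metis imageI, metis imageE)
      moreover have "restrict_id w (\<Union>F) ` B = w ` B" if "B \<in> F" for B
        using that by (intro image_cong) (auto simp: restrict_id_def)
      ultimately show "(restrict_id w A, restrict_id w (\<Union>F)) \<in> {u. u permutes A} \<times> ?G"
        using w r[OF w(1)] by auto
    qed
    show "\<forall>p\<in>{u. u permutes A} \<times> ?G. (\<lambda>w. (restrict_id w A, restrict_id w (\<Union>F))) ((\<lambda>(u, v). u \<circ> v) p) = p"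
    proof clarify
      fix u v assume uv: "u permutes A" "v permutes \<Union>F" "\<forall>B\<in>F. v ` B = B"
      have vF: "v x \<in> \<Union>F" if "x \<in> \<Union>F" for x
        using uv(2) that by (simp only: permutes_in_image)
      have vA: "v x = x" if "x \<in> A" for x
        using that disU by (intro permutes_not_in[OF uv(2)]) blast
      have uF: "u x = x" if "x \<in> \<Union>F" for x
        using that disU by (intro permutes_not_in[OF uv(1)]) blast
      show "restrict_id (u \<circ> v) A = u \<and> restrict_id (u \<circ> v) (\<Union>F) = v"
      proof (intro conjI ext)
        fix x
        show "restrict_id (u \<circ> v) A x = u x"
          using vA permutes_not_in[OF uv(1)] by (simp add: restrict_id_def)
        show "restrict_id (u \<circ> v) (\<Union>F) x = v x"
          using uF[OF vF] permutes_not_in[OF uv(2)] by (cases "x \<in> \<Union>F") (simp_all add: restrict_id_def del: Union_iff)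
      qed
    qed
    show "\<forall>w\<in>{w. w permutes \<Union>(insert A F) \<and> (\<forall>B\<in>insert A F. w ` B = B)}.
       (\<lambda>(u, v). u \<circ> v) (restrict_id w A, restrict_id w (\<Union>F)) = w"
    proof clarify
      fix w assume w: "w permutes \<Union>(insert A F)" "\<forall>B\<in>insert A F. w ` B = B"
      show "restrict_id w A \<circ> restrict_id w (\<Union>F) = w"
      proof
        fix x
        consider "x \<in> A" | B where "x \<in> B" "B \<in> F" | "x \<notin> \<Union>(insert A F)" by blast
        then show "(restrict_id w A \<circ> restrict_id w (\<Union>F)) x = w x"
        proof cases
          case 1
          then show ?thesis using disU by (auto simp: restrict_id_def)
        next
          case 2
          then have "w x \<in> B" using w by blast
          then show ?thesis using 2 dis[of B] by (auto simp: restrict_id_def)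
        next
          case 3
          then show ?thesis using w by (auto simp: restrict_id_def permutes_def)
        qed
      qed
    qed
  qed
  then have "card {w. w permutes \<Union>(insert A F) \<and> (\<forall>B\<in>insert A F. w ` B = B)} = card ({u. u permutes A} \<times> ?G)"
    by (rule bij_betw_same_card[symmetric])
  also have "\<dots> = fact (card A) * card ?G"
    using insert by (simp add: card_cartesian_product card_permutations)
  also have "card ?G = (\<Prod>A\<in>F. fact (card A))"
    using insert by blast
  finally show ?case using insert by simp
qed

section \<open>Maximal runs of generators and the group order\<close>

lemma consec: "a \<le> b \<Longrightarrow> consecutive {a..b}"
  unfolding consecutive_def by blast

text \<open>A maximal interval is one that cannot be extended by a single step at either end. As a
  is at least 1, the subtraction a - 1 is genuine, and a - 1 = 0 lies outside
  \<open>K\<close>.\<close>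

lemma blocks_iff:
  assumes "0 \<notin> K" "finite K"
  shows "X \<in> blocks K \<longleftrightarrow> (\<exists>a b. 1 \<le> a \<and> a \<le> b \<and> X = {a..b} \<and> {a..b} \<subseteq> K \<and> a - 1 \<notin> K \<and> Suc b \<notin> K)"
proof
  assume X: "X \<in> blocks K"
  then obtain a b where ab: "a \<le> b" "X = {a..b}" "{a..b} \<subseteq> K"
    by (auto simp: blocks_def consecutive_def)
  have mx: "Y = X" if "consecutive Y" "X \<subseteq> Y" "Y \<subseteq> K" for Y
    using X that by (auto simp: blocks_def)
  have "a \<in> K" using ab by auto
  then have a1: "1 \<le> a" using assms(1) by (cases a) auto
  have "a - 1 \<notin> K"
  proof
    assume "a - 1 \<in> K"
    moreover have e: "{a - 1..b} = insert (a - 1) {a..b}" using a1 ab by auto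
    ultimately have "{a - 1..b} = X"
      using ab a1 by (intro mx consec) auto
    then have "a - 1 \<in> {a..b}" using e ab by auto
    then show False using a1 by auto
  qed
  moreover have "Suc b \<notin> K"
  proof
    assume "Suc b \<in> K"
    moreover have e: "{a..Suc b} = insert (Suc b) {a..b}" using ab by auto
    ultimately have "{a..Suc b} = X"
      using ab a1 by (intro mx consec) auto
    then have "Suc b \<in> {a..b}" using e ab by auto
    then show False by auto
  qed
  ultimately show "\<exists>a b. 1 \<le> a \<and> a \<le> b \<and> X = {a..b} \<and> {a..b} \<subseteq> K \<and> a - 1 \<notin> K \<and> Suc b \<notin> K"
    using ab a1 by blast
next
  assume "\<exists>a b. 1 \<le> a \<and> a \<le> b \<and> X = {a..b} \<and> {a..b} \<subseteq> K \<and> a - 1 \<notin> K \<and> Suc b \<notin> K"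
  then obtain a b where ab: "1 \<le> a" "a \<le> b" "X = {a..b}" "{a..b} \<subseteq> K" "a - 1 \<notin> K" "Suc b \<notin> K"
    by blast
  have "Y = X" if cY: "consecutive Y" and that: "X \<subseteq> Y" "Y \<subseteq> K" for Y
  proof -
    obtain c d where Y: "c \<le> d" "Y = {c..d}" using cY unfolding consecutive_def by blast
    have cd: "c \<le> a" "b \<le> d" using that(1) Y ab by auto
    have "c = a"
    proof (rule ccontr)
      assume "c \<noteq> a"
      then have "a - 1 \<in> Y" using Y cd ab by auto
      with that ab show False by auto
    qed
    moreover have "d = b"
    proof (rule ccontr)
      assume "d \<noteq> b"
      then have "Suc b \<in> Y" using Y cd ab by auto
      with that ab show False by auto
    qed
    ultimately show ?thesis using Y ab by simp
  qed
  then show "X \<in> blocks K"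
    using ab by (auto simp: blocks_def consecutive_def)
qed

lemma tilde_interval: "a \<le> b \<Longrightarrow> tilde {a..b} = {a..Suc b}"
proof -
  assume "a \<le> b"
  then have "Max {a..b} = b" by (intro Max_eqI) auto
  with \<open>a \<le> b\<close> show ?thesis by (auto simp: tilde_def)
qed

lemma block_exists:
  assumes "0 \<notin> K" "finite K" "{x..<y} \<subseteq> K" "x < y"
  obtains a b where "{a..b} \<in> blocks K" "a \<le> x" "y \<le> Suc b" "a \<le> b"
proof -
  define a where "a = (LEAST a. {a..<y} \<subseteq> K)"
  define b where "b = (GREATEST b. {x..b} \<subseteq> K \<and> x \<le> b)"
  have a: "{a..<y} \<subseteq> K" unfolding a_def by (rule LeastI, rule assms(3))
  have ax: "a \<le> x" unfolding a_def by (rule Least_le, rule assms(3))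
  have bd: "\<forall>b. {x..b} \<subseteq> K \<and> x \<le> b \<longrightarrow> b \<le> Max K"
    using assms(2) by (auto intro!: Max_ge)
  have y1: "{x..y - 1} = {x..<y}" using assms(4) by auto
  then have ex: "{x..y - 1} \<subseteq> K \<and> x \<le> y - 1" using assms(3,4) by auto
  have b: "{x..b} \<subseteq> K \<and> x \<le> b"
    unfolding b_def using bd by (intro GreatestI_nat[where b = "Max K" and P = "\<lambda>b. {x..b} \<subseteq> K \<and> x \<le> b", OF ex]) auto
  have yb: "y - 1 \<le> b"
    unfolding b_def using bd by (intro Greatest_le_nat[where b = "Max K" and P = "\<lambda>b. {x..b} \<subseteq> K \<and> x \<le> b", OF ex]) auto
  have ab: "{a..b} \<subseteq> K"
    using a b assms(4) by (auto simp: subset_iff) (metis linorder_not_less order_trans less_or_eq_imp_le)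
  have "a \<in> K" using ab ax b by auto
  then have a1: "1 \<le> a" using assms(1) by (cases a) auto
  have "a - 1 \<notin> K"
  proof
    assume "a - 1 \<in> K"
    moreover have "{a - 1..<y} = insert (a - 1) {a..<y}" using a1 ax assms(4) by auto
    ultimately have "{a - 1..<y} \<subseteq> K" using a by simp
    then have "a \<le> a - 1" unfolding a_def by (rule Least_le)
    then show False using a1 by simp
  qed
  moreover have "Suc b \<notin> K"
  proof
    assume "Suc b \<in> K"
    moreover have "{x..Suc b} = insert (Suc b) {x..b}" using b by auto
    ultimately have "{x..Suc b} \<subseteq> K \<and> x \<le> Suc b" using b by simp
    then have "Suc b \<le> b"
      unfolding b_def using bd by (intro Greatest_le_nat[where b = "Max K" and P = "\<lambda>b. {x..b} \<subseteq> K \<and> x \<le> b"]) auto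
    then show False by simp
  qed
  ultimately have "{a..b} \<in> blocks K"
    using blocks_iff[OF assms(1,2), of "{a..b}"] ab a1 ax b by (auto intro: order_trans)
  then show ?thesis
    using that[of a b] ax yb b assms(4) by auto
qed

text \<open>Replaces maximal sets by the local condition that every generator between the two
  positions lies in \<open>K\<close>; this is the form in which roots are handled from here
  on.\<close>

lemma same_block_iff:
  assumes "0 \<notin> K" "finite K" "x < y"
  shows "(\<exists>X\<in>blocks K. x \<in> tilde X \<and> y \<in> tilde X) \<longleftrightarrow> {x..<y} \<subseteq> K"
proof
  assume "\<exists>X\<in>blocks K. x \<in> tilde X \<and> y \<in> tilde X"
  then obtain a b where "{a..b} \<subseteq> K" "x \<in> {a..Suc b}" "y \<in> {a..Suc b}"
    unfolding blocks_iff[OF assms(1,2)] Bex_def by (metis tilde_interval)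
  then show "{x..<y} \<subseteq> K" by auto
next
  assume "{x..<y} \<subseteq> K"
  then obtain a b where "{a..b} \<in> blocks K" "a \<le> x" "y \<le> Suc b" "a \<le> b"
    using block_exists[OF assms(1,2)] assms(3) by metis
  then show "\<exists>X\<in>blocks K. x \<in> tilde X \<and> y \<in> tilde X"
    using assms(3) by (intro bexI[of _ "{a..b}"]) (auto simp: tilde_interval)
qed

text \<open>Distinct blocks are separated by at least one missing generator, so adding one further
  point to each does not make them meet.\<close>

lemma tilde_disjoint:
  assumes K: "0 \<notin> K" "finite K" and "X \<in> blocks K" "Y \<in> blocks K" "tilde X \<inter> tilde Y \<noteq> {}"
  shows "X = Y"
proof -
  obtain a b where ab: "a \<le> b" "X = {a..b}" "{a..b} \<subseteq> K" "a - 1 \<notin> K" "Suc b \<notin> K" "1 \<le> a"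
    using assms(3) blocks_iff[OF K] by metis
  obtain c d where cd: "c \<le> d" "Y = {c..d}" "{c..d} \<subseteq> K" "c - 1 \<notin> K" "Suc d \<notin> K" "1 \<le> c"
    using assms(4) blocks_iff[OF K] by metis
  obtain z where z: "a \<le> z" "z \<le> Suc b" "c \<le> z" "z \<le> Suc d"
    using assms(5) ab cd by (auto simp: tilde_interval)
  have "a = c"
  proof (rule ccontr)
    assume "a \<noteq> c"
    then consider "a \<le> c - 1" "c - 1 \<le> b" | "c \<le> a - 1" "a - 1 \<le> d" using z ab cd by linarith
    then show False using ab cd by cases (auto simp: subset_iff)
  qed
  moreover have "b = d"
  proof (rule ccontr)
    assume "b \<noteq> d"
    then consider "Suc b \<le> d" | "Suc d \<le> b" by linarith
    then show False using ab cd \<open>a = c\<close> by cases (auto simp: subset_iff)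
  qed
  ultimately show ?thesis using ab cd by simp
qed

lemma finite_blocks: "finite K \<Longrightarrow> finite (blocks K)"
  by (rule finite_subset[of _ "Pow K"]) (auto simp: blocks_def)

text \<open>By the description through cuts, \<open>W K\<close> consists of the permutations that
  preserve every \<open>tilde\<close> block and fix all other points.\<close>

lemma card_W:
  assumes K: "K \<subseteq> {1..N - 1}"
  shows "card (W K) = (\<Prod>X\<in>blocks K. fact (card (tilde X)))"
proof -
  have fin: "finite K" using K finite_subset by blast
  have 0: "0 \<notin> K" using K by auto
  let ?F = "tilde ` blocks K"
  have inj: "inj_on tilde (blocks K)"
  proof (rule inj_onI)
    fix X Y assume "X \<in> blocks K" "Y \<in> blocks K" "tilde X = tilde Y"
    then show "X = Y" using tilde_disjoint[OF 0 fin, of X Y] by (auto simp: tilde_def)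
  qed
  have T: "\<exists>a b. A = {a..Suc b} \<and> 1 \<le> a \<and> a \<le> b \<and> {a..b} \<subseteq> K \<and> a - 1 \<notin> K \<and> Suc b \<notin> K" if "A \<in> ?F" for A
    using that blocks_iff[OF 0 fin] by (metis (no_types, lifting) image_iff tilde_interval)
  have "W K = {w. w permutes \<Union>?F \<and> (\<forall>A\<in>?F. w ` A = A)}"
  proof (intro set_eqI iffI)
    fix w assume w: "w \<in> W K"
    have "w x = x" if "x \<notin> \<Union>?F" for x
    proof (rule W_fix[OF w])
      show "x \<notin> K"
      proof
        assume "x \<in> K"
        then obtain a b where "{a..b} \<in> blocks K" "a \<le> x" "Suc x \<le> Suc b" "a \<le> b"
          using block_exists[OF 0 fin, of x "Suc x"] by auto
        with that show False by (force simp: tilde_interval)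
      qed
      show "x = 0 \<or> x - 1 \<notin> K"
      proof (rule ccontr)
        assume "\<not> (x = 0 \<or> x - 1 \<notin> K)"
        then have x: "x - 1 < x" "{x - 1..<x} \<subseteq> K"
          using atLeastLessThan_singleton[of "x - 1"] by auto
        then obtain a b where "{a..b} \<in> blocks K" "a \<le> x - 1" "x \<le> Suc b" "a \<le> b"
          using block_exists[OF 0 fin x(2,1)] by metis
        with that show False by (force simp: tilde_interval)
      qed
    qed
    then have "w permutes \<Union>?F"
      by (intro bij_permutesI W_bij[OF w])
    moreover have "w ` A = A" if A: "A \<in> ?F" for A
    proof -
      obtain a b where ab: "A = {a..Suc b}" "1 \<le> a" "a \<le> b" "a - 1 \<notin> K" "Suc b \<notin> K"
        using T[OF A] by blast
      have "A = {..Suc b} - {..a - 1}" using ab by auto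
      then show ?thesis
        using W_cut[OF w ab(4)] W_cut[OF w ab(5)] image_set_diff[OF bij_is_inj[OF W_bij[OF w]]] by metis
    qed
    ultimately show "w \<in> {w. w permutes \<Union>?F \<and> (\<forall>A\<in>?F. w ` A = A)}" by blast
  next
    fix w assume w: "w \<in> {w. w permutes \<Union>?F \<and> (\<forall>A\<in>?F. w ` A = A)}"
    then have bw: "bij w" using permutes_bij by auto
    have sub: "w x \<le> q" if "q \<notin> K" "x \<le> q" for q x
    proof (cases "x \<in> \<Union>?F")
      case True
      then obtain A where A: "A \<in> ?F" "x \<in> A" by blast
      then obtain a b where ab: "A = {a..Suc b}" "{a..b} \<subseteq> K"
        using T[OF A(1)] by blast
      have "w x \<in> A" using w A by blast
      moreover have "q \<notin> {a..b}" using ab that by blast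
      ultimately show ?thesis using ab A(2) that by auto
    next
      case False
      then show ?thesis using w that by (auto simp: permutes_def)
    qed
    have "w ` {..q} = {..q}" if "q \<notin> K" for q
      using sub[OF that] by (intro card_subset_eq) (auto simp: card_image inj_on_subset[OF bij_is_inj[OF bw]])
    then show "w \<in> W K"
      using cut_W[OF K bw] by blast
  qed
  also have "card \<dots> = (\<Prod>A\<in>?F. fact (card A))"
  proof (rule card_family_perms)
    show "finite ?F" using finite_blocks[OF fin] by simp
    show "finite A" if "A \<in> ?F" for A using T[OF that] by auto
    show "A \<inter> B = {}" if "A \<in> ?F" "B \<in> ?F" "A \<noteq> B" for A B
      using that tilde_disjoint[OF 0 fin] by blast
  qed
  also have "\<dots> = (\<Prod>X\<in>blocks K. fact (card (tilde X)))"
    using inj by (simp add: prod.reindex)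
  finally show ?thesis .
qed

section \<open>Vandermonde products and vanishing order\<close>

text \<open>The positive roots of \<open>J\<close>: two positions lie in a common
  \<open>tilde\<close> block exactly when all generators between them lie in
  \<open>J\<close>.\<close>

definition run_pairs :: "nat set \<Rightarrow> (nat \<times> nat) set" where
  "run_pairs J = {(j, k). j < k \<and> {j..<k} \<subseteq> J}"

definition vdm :: "nat set \<Rightarrow> mpol" where
  "vdm J = (\<Prod>(j, k)\<in>run_pairs J. Z j - Z k)"

lemma run_pairs_bounds: "J \<subseteq> {1..N - 1} \<Longrightarrow> (j, k) \<in> run_pairs J \<Longrightarrow> 1 \<le> j \<and> j < k \<and> k \<le> N"
proof -
  assume J: "J \<subseteq> {1..N - 1}" and "(j, k) \<in> run_pairs J"
  then have jk: "j < k" "{j..<k} \<subseteq> J" by (auto simp: run_pairs_def)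
  then have "j \<in> J" "k - 1 \<in> J" by (auto simp: subset_iff)
  then have "j \<in> {1..N - 1}" "k - 1 \<in> {1..N - 1}" using J by auto
  then show ?thesis using jk by auto
qed

lemma finite_run_pairs:
  assumes J: "J \<subseteq> {1..N - 1}" shows "finite (run_pairs J)"
proof (rule finite_subset)
  show "run_pairs J \<subseteq> {1..N} \<times> {1..N}"
  proof (rule subrelI)
    fix j k assume "(j, k) \<in> run_pairs J"
    from run_pairs_bounds[OF J this] show "(j, k) \<in> {1..N} \<times> {1..N}" by simp
  qed
qed simp

lemma run_pairs_iff_blocks:
  assumes "finite J" "0 \<notin> J"
  shows "(j, k) \<in> run_pairs J \<longleftrightarrow> j < k \<and> (\<exists>X\<in>blocks J. j \<in> tilde X \<and> k \<in> tilde X)"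
  unfolding run_pairs_def using same_block_iff[OF assms(2,1), of j k] by (simp only: mem_Collect_eq case_prod_conv) blast

lemma pos_roots_eq: 
  assumes J: "J \<subseteq> {1..N - 1}" shows "pos_roots N J = run_pairs J"
proof -
  have JJ: "finite J" "0 \<notin> J" using J finite_subset by auto
  show ?thesis
  proof (rule set_eqI)
    fix p :: "nat \<times> nat"
    obtain j k where p: "p = (j, k)" by force
    show "p \<in> pos_roots N J \<longleftrightarrow> p \<in> run_pairs J"
      unfolding p pos_roots_def mem_Collect_eq case_prod_conv
      using run_pairs_iff_blocks[OF JJ, of j k] run_pairs_bounds[OF J, of j k] by blast
  qed
qed

lemma vdm_eq_blocks:
  assumes J: "J \<subseteq> {1..N - 1}" shows "(\<Prod>X\<in>blocks J. vandermonde (tilde X)) = vdm J"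
proof -
  have fin: "finite J" and 0: "0 \<notin> J" using J finite_subset by auto
  let ?P = "\<lambda>X. {(i, i'). i \<in> tilde X \<and> i' \<in> tilde X \<and> i < i'}"
  have "run_pairs J = (\<Union>X\<in>blocks J. ?P X)"
  proof (rule set_eqI)
    fix p :: "nat \<times> nat"
    obtain j k where p: "p = (j, k)" by force
    show "p \<in> run_pairs J \<longleftrightarrow> p \<in> (\<Union>X\<in>blocks J. ?P X)"
      unfolding p run_pairs_iff_blocks[OF fin 0] by blast
  qed
  moreover have "finite (?P X)" if "X \<in> blocks J" for X
    using that calculation finite_run_pairs[OF J] by (metis (no_types, lifting) UN_upper finite_subset)
  moreover have "?P X \<inter> ?P Y = {}" if "X \<in> blocks J" "Y \<in> blocks J" "X \<noteq> Y" for X Y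
    using tilde_disjoint[OF 0 fin that(1,2)] that(3) by blast
  ultimately show ?thesis
    unfolding vdm_def vandermonde_def using finite_blocks[OF fin]
    by (simp only:) (rule prod.UNION_disjoint[symmetric]; auto)
qed

text \<open>The root-system fact that a simple reflection permutes the positive roots other than its
  own simple root.\<close>

lemma run_pairs_swap:
  assumes "k \<in> J" "p \<in> run_pairs J - {(k, Suc k)}"
  shows "map_prod (tr k (Suc k)) (tr k (Suc k)) p \<in> run_pairs J - {(k, Suc k)}"
proof -
  obtain a b where p: "p = (a, b)" "a < b" "{a..<b} \<subseteq> J" "(a, b) \<noteq> (k, Suc k)"
    using assms(2) by (auto simp: run_pairs_def)
  have sub: "x \<in> J" if "a \<le> x" "x < b" for x using p(3) that by auto
  consider "a = k" "Suc k < b" | "a = Suc k" | "b = k" | "b = Suc k" "a < k" | "a \<notin> {k, Suc k}" "b \<notin> {k, Suc k}"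
    using p(2,4) by force
  then show ?thesis
  proof cases
    case 1
    then have "map_prod (tr k (Suc k)) (tr k (Suc k)) p = (Suc k, b)" by (simp add: p)
    then show ?thesis using 1 sub by (auto simp: run_pairs_def)
  next
    case 2
    then have "map_prod (tr k (Suc k)) (tr k (Suc k)) p = (k, b)" using p by simp
    moreover have "x \<in> J" if "k \<le> x" "x < b" for x
      using sub[of x] that assms(1) 2 by (cases "x = k") auto
    ultimately show ?thesis using 2 p by (auto simp: run_pairs_def)
  next
    case 3
    then have "map_prod (tr k (Suc k)) (tr k (Suc k)) p = (a, Suc k)" using p by simp
    moreover have "x \<in> J" if "a \<le> x" "x < Suc k" for x
      using sub[of x] that assms(1) 3 by (cases "x = k") auto
    ultimately show ?thesis using 3 p by (auto simp: run_pairs_def)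
  next
    case 4
    then have "map_prod (tr k (Suc k)) (tr k (Suc k)) p = (a, k)" by (simp add: p)
    then show ?thesis using 4 sub by (auto simp: run_pairs_def)
  next
    case 5
    then show ?thesis using p assms(2) by simp
  qed
qed

lemma bij_betw_run_pairs_swap:
  assumes "k \<in> J"
  shows "bij_betw (map_prod (tr k (Suc k)) (tr k (Suc k))) (run_pairs J - {(k, Suc k)}) (run_pairs J - {(k, Suc k)})"
  by (rule bij_betw_byWitness[where f' = "map_prod (tr k (Suc k)) (tr k (Suc k))"])
     (use run_pairs_swap[OF assms] in \<open>auto simp: map_prod_def split_beta\<close>)

text \<open>Indices of a root lie in \<open>J\<close> or one past an element of \<open>J\<close>, so
  a generator away from \<open>J\<close> moves none of them.\<close>

lemma run_pairs_no_swap: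
  assumes "k \<notin> J" "k - 1 \<notin> J" "Suc k \<notin> J" "(a, b) \<in> run_pairs J"
  shows "tr k (Suc k) a = a" "tr k (Suc k) b = b"
proof -
  have ab: "a < b" "{a..<b} \<subseteq> J" using assms(4) by (auto simp: run_pairs_def)
  then have "a \<in> J" "b - 1 \<in> J" by (auto simp: subset_iff)
  then have "a \<noteq> k" "a \<noteq> Suc k" "b \<noteq> k" "b \<noteq> Suc k" using assms by auto
  then show "tr k (Suc k) a = a" "tr k (Suc k) b = b" by simp_all
qed

lemma run_pairs_simple: "k \<in> J \<Longrightarrow> (k, Suc k) \<in> run_pairs J"
  by (auto simp: run_pairs_def less_Suc_eq_le)

lemma prod_run_pairs_swap:
  fixes F :: "nat \<Rightarrow> nat \<Rightarrow> 'a::comm_monoid_mult"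
  assumes "finite (run_pairs J)" "k \<in> J"
  shows "(\<Prod>(a, b)\<in>run_pairs J. F (tr k (Suc k) a) (tr k (Suc k) b)) =
    F (Suc k) k * (\<Prod>(a, b)\<in>run_pairs J - {(k, Suc k)}. F a b)"
proof -
  have "(\<Prod>(a, b)\<in>run_pairs J. F (tr k (Suc k) a) (tr k (Suc k) b)) =
    F (Suc k) k * (\<Prod>(a, b)\<in>run_pairs J - {(k, Suc k)}. F (tr k (Suc k) a) (tr k (Suc k) b))"
    using assms run_pairs_simple by (subst prod.remove[of _ "(k, Suc k)"]) auto
  also have "(\<Prod>(a, b)\<in>run_pairs J - {(k, Suc k)}. F (tr k (Suc k) a) (tr k (Suc k) b)) =
    (\<Prod>p\<in>run_pairs J - {(k, Suc k)}. (\<lambda>(a, b). F a b) (map_prod (tr k (Suc k)) (tr k (Suc k)) p))"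
    by (rule prod.cong) auto
  also have "\<dots> = (\<Prod>(a, b)\<in>run_pairs J - {(k, Suc k)}. F a b)"
    by (rule prod.reindex_bij_betw[OF bij_betw_run_pairs_swap[OF assms(2)]])
  finally show ?thesis .
qed

lemma pact_prod: "bij w \<Longrightarrow> pact w (prod F A) = (\<Prod>a\<in>A. pact w (F a))"
  by (induction A rule: infinite_finite_induct) (simp_all add: pact_mult)

lemma pact_vdm_J:
  assumes "finite (run_pairs J)" "k \<in> J"
  shows "pact (tr k (Suc k)) (vdm J) = - vdm J"
proof -
  have "pact (tr k (Suc k)) (vdm J) = (\<Prod>(a, b)\<in>run_pairs J. Z (tr k (Suc k) a) - Z (tr k (Suc k) b))"
    unfolding vdm_def by (simp add: pact_prod pact_diff split_def)
  also have "\<dots> = (Z (Suc k) - Z k) * (\<Prod>(a, b)\<in>run_pairs J - {(k, Suc k)}. Z a - Z b)"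
    by (rule prod_run_pairs_swap[OF assms])
  also have "\<dots> = - ((Z k - Z (Suc k)) * (\<Prod>(a, b)\<in>run_pairs J - {(k, Suc k)}. Z a - Z b))"
    by (simp add: algebra_simps)
  also have "(Z k - Z (Suc k)) * (\<Prod>(a, b)\<in>run_pairs J - {(k, Suc k)}. Z a - Z b) = vdm J"
    unfolding vdm_def using assms run_pairs_simple by (subst prod.remove[of _ "(k, Suc k)"]) auto
  finally show ?thesis .
qed

lemma pact_vdm_I:
  assumes "k \<notin> J" "k - 1 \<notin> J" "Suc k \<notin> J"
  shows "pact (tr k (Suc k)) (vdm J) = vdm J"
  unfolding vdm_def pact_prod[OF bij_transpose]
  by (rule prod.cong) (use run_pairs_no_swap[OF assms] in \<open>auto simp: pact_diff\<close>)

lemma vdm_nonzero: "finite (run_pairs J) \<Longrightarrow> vdm J \<noteq> 0"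
  unfolding vdm_def by (subst prod_zero_iff) (auto simp: run_pairs_def dest!: Z_diff_nonzero[OF less_imp_neq])

section \<open>Divisibility by a Vandermonde product\<close>

definition collapse :: "nat \<Rightarrow> nat \<Rightarrow> comp \<Rightarrow> comp" where
  "collapse a b \<kappa> = Poly_Mapping.update a 0 \<kappa> + single b (lookup \<kappa> a)"

text \<open>The substitution z_a := z_b, a ring homomorphism whose vanishing on f is equivalent to
  divisibility of f by z_a - z_b.\<close>

definition subst_var :: "nat \<Rightarrow> nat \<Rightarrow> mpol \<Rightarrow> mpol" where
  "subst_var a b f = lin (\<lambda>\<kappa>. monom (collapse a b \<kappa>)) f"

lemma collapse_add: "collapse a b (\<kappa> + \<nu>) = collapse a b \<kappa> + collapse a b \<nu>"
  by (rule poly_mapping_eqI) (auto simp: collapse_def lookup_add lookup_update lookup_single when_def)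

lemma collapse_single: "collapse a b (single c 1) = single (if c = a then b else c) 1"
  by (rule poly_mapping_eqI) (auto simp: collapse_def lookup_add lookup_update lookup_single when_def)

lemma subst_var_mult: "subst_var a b (f * g) = subst_var a b f * subst_var a b g"
  unfolding subst_var_def by (rule lin_mult) (simp add: collapse_add monom_add)

lemma subst_var_Z: "subst_var a b (Z c) = Z (if c = a then b else c)"
  unfolding subst_var_def Z_def lin_monom collapse_single ..

lemma subst_var_diff: "subst_var a b (f - g) = subst_var a b f - subst_var a b g"
  and subst_var_add: "subst_var a b (f + g) = subst_var a b f + subst_var a b g"
  and subst_var_0 [simp]: "subst_var a b 0 = 0"
  and subst_var_Const_mult: "subst_var a b (Const c * f) = Const c * subst_var a b f"
  by (simp_all add: subst_var_def lin_diff lin_add lin_Const_mult)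

lemma subst_var_1: "subst_var a b 1 = 1"
proof -
  have "collapse a b 0 = 0"
    by (rule poly_mapping_eqI) (auto simp: collapse_def lookup_add lookup_update)
  then show ?thesis
    using lin_monom[of "\<lambda>\<kappa>. monom (collapse a b \<kappa>)" 0] by (simp add: subst_var_def del: lin_monom)
qed

lemma dvd_diff_subst_var: "Z a - Z b dvd f - subst_var a b f"
proof (induction f rule: mpol_induct)
  case (add f g)
  have "f + g - subst_var a b (f + g) = (f - subst_var a b f) + (g - subst_var a b g)"
    by (simp add: subst_var_add)
  with add show ?case by (metis dvd_add)
next
  case (monom c \<kappa>)
  have "Z a - Z b dvd monom \<kappa> - subst_var a b (monom \<kappa>)"
  proof (induction \<kappa> rule: comp_induct)
    case zero
    show ?case by (simp add: subst_var_1)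
  next
    case (add \<kappa> l)
    have "monom (\<kappa> + single l 1) - subst_var a b (monom (\<kappa> + single l 1)) =
      (Z l - subst_var a b (Z l)) * monom \<kappa> + subst_var a b (Z l) * (monom \<kappa> - subst_var a b (monom \<kappa>))"
      by (simp add: monom_add_single subst_var_mult algebra_simps del: One_nat_def)
    moreover have "Z a - Z b dvd Z l - subst_var a b (Z l)"
      by (auto simp: subst_var_Z)
    ultimately show ?case
      using add by (metis dvd_add dvd_mult dvd_mult2)
  qed
  then show ?case
    by (metis dvd_mult right_diff_distrib subst_var_Const_mult)
qed simp

lemma dvd_iff_subst_var: "Z a - Z b dvd f \<longleftrightarrow> subst_var a b f = 0"
proof
  assume "Z a - Z b dvd f"
  then obtain g where "f = (Z a - Z b) * g" by (rule dvdE)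
  then show "subst_var a b f = 0"
    by (simp add: subst_var_mult subst_var_diff subst_var_Z)
next
  assume "subst_var a b f = 0"
  then show "Z a - Z b dvd f"
    using dvd_diff_subst_var[of a b f] by simp
qed

lemma subst_var_prod: "subst_var a b (prod F A) = (\<Prod>x\<in>A. subst_var a b (F x))"
  by (induction A rule: infinite_finite_induct) (simp_all add: subst_var_mult subst_var_1)

text \<open>Under z_a := z_b no other factor of the product becomes 0, since the pairs are distinct
  and increasing. In an integral domain the vanishing therefore passes to the cofactor.\<close>

lemma prod_dvd:
  assumes "finite S" "\<And>a b. (a, b) \<in> S \<Longrightarrow> a < b" "\<And>a b. (a, b) \<in> S \<Longrightarrow> Z a - Z b dvd f"
  shows "(\<Prod>(a, b)\<in>S. Z a - Z b) dvd f"
  using assms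
proof (induction S)
  case (insert p S)
  obtain a b where p: "p = (a, b)" by force
  have ab: "a < b" using insert p by auto
  have "(\<Prod>(a, b)\<in>S. Z a - Z b) dvd f"
    using insert by auto
  then obtain g where g: "f = (\<Prod>(a, b)\<in>S. Z a - Z b) * g"
    by (rule dvdE)
  have "subst_var a b f = 0"
    using insert p dvd_iff_subst_var by auto
  then have "(\<Prod>(c, d)\<in>S. subst_var a b (Z c - Z d)) * subst_var a b g = 0"
    by (simp add: g subst_var_mult subst_var_prod split_def)
  moreover have "subst_var a b (Z c - Z d) \<noteq> 0" if "(c, d) \<in> S" for c d
  proof -
    have "c < d" "(c, d) \<noteq> (a, b)" using insert that p by auto
    then have "(if c = a then b else c) \<noteq> (if d = a then b else d)"
      using ab by auto
    then show ?thesis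
      unfolding subst_var_diff subst_var_Z by (rule Z_diff_nonzero)
  qed
  then have "(\<Prod>(c, d)\<in>S. subst_var a b (Z c - Z d)) \<noteq> 0"
    using insert(1) by (subst prod_zero_iff) auto
  ultimately have "subst_var a b g = 0" by simp
  then have "Z a - Z b dvd g" by (simp add: dvd_iff_subst_var)
  then have "(Z a - Z b) * (\<Prod>(a, b)\<in>S. Z a - Z b) dvd f"
    unfolding g by (subst mult.commute) (rule mult_dvd_mono, simp_all)
  then show ?case
    using insert(1,2) p by simp
qed simp

lemma antisym_transposition:
  assumes "\<And>k. k \<in> J \<Longrightarrow> pact (tr k (Suc k)) f = - f" "a < b" "{a..<b} \<subseteq> J"
  shows "pact (tr a b) f = - f"
  using assms(2,3)
proof (induction b)
  case (Suc b)
  show ?case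
  proof (cases "a = b")
    case True
    with Suc assms(1) show ?thesis by auto
  next
    case False
    then have IH: "pact (tr a b) f = - f" using Suc by (auto simp: subset_iff)
    have b: "pact (tr b (Suc b)) f = - f" using Suc assms(1) by (auto simp: subset_iff)
    have m: "pact w (- g) = - pact w g" for w g
      using pact_diff[of w 0 g] by simp
    have "tr a (Suc b) = tr b (Suc b) \<circ> (tr a b \<circ> tr b (Suc b))"
      using False Suc by (auto simp: fun_eq_iff Transposition.transpose_def)
    then have "pact (tr a (Suc b)) f = pact (tr b (Suc b)) (pact (tr a b) (pact (tr b (Suc b)) f))"
      by (simp only: pact_comp bij_comp bij_transpose)
    then show ?thesis by (simp add: b IH m)
  qed
qed simp

text \<open>Antisymmetry under generators gives antisymmetry under every transposition of a root, so
  f - s f = 2 f, and the left side is divisible by z_a - z_b.\<close>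

lemma vdm_dvd:
  assumes "finite (run_pairs J)" "\<And>k. k \<in> J \<Longrightarrow> pact (tr k (Suc k)) f = - f"
  shows "vdm J dvd f"
  unfolding vdm_def
proof (rule prod_dvd)
  fix a b assume "(a, b) \<in> run_pairs J"
  then have ab: "a < b" "{a..<b} \<subseteq> J" by (auto simp: run_pairs_def)
  show "a < b" by (rule ab)
  have "f - pact (tr a b) f = Const 2 * f"
    using antisym_transposition[OF assms(2) ab] by (simp add: Const_add[of 1 1, simplified] algebra_simps)
  then have "(Z a - Z b) * ddiff a b f = Const 2 * f"
    using ddiff_eq[of a b f] ab by simp
  then have "Const (1/2) * ((Z a - Z b) * ddiff a b f) = Const (1/2) * (Const 2 * f)" by simp
  also have "\<dots> = f" by (simp add: mult.assoc[symmetric] flip: Const_mult)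
  finally have "f = (Z a - Z b) * (Const (1/2) * ddiff a b f)"
    by (simp add: mult.left_commute)
  then show "Z a - Z b dvd f" by (rule dvdI)
qed fact

text \<open>\<open>van k\<close> is the k-th power of the ideal generated by all z_i - 1, that is,
  vanishing of order at least k at (1, ..., 1). The inductive form lets product rules act on one
  factor at a time.\<close>

inductive van :: "nat \<Rightarrow> mpol \<Rightarrow> bool" where
  van_base: "van 0 f"
| van_zero: "van (Suc k) 0"
| van_step: "van k g \<Longrightarrow> van (Suc k) ((Z i - 1) * g)"
| van_plus: "van (Suc k) f \<Longrightarrow> van (Suc k) g \<Longrightarrow> van (Suc k) (f + g)"

lemma van_add: "van k f \<Longrightarrow> van k g \<Longrightarrow> van k (f + g)"
  by (cases k) (auto intro: van.intros)

lemma van_0: "van k 0"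
  by (cases k) (auto intro: van.intros)

lemma van_mult: "van k f \<Longrightarrow> van k (h * f)"
proof (induction rule: van.induct)
  case (van_step k g i)
  then have "van (Suc k) ((Z i - 1) * (h * g))" by (intro van.van_step)
  then show ?case by (simp add: mult.left_commute)
qed (auto intro: van.intros simp: distrib_left)

lemma van_diff: "van k f \<Longrightarrow> van k g \<Longrightarrow> van k (f - g)"
  using van_add[of k f "- 1 * g"] van_mult[of k g "-1"] by simp

lemma van_sum: "(\<And>a. a \<in> A \<Longrightarrow> van k (F a)) \<Longrightarrow> van k (sum F A)"
  by (induction A rule: infinite_finite_induct) (auto intro: van_add van_0)

lemma van_prod: "van a f \<Longrightarrow> van b g \<Longrightarrow> van (a + b) (f * g)"
proof (induction rule: van.induct)
  case (van_base f)
  then show ?case by (simp add: van_mult)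
next
  case (van_step k g' i)
  then have "van (Suc (k + b)) ((Z i - 1) * (g' * g))" by (intro van.van_step)
  then show ?case by (simp add: mult.assoc)
next
  case (van_plus k f g')
  then show ?case by (simp add: distrib_right van_add)
qed (simp add: van_0)

lemma van_Suc: "van (Suc k) f \<Longrightarrow> van k f"
proof (induction "Suc k" f arbitrary: k rule: van.induct)
  case (van_step k g i)
  then show ?case by (intro van_mult)
qed (auto intro: van_0 van_add)

text \<open>The twisted Leibniz rule either consumes the factor z_l - 1 or replaces it by its image
  under the transposition, again a generator of the ideal. For k = 0 the truncated k - 1 makes the
  claim trivial.\<close>

lemma van_pred_ddiff:
  assumes "i \<noteq> j" shows "van k f \<Longrightarrow> van (k - 1) (ddiff i j f)"
proof (induction rule: van.induct)
  case (van_step k g l)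
  have 1: "van k (ddiff i j (Z l - 1) * g)"
    using van_step by (intro van_mult)
  have "ddiff i j 1 = 0"
    using assms by (intro ddiff_unique) auto
  have "van k ((Z (tr i j l) - 1) * ddiff i j g)"
  proof (cases k)
    case (Suc k')
    then show ?thesis using van_step by (auto intro: van.van_step)
  qed (simp add: van_base)
  then have "van k (pact (tr i j) (Z l - 1) * ddiff i j g)"
    by (simp add: pact_diff)
  with 1 show ?case
    using assms by (simp add: ddiff_mult van_add)
next
  case (van_plus k f g)
  then show ?case using assms by (simp add: ddiff_add van_add)
qed (use assms in \<open>auto intro: van_base van_0\<close>)

lemma van_pred_eul: "van k f \<Longrightarrow> van (k - 1) (eul i f)"
proof (induction rule: van.induct)
  case (van_step k g l)
  have "van k (eul i (Z l - 1) * g)"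
    using van_step by (intro van_mult)
  moreover have "van k ((Z l - 1) * eul i g)"
  proof (cases k)
    case (Suc k')
    then show ?thesis using van_step by (auto intro: van.van_step)
  qed (simp add: van_base)
  ultimately show ?case by (simp add: eul_mult van_add)
next
  case (van_plus k f g)
  then show ?case by (simp add: eul_add van_add)
qed (auto intro: van_base van_0)

lemma van_cherednik: "van (Suc k) f \<Longrightarrow> van k (cherednik N \<alpha> i f)"
  unfolding cherednik_eq
  by (intro van_add van_mult van_sum van_Suc[of k f]
      van_pred_ddiff[of _ _ "Suc k" f, unfolded diff_Suc_1] van_pred_eul[of "Suc k" f, unfolded diff_Suc_1])
     auto

lemma ev1_van: "van (Suc k) f \<Longrightarrow> ev1 f = 0"
  by (induction "Suc k" f rule: van.induct) (auto simp: ev1_mult ev1_diff ev1_add)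

lemma van_diff_ev1: "van (Suc 0) (f - Const (ev1 f))"
proof (induction f rule: mpol_induct)
  case zero
  show ?case by (simp add: van_zero)
next
  case (add f g)
  have "f + g - Const (ev1 (f + g)) = (f - Const (ev1 f)) + (g - Const (ev1 g))"
    by (simp add: ev1_add Const_add)
  with add show ?case by (metis van_add)
next
  case (monom c \<kappa>)
  have "van (Suc 0) (monom \<kappa> - 1)"
  proof (induction \<kappa> rule: comp_induct)
    case (add \<kappa> i)
    have "monom (\<kappa> + single i 1) - 1 = (Z i - 1) * monom \<kappa> + (monom \<kappa> - 1)"
      unfolding monom_add_single by (simp add: algebra_simps)
    then show ?case
      using add by (metis van_add van_base van_step)
  qed (simp add: van_zero)
  then have "van (Suc 0) (Const c * (monom \<kappa> - 1))" by (rule van_mult)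
  then show ?case by (simp add: ev1_Const_mult right_diff_distrib)
qed

lemma van_prod_run_pairs:
  assumes "finite S"
  shows "van (card S) (\<Prod>(a, b)\<in>S. Z a - Z b)"
  using assms
proof (induction S)
  case (insert p S)
  obtain a b where p: "p = (a, b)" by force
  have 1: "van (Suc 0) ((Z c - 1) * 1)" for c by (intro van_step van_base)
  have "Z a - Z b = (Z a - 1) * 1 - (Z b - 1) * 1" by simp
  then have "van (Suc 0) (Z a - Z b)" using 1 van_diff by metis
  then show ?case
    using insert van_prod[of "Suc 0" _ "card S"] p by simp
qed (simp add: van_base)

text \<open>The operator P, composed in the order of a list of roots; on an \<open>E \<mu>\<close>
  every order gives the same scalar.\<close>

definition pxi :: "nat \<Rightarrow> real \<Rightarrow> (nat \<times> nat) list \<Rightarrow> mpol \<Rightarrow> mpol" where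
  "pxi N \<alpha> rs f = foldr (\<lambda>(j, k) g. cherednik N \<alpha> j g - cherednik N \<alpha> k g + g) rs f"

lemma pxi_Nil [simp]: "pxi N \<alpha> [] f = f"
  and pxi_Cons: "pxi N \<alpha> ((j, k) # rs) f = cherednik N \<alpha> j (pxi N \<alpha> rs f) - cherednik N \<alpha> k (pxi N \<alpha> rs f) + pxi N \<alpha> rs f"
  by (simp_all add: pxi_def)

lemma pxi_add: "pxi N \<alpha> rs (f + g) = pxi N \<alpha> rs f + pxi N \<alpha> rs g"
  by (induction rs) (auto simp: pxi_Cons cherednik_add)

lemma pxi_Const_mult: "pxi N \<alpha> rs (Const c * f) = Const c * pxi N \<alpha> rs f"
  by (induction rs) (auto simp: pxi_Cons cherednik_Const_mult algebra_simps)

lemma van_pxi: "van (m + length rs) f \<Longrightarrow> van m (pxi N \<alpha> rs f)"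
proof (induction rs arbitrary: m)
  case (Cons r rs)
  then have g: "van (Suc m) (pxi N \<alpha> rs f)" by simp
  obtain j k where r: "r = (j, k)" by force
  show ?case
    unfolding r pxi_Cons by (intro van_add van_diff van_cherednik[OF g] van_Suc[OF g])
qed simp

text \<open>\<open>vdm J\<close> times U - U(1) vanishes to one order more than the number of
  factors in P, so some vanishing remains after P and only the constant U(1) contributes.\<close>

lemma ev1_pxi_vdm:
  assumes "finite (run_pairs J)" "length rs = card (run_pairs J)"
  shows "ev1 (pxi N \<alpha> rs (vdm J * U)) = ev1 U * ev1 (pxi N \<alpha> rs (vdm J))"
proof -
  have "van (card (run_pairs J) + 1) (vdm J * (U - Const (ev1 U)))"
    using van_prod[OF van_prod_run_pairs[OF assms(1)] van_diff_ev1] by (simp add: vdm_def)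
  then have "van (Suc 0) (pxi N \<alpha> rs (vdm J * (U - Const (ev1 U))))"
    using assms by (intro van_pxi) simp
  then have 0: "ev1 (pxi N \<alpha> rs (vdm J * (U - Const (ev1 U)))) = 0"
    by (rule ev1_van)
  have "vdm J * U = vdm J * (U - Const (ev1 U)) + Const (ev1 U) * vdm J"
    by (simp add: algebra_simps)
  then show ?thesis
    using 0 by (simp add: pxi_add pxi_Const_mult ev1_add ev1_Const_mult)
qed

section \<open>Orbits\<close>

lemma antimono_run:
  fixes h :: "nat \<Rightarrow> int"
  assumes "\<And>k. k \<in> K \<Longrightarrow> h (Suc k) \<le> h k" "x \<le> y" "{x..<y} \<subseteq> K"
  shows "h y \<le> h x"
  using assms(2,3)
proof (induction y rule: dec_induct)
  case (step n)
  then have "h n \<le> h x" by (auto simp: subset_iff)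
  moreover have "n \<in> K" using step by auto
  ultimately show ?case using assms(1)[of n] by simp
qed simp

text \<open>Rearrangement inequality inside runs: the indices entering the prefix carry values at
  most h(p), those leaving it carry values at least h(p), and there are equally many of
  both.\<close>

lemma prefix_sum_le:
  fixes h :: "nat \<Rightarrow> int"
  assumes v: "v \<in> W K" and h: "\<And>k. k \<in> K \<Longrightarrow> h (Suc k) \<le> h k"
  shows "(\<Sum>j\<le>p. h (v j)) \<le> (\<Sum>j\<le>p. h j)"
proof -
  define A where "A = {..p}"
  define B where "B = v ` {..p}"
  have inj: "inj_on v {..p}" using bij_is_inj[OF W_bij[OF v]] inj_on_subset by blast
  have fin: "finite A" "finite B" by (auto simp: A_def B_def)
  have "card A = card B" by (simp add: A_def B_def card_image[OF inj])
  then have card: "card (B - A) = card (A - B)"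
    using card_Diff_subset_Int[of A B] card_Diff_subset_Int[of B A] fin by (simp add: Int_commute)
  \<comment> \<open>If some generator from p up to x were missing, its cut would be preserved by
    \<open>v\<close> and \<open>x\<close> could not be the image of a point of the prefix; hence p
    and x lie in one run, on which \<open>h\<close> decreases.\<close>
  have 1: "h x \<le> h p" if x: "x \<in> B - A" for x
  proof (rule antimono_run[where K = K and h = h, OF h])
    obtain j where j: "j \<le> p" "x = v j" using x by (auto simp: B_def)
    show "p \<le> x" using x by (simp add: A_def)
    show "{p..<x} \<subseteq> K"
    proof (rule subsetI, rule ccontr)
      fix q assume q: "q \<in> {p..<x}" "q \<notin> K"
      then have "v j \<in> v ` {..q}" using j by (intro imageI) auto
      then have "v j \<in> {..q}" unfolding W_cut[OF v q(2)] .
      then show False using j q by simp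
    qed
  qed
  have 2: "h p \<le> h y" if y: "y \<in> A - B" for y
  proof (rule antimono_run[where K = K and h = h, OF h])
    show "y \<le> p" using y by (simp add: A_def)
    show "{y..<p} \<subseteq> K"
    proof (rule subsetI, rule ccontr)
      fix q assume q: "q \<in> {y..<p}" "q \<notin> K"
      then have "y \<in> v ` {..q}" using W_cut[OF v q(2)] by auto
      then have "y \<in> B" using q by (auto simp: B_def)
      then show False using y by simp
    qed
  qed
  have "sum h (B - A) \<le> of_nat (card (B - A)) * h p"
    by (rule sum_bounded_above) (rule 1)
  also have "\<dots> = of_nat (card (A - B)) * h p" by (simp add: card)
  also have "\<dots> \<le> sum h (A - B)"
    by (rule sum_bounded_below) (rule 2)
  finally have "sum h B \<le> sum h A"
    using sum.Int_Diff[OF fin(1), of h B] sum.Int_Diff[OF fin(2), of h A] by (simp add: Int_commute)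
  then show ?thesis
    using sum.reindex[OF inj, of h] by (simp add: A_def B_def)
qed

lemma lookup_composition_0: "composition N \<eta> \<Longrightarrow> lookup \<eta> 0 = 0"
  unfolding composition_def by (metis atLeastAtMost_iff in_keys_iff not_one_le_zero subsetD)

lemma sum_atMost_composition: "composition N \<eta> \<Longrightarrow> (\<Sum>j\<le>p. int (lookup \<eta> j)) = int (\<Sum>j=1..p. lookup \<eta> j)"
proof -
  assume "composition N \<eta>"
  moreover have "{..p} = insert 0 {1..p}" by auto
  ultimately show ?thesis
    using lookup_composition_0 by (simp add: lookup_composition_0)
qed

lemma composition_act_W:
  assumes K: "K \<subseteq> {1..N - 1}" and w: "w \<in> W K" and \<eta>: "composition N \<eta>"
  shows "composition N (act w \<eta>)"
  using w
proof (induction rule: W_induct)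
  case (step k w)
  then have k: "1 \<le> k" "k < N" using K by force+
  have "act (tr k (Suc k) \<circ> w) \<eta> = act (tr k (Suc k)) (act w \<eta>)"
    using step by (intro act_comp bij_transpose W_bij)
  then show ?case using composition_swap[OF k step(3)] by (simp only:)
qed (simp add: \<eta>)

lemma comp_precI_prefix:
  assumes "composition N \<nu>" "composition N \<eta>" "sort_comp N \<nu> = sort_comp N \<eta>"
    and le: "\<And>p. (\<Sum>j\<le>p. int (lookup \<nu> j)) \<le> (\<Sum>j\<le>p. int (lookup \<eta> j))"
  shows "\<nu> = \<eta> \<or> comp_prec N \<nu> \<eta>"
proof -
  have "weight N \<nu> = weight N \<eta>" by (metis assms(3) weight_sort_comp)
  moreover have "(\<Sum>j=1..p. lookup \<nu> j) \<le> (\<Sum>j=1..p. lookup \<eta> j)" for p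
    using le[of p] unfolding sum_atMost_composition[OF assms(1)] sum_atMost_composition[OF assms(2)]
    by (simp only: of_nat_le_iff)
  ultimately show ?thesis
    using assms by (auto simp: comp_prec_def dom_less_def)
qed

lemma orbit_prec_dominant:
  assumes K: "K \<subseteq> {1..N - 1}" and w: "w \<in> W K" and \<eta>: "composition N \<eta>"
    and dom: "\<And>k. k \<in> K \<Longrightarrow> lookup \<eta> (Suc k) \<le> lookup \<eta> k"
  shows "act w \<eta> = \<eta> \<or> comp_prec N (act w \<eta>) \<eta>"
proof (rule comp_precI_prefix)
  fix p
  have "(\<Sum>j\<le>p. int (lookup \<eta> (inv w j))) \<le> (\<Sum>j\<le>p. int (lookup \<eta> j))"
    by (rule prefix_sum_le[OF W_inv[OF w]]) (use dom in auto)
  then show "(\<Sum>j\<le>p. int (lookup (act w \<eta>) j)) \<le> (\<Sum>j\<le>p. int (lookup \<eta> j))"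
    by (simp add: lookup_act W_bij[OF w])
qed (use \<eta> composition_act_W[OF K w \<eta>] sort_comp_act[OF W_bij[OF w] W_image[OF K w]] in auto)

lemma orbit_prec_antidominant:
  assumes K: "K \<subseteq> {1..N - 1}" and w: "w \<in> W K" and \<eta>: "composition N \<eta>"
    and dom: "\<And>k. k \<in> K \<Longrightarrow> lookup \<eta> k \<le> lookup \<eta> (Suc k)"
  shows "\<eta> = act w \<eta> \<or> comp_prec N \<eta> (act w \<eta>)"
proof (rule comp_precI_prefix)
  fix p
  have "(\<Sum>j\<le>p. - int (lookup \<eta> (inv w j))) \<le> (\<Sum>j\<le>p. - int (lookup \<eta> j))"
    by (rule prefix_sum_le[OF W_inv[OF w], where h = "\<lambda>j. - int (lookup \<eta> j)"]) (use dom in auto)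
  then show "(\<Sum>j\<le>p. int (lookup \<eta> j)) \<le> (\<Sum>j\<le>p. int (lookup (act w \<eta>) j))"
    by (simp add: lookup_act W_bij[OF w] sum_negf)
qed (use \<eta> composition_act_W[OF K w \<eta>] sort_comp_act[OF W_bij[OF w] W_image[OF K w]] in auto)

section \<open>The common setting: signs, symmetrizer and orbit\<close>

abbreviation "sw k \<equiv> tr k (Suc k)"

locale prescribed =
  fixes N :: nat and \<alpha> :: real and I J :: "nat set" and \<eta> :: comp
  assumes N1: "1 \<le> N" and \<alpha>: "\<alpha> > 0"
    and I_sub: "I \<subseteq> {1..N - 1}" and J_sub: "J \<subseteq> {1..N - 1}" and disj: "I \<inter> J = {}"
    and adjI: "\<And>i. i \<in> I \<Longrightarrow> i - 1 \<notin> J \<and> i + 1 \<notin> J"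
    and adjJ: "\<And>j. j \<in> J \<Longrightarrow> j - 1 \<notin> I \<and> j + 1 \<notin> I"
    and \<eta>: "composition N \<eta>"
    and domI: "\<And>i. i \<in> I \<Longrightarrow> lookup \<eta> i \<ge> lookup \<eta> (i + 1)"
    and domJ: "\<And>j. j \<in> J \<Longrightarrow> lookup \<eta> j > lookup \<eta> (j + 1)"
begin

abbreviation "K \<equiv> I \<union> J"

lemma K_sub: "K \<subseteq> {1..N - 1}"
  using I_sub J_sub by blast

lemma K_bounds: "k \<in> K \<Longrightarrow> 1 \<le> k" "k \<in> K \<Longrightarrow> k < N"
  using K_sub by force+

lemma fin_run_pairs: "finite (run_pairs J)"
  by (rule finite_run_pairs[OF J_sub])

lemma fin_W: "finite (W K)"
  by (rule finite_W[OF K_sub])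

definition gen_sign :: "nat \<Rightarrow> real" where
  "gen_sign k = (if k \<in> J then - 1 else 1)"

lemma gen_sign_sq: "gen_sign k * gen_sign k = 1"
  by (simp add: gen_sign_def)

lemma pact_vdm: "k \<in> K \<Longrightarrow> pact (sw k) (vdm J) = Const (gen_sign k) * vdm J"
  using pact_vdm_J[OF fin_run_pairs, of k] pact_vdm_I[of k J] disj adjI[of k]
  by (auto simp: gen_sign_def Const_minus)

lemma pact_word_vdm:
  "set js \<subseteq> K \<Longrightarrow> pact (word_perm js) (vdm J) =
     Const (if even (length (filter (\<lambda>j. j \<in> J) js)) then 1 else - 1) * vdm J"
proof (induction js)
  case (Cons j js)
  have "pact (word_perm (j # js)) (vdm J) = pact (sw j) (pact (word_perm js) (vdm J))"
    unfolding word_perm_Cons by (rule pact_comp[OF bij_transpose bij_word_perm])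
  also have "\<dots> = Const (if even (length (filter (\<lambda>j. j \<in> J) js)) then 1 else - 1) * (Const (gen_sign j) * vdm J)"
    using Cons by (simp add: pact_Const_mult pact_vdm)
  also have "\<dots> = Const (if even (length (filter (\<lambda>j. j \<in> J) (j # js))) then 1 else - 1) * vdm J"
    by (simp add: gen_sign_def Const_minus)
  finally show ?case .
next
  case Nil
  show ?case unfolding word_perm_Nil pact_id by simp
qed

lemma Const_vdm_inj: "Const a * vdm J = Const b * vdm J \<longleftrightarrow> a = b"
proof -
  have "lookup (Const a) 0 = a" for a by (simp add: Const_def)
  then have "Const a = Const b \<longleftrightarrow> a = b" by metis
  then show ?thesis
    using vdm_nonzero[OF fin_run_pairs] by simp
qed

text \<open>Well-definedness of the sign: any word for the permutation multiplies the nonzero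
  polynomial \<open>vdm J\<close> by its own sign, so all words for one permutation have the same
  sign.\<close>

lemma det_word:
  assumes "set js \<subseteq> K"
  shows "det_J I J (word_perm js) = (if even (length (filter (\<lambda>j. j \<in> J) js)) then 1 else - 1)"
  unfolding det_J_def
proof (rule the_equality)
  fix e :: real assume "\<exists>ks. set ks \<subseteq> K \<and> word_perm js = word_perm ks \<and>
      e = (if even (length (filter (\<lambda>j. j \<in> J) ks)) then 1 else - 1)"
  then obtain ks where ks: "set ks \<subseteq> K" "word_perm js = word_perm ks"
     "e = (if even (length (filter (\<lambda>j. j \<in> J) ks)) then 1 else - 1)" by blast
  have "Const e * vdm J = Const (if even (length (filter (\<lambda>j. j \<in> J) js)) then 1 else - 1) * vdm J"
    using pact_word_vdm[OF ks(1)] pact_word_vdm[OF assms] ks(2,3) by metis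
  then show "e = (if even (length (filter (\<lambda>j. j \<in> J) js)) then 1 else - 1)"
    unfolding Const_vdm_inj .
qed (use assms in blast)

abbreviation "det \<equiv> det_J I J"

lemma det_vdm: "w \<in> W K \<Longrightarrow> pact w (vdm J) = Const (det w) * vdm J"
  using pact_word_vdm det_word by (auto simp: W_def)

lemma det_eqI: "w \<in> W K \<Longrightarrow> pact w (vdm J) = Const e * vdm J \<Longrightarrow> det w = e"
  using det_vdm Const_vdm_inj by metis

lemma det_comp: "v \<in> W K \<Longrightarrow> w \<in> W K \<Longrightarrow> det (v \<circ> w) = det v * det w"
proof (rule det_eqI[OF W_comp])
  assume vw: "v \<in> W K" "w \<in> W K"
  have "pact (v \<circ> w) (vdm J) = pact v (pact w (vdm J))"
    by (rule pact_comp[OF W_bij[OF vw(1)] W_bij[OF vw(2)]])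
  also have "\<dots> = Const (det w) * (Const (det v) * vdm J)"
    by (simp only: det_vdm[OF vw(1)] det_vdm[OF vw(2)] pact_Const_mult)
  finally show "pact (v \<circ> w) (vdm J) = Const (det v * det w) * vdm J"
    by (simp only: Const_mult mult_ac)
qed

lemma det_gen: "k \<in> K \<Longrightarrow> det (sw k) = gen_sign k"
  by (rule det_eqI[OF W_generator pact_vdm])

lemma det_nonzero: "w \<in> W K \<Longrightarrow> det w \<noteq> 0"
  using det_word by (auto simp: W_def split: if_splits)

lemma W_mono: "A \<subseteq> B \<Longrightarrow> W A \<subseteq> W B"
  by (auto simp: W_def)

lemma det_I: "w \<in> W I \<Longrightarrow> det w = 1"
proof (rule det_eqI)
  show "w \<in> W I \<Longrightarrow> w \<in> W K" using W_mono by blast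
  show "w \<in> W I \<Longrightarrow> pact w (vdm J) = Const 1 * vdm J"
  proof (induction rule: W_induct)
    case (step k w)
    then have "pact (sw k \<circ> w) (vdm J) = pact (sw k) (pact w (vdm J))"
      by (intro pact_comp bij_transpose W_bij)
    also have "\<dots> = Const 1 * vdm J"
      using step pact_vdm[of k] disj by (auto simp: gen_sign_def)
    finally show ?case .
  next
    case id
    show ?case unfolding pact_id by simp
  qed
qed

lemma sym_op_eq: "sym_op I J f = (\<Sum>w\<in>W K. Const (det w) * pact w f)"
proof -
  have l: "sym_op I J f = lin (\<lambda>\<kappa>. \<Sum>w\<in>W K. Const (det w) * monom (act w \<kappa>)) f"
    by (simp add: sym_op_def lin_def)
  show ?thesis unfolding l
  proof (induction f rule: mpol_induct)
    case (monom c \<kappa>)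
    show ?case
      by (simp add: lin_Const_mult pact_Const_mult sum_distrib_left mult.left_commute)
  qed (simp_all add: lin_add pact_add distrib_left sum.distrib)
qed

lemma sym_op_add: "sym_op I J (f + g) = sym_op I J f + sym_op I J g"
  and sym_op_Const_mult: "sym_op I J (Const c * f) = Const c * sym_op I J f"
  by (simp_all add: sym_op_eq pact_add pact_Const_mult distrib_left sum.distrib sum_distrib_left mult.left_commute)

lemma bij_W_left: "v \<in> W K \<Longrightarrow> bij_betw (\<lambda>w. v \<circ> w) (W K) (W K)"
  by (rule bij_betw_byWitness[where f' = "\<lambda>w. inv v \<circ> w"])
     (auto simp: o_assoc W_comp W_inv W_bij bij_is_inj bij_is_surj surj_iff[symmetric] inj_iff[THEN iffD1] surj_iff[THEN iffD1])

lemma bij_W_right: "v \<in> W K \<Longrightarrow> bij_betw (\<lambda>w. w \<circ> v) (W K) (W K)"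
  by (rule bij_betw_byWitness[where f' = "\<lambda>w. w \<circ> inv v"])
     (auto simp: o_assoc[symmetric] W_comp W_inv W_bij bij_is_inj bij_is_surj inj_iff[THEN iffD1] surj_iff[THEN iffD1])

lemma gen_sign_det_left: "k \<in> K \<Longrightarrow> w \<in> W K \<Longrightarrow> det w = gen_sign k * det (sw k \<circ> w)"
  using det_comp[OF W_generator] det_gen gen_sign_sq[of k] by (simp add: mult.assoc[symmetric])

lemma gen_sign_det_right: "k \<in> K \<Longrightarrow> w \<in> W K \<Longrightarrow> det w = gen_sign k * det (w \<circ> sw k)"
  using det_comp[OF _ W_generator] det_gen gen_sign_sq[of k] by (simp add: mult_ac)

lemma pact_sym_op:
  assumes k: "k \<in> K"
  shows "pact (sw k) (sym_op I J f) = Const (gen_sign k) * sym_op I J f"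
proof -
  have "pact (sw k) (sym_op I J f) = (\<Sum>w\<in>W K. Const (det w) * pact (sw k \<circ> w) f)"
    unfolding sym_op_eq pact_sum pact_Const_mult
    by (rule sum.cong) (auto simp: pact_comp W_bij)
  also have "\<dots> = (\<Sum>w\<in>W K. Const (gen_sign k) * (Const (det (sw k \<circ> w)) * pact (sw k \<circ> w) f))"
    by (rule sum.cong) (use gen_sign_det_left[OF k] in \<open>auto simp: Const_mult mult.assoc[symmetric]\<close>)
  also have "\<dots> = (\<Sum>w\<in>W K. Const (gen_sign k) * (Const (det w) * pact w f))"
    by (rule sum.reindex_bij_betw[OF bij_W_left[OF W_generator[OF k]]])
  also have "\<dots> = Const (gen_sign k) * sym_op I J f"
    by (simp add: sym_op_eq sum_distrib_left)
  finally show ?thesis .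
qed

lemma sym_op_pact:
  assumes k: "k \<in> K"
  shows "sym_op I J (pact (sw k) f) = Const (gen_sign k) * sym_op I J f"
proof -
  have "sym_op I J (pact (sw k) f) = (\<Sum>w\<in>W K. Const (gen_sign k) * (Const (det (w \<circ> sw k)) * pact (w \<circ> sw k) f))"
    unfolding sym_op_eq
    by (rule sum.cong) (use gen_sign_det_right[OF k] in \<open>auto simp: Const_mult mult.assoc[symmetric] pact_comp W_bij\<close>)
  also have "\<dots> = (\<Sum>w\<in>W K. Const (gen_sign k) * (Const (det w) * pact w f))"
    by (rule sum.reindex_bij_betw[OF bij_W_right[OF W_generator[OF k]]])
  also have "\<dots> = Const (gen_sign k) * sym_op I J f"
    by (simp add: sym_op_eq sum_distrib_left)
  finally show ?thesis .
qed

lemma domK: "k \<in> K \<Longrightarrow> lookup \<eta> (Suc k) \<le> lookup \<eta> k"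
  using domI domJ by fastforce

definition orb :: "comp set" where
  "orb = (\<lambda>w. act w \<eta>) ` W K"

lemma finite_orb: "finite orb"
  by (simp add: orb_def fin_W)

lemma \<eta>_orb: "\<eta> \<in> orb"
  unfolding orb_def by (rule image_eqI[OF _ W_id]) simp

lemma orb_act: "\<mu> \<in> orb \<Longrightarrow> w \<in> W K \<Longrightarrow> act w \<mu> \<in> orb"
  unfolding orb_def by (auto simp: act_comp[symmetric] W_bij intro!: imageI W_comp)

lemma orb_swap: "\<mu> \<in> orb \<Longrightarrow> k \<in> K \<Longrightarrow> act (sw k) \<mu> \<in> orb"
  by (intro orb_act W_generator)

lemma orb_composition: "\<mu> \<in> orb \<Longrightarrow> composition N \<mu>"
  unfolding orb_def using composition_act_W[OF K_sub _ \<eta>] by auto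

lemma orb_trans: "\<mu> \<in> orb \<Longrightarrow> \<nu> \<in> orb \<Longrightarrow> \<exists>w\<in>W K. \<nu> = act w \<mu>"
proof -
  assume "\<mu> \<in> orb" "\<nu> \<in> orb"
  then obtain v w where vw: "v \<in> W K" "w \<in> W K" "\<mu> = act v \<eta>" "\<nu> = act w \<eta>" by (auto simp: orb_def)
  have "act (w \<circ> inv v) \<mu> = act w (act (inv v) \<mu>)"
    using vw by (intro act_comp W_bij W_inv)
  then have "\<nu> = act (w \<circ> inv v) \<mu>"
    using vw by (simp only: act_inv_act[OF W_bij])
  then show ?thesis using vw W_comp W_inv by blast
qed

lemma orb_prec: "\<mu> \<in> orb \<Longrightarrow> \<mu> = \<eta> \<or> comp_prec N \<mu> \<eta>"
  unfolding orb_def using orbit_prec_dominant[OF K_sub _ \<eta> domK] by auto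

text \<open>A dominant element of the orbit is above every other element, in particular above
  \<open>\<eta>\<close>, which is itself dominant; irreflexivity then forces equality.\<close>

lemma orb_dominant_unique:
  assumes "\<mu> \<in> orb" "\<And>k. k \<in> K \<Longrightarrow> lookup \<mu> (Suc k) \<le> lookup \<mu> k"
  shows "\<mu> = \<eta>"
proof -
  obtain w where w: "w \<in> W K" "\<eta> = act w \<mu>" using orb_trans[OF assms(1) \<eta>_orb] by blast
  have "\<eta> = \<mu> \<or> comp_prec N \<eta> \<mu>"
    unfolding w(2) by (rule orbit_prec_dominant[OF K_sub w(1) orb_composition[OF assms(1)] assms(2)])
  then show ?thesis
    using orb_prec[OF assms(1)] comp_prec_trans comp_prec_irrefl by metis
qed

text \<open>Induction measure for moving through the orbit: exchanging an ascent strictly lowers it,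
  so repeated exchanges end at \<open>\<eta>\<close>, and reversed exchanges end at the lowest
  element.\<close>

definition height :: "comp \<Rightarrow> nat" where
  "height \<mu> = (\<Sum>j=1..N. j * lookup \<mu> j)"

lemma height_swap:
  assumes k: "k \<in> K" and lt: "lookup \<mu> k < lookup \<mu> (Suc k)"
  shows "height (act (sw k) \<mu>) < height \<mu>"
proof -
  have kN: "1 \<le> k" "k < N" using K_bounds k by auto
  have d: "{1..N} = insert k (insert (Suc k) ({1..N} - {k, Suc k}))"
    using kN by auto
  have s: "height \<nu> = k * lookup \<nu> k + Suc k * lookup \<nu> (Suc k) + (\<Sum>x\<in>{1..N} - {k, Suc k}. x * lookup \<nu> x)" for \<nu>
    unfolding height_def by (subst d) (simp add: add.assoc)
  have e: "(\<Sum>x\<in>{1..N} - {k, Suc k}. x * lookup (act (sw k) \<mu>) x) = (\<Sum>x\<in>{1..N} - {k, Suc k}. x * lookup \<mu> x)"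
    by (rule sum.cong) (auto simp: lookup_swap)
  show ?thesis
    unfolding s[of \<mu>] s[of "act (sw k) \<mu>"] e using lt by (simp add: lookup_swap)
qed

lemma orb_up_induct:
  assumes "\<mu> \<in> orb" "P \<eta>"
    and step: "\<And>\<mu> k. \<mu> \<in> orb \<Longrightarrow> k \<in> K \<Longrightarrow> lookup \<mu> k < lookup \<mu> (Suc k) \<Longrightarrow> P (act (sw k) \<mu>) \<Longrightarrow> P \<mu>"
  shows "P \<mu>"
  using assms(1)
proof (induction "height \<mu>" arbitrary: \<mu> rule: less_induct)
  case less
  show ?case
  proof (cases "\<mu> = \<eta>")
    case False
    then obtain k where k: "k \<in> K" "lookup \<mu> k < lookup \<mu> (Suc k)"
      using orb_dominant_unique[OF less(2)] by (meson not_le)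
    then show ?thesis
      using less(1)[OF height_swap[OF k] orb_swap[OF less(2) k(1)]] step[OF less(2) k] by blast
  qed (use assms in simp)
qed

definition lowest :: comp where
  "lowest = (SOME \<mu>. \<mu> \<in> orb \<and> (\<forall>\<nu>\<in>orb. height \<nu> \<le> height \<mu>))"

lemma lowest_props: "lowest \<in> orb \<and> (\<forall>\<nu>\<in>orb. height \<nu> \<le> height lowest)"
  unfolding lowest_def
proof (rule someI_ex)
  have "Max (height ` orb) \<in> height ` orb" using finite_orb \<eta>_orb by (intro Max_in) auto
  then obtain \<mu> where "\<mu> \<in> orb" "height \<mu> = Max (height ` orb)" by auto
  then show "\<exists>\<mu>. \<mu> \<in> orb \<and> (\<forall>\<nu>\<in>orb. height \<nu> \<le> height \<mu>)" using finite_orb by auto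
qed

lemma lowest_orb: "lowest \<in> orb"
  and height_le_low: "\<mu> \<in> orb \<Longrightarrow> height \<mu> \<le> height lowest"
  using lowest_props by blast+

lemma lowest_mono:
  assumes k: "k \<in> K" shows "lookup lowest k \<le> lookup lowest (Suc k)"
proof (rule ccontr)
  assume "\<not> ?thesis"
  then have "height (act (sw k) (act (sw k) lowest)) < height (act (sw k) lowest)"
    by (intro height_swap[OF k]) (simp add: lookup_swap)
  then show False
    using height_le_low[OF orb_swap[OF lowest_orb k]] by simp
qed

lemma lowest_prec: "\<nu> \<in> orb \<Longrightarrow> lowest = \<nu> \<or> comp_prec N lowest \<nu>"
proof -
  assume "\<nu> \<in> orb"
  then obtain w where w: "w \<in> W K" "\<nu> = act w lowest" using orb_trans[OF lowest_orb] by blast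
  show ?thesis
    unfolding w(2) by (rule orbit_prec_antidominant[OF K_sub w(1) orb_composition[OF lowest_orb] lowest_mono])
qed

lemma orb_antidominant_unique:
  assumes "\<mu> \<in> orb" "\<And>k. k \<in> K \<Longrightarrow> lookup \<mu> k \<le> lookup \<mu> (Suc k)"
  shows "\<mu> = lowest"
proof -
  obtain w where w: "w \<in> W K" "lowest = act w \<mu>" using orb_trans[OF assms(1) lowest_orb] by blast
  have "\<mu> = lowest \<or> comp_prec N \<mu> lowest"
    unfolding w(2) by (rule orbit_prec_antidominant[OF K_sub w(1) orb_composition[OF assms(1)] assms(2)])
  then show ?thesis
    using lowest_prec[OF assms(1)] comp_prec_trans comp_prec_irrefl by metis
qed

lemma orb_down_induct:
  assumes "\<mu> \<in> orb" "P lowest"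
    and step: "\<And>\<mu> k. \<mu> \<in> orb \<Longrightarrow> k \<in> K \<Longrightarrow> lookup \<mu> k < lookup \<mu> (Suc k) \<Longrightarrow> P \<mu> \<Longrightarrow> P (act (sw k) \<mu>)"
  shows "P \<mu>"
  using assms(1)
proof (induction "height lowest - height \<mu>" arbitrary: \<mu> rule: less_induct)
  case less
  show ?case
  proof (cases "\<mu> = lowest")
    case False
    then obtain k where k: "k \<in> K" "lookup \<mu> (Suc k) < lookup \<mu> k"
      using orb_antidominant_unique[OF less(2)] by (meson not_le)
    let ?\<nu> = "act (sw k) \<mu>"
    have lt: "lookup ?\<nu> k < lookup ?\<nu> (Suc k)" using k by (simp add: lookup_swap)
    have o: "?\<nu> \<in> orb" using orb_swap[OF less(2) k(1)] .
    have "height \<mu> < height ?\<nu>" using height_swap[OF k(1) lt] by simp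
    then have "P ?\<nu>" using height_le_low[OF o] by (intro less(1) o) linarith
    then show ?thesis using step[OF o k(1) lt] by simp
  qed (use assms in simp)
qed

text \<open>For \<open>\<eta>\<close> itself the entries strictly decrease along runs of
  \<open>J\<close>. Swaps in \<open>J\<close> permute the roots and swaps in \<open>I\<close> do not
  touch them, so distinctness spreads over the orbit.\<close>

lemma orb_regular:
  assumes "\<mu> \<in> orb" shows "x < y \<Longrightarrow> {x..<y} \<subseteq> J \<Longrightarrow> lookup \<mu> x \<noteq> lookup \<mu> y"
proof -
  have "\<forall>x y. x < y \<longrightarrow> {x..<y} \<subseteq> J \<longrightarrow> lookup \<mu> x \<noteq> lookup \<mu> y"
  proof (rule orb_up_induct[OF assms])
    have "lookup \<eta> y < lookup \<eta> x" if "x < y" "{x..<y} \<subseteq> J" for x y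
      using that
    proof (induction y)
      case (Suc y)
      then have "lookup \<eta> (Suc y) < lookup \<eta> y" using domJ[of y] by (simp add: subset_iff)
      moreover have "lookup \<eta> y \<le> lookup \<eta> x"
      proof (cases "x = y")
        case False
        then have "x < y" using Suc.prems by simp
        moreover have "{x..<y} \<subseteq> J"
          using Suc.prems(2) by (rule order_trans[rotated]) simp
        ultimately show ?thesis using Suc.IH by simp
      qed simp
      ultimately show ?case by simp
    qed simp
    then show "\<forall>x y. x < y \<longrightarrow> {x..<y} \<subseteq> J \<longrightarrow> lookup \<eta> x \<noteq> lookup \<eta> y" by force
  next
    fix \<mu> k assume k: "k \<in> K" and "\<mu> \<in> orb" and lt: "lookup \<mu> k < lookup \<mu> (Suc k)"
      and IH: "\<forall>x y. x < y \<longrightarrow> {x..<y} \<subseteq> J \<longrightarrow> lookup (act (sw k) \<mu>) x \<noteq> lookup (act (sw k) \<mu>) y"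
    show "\<forall>x y. x < y \<longrightarrow> {x..<y} \<subseteq> J \<longrightarrow> lookup \<mu> x \<noteq> lookup \<mu> y"
    proof (intro allI impI)
      fix x y assume "x < y" "{x..<y} \<subseteq> J"
      then have R: "(x, y) \<in> run_pairs J" by (simp add: run_pairs_def)
      show "lookup \<mu> x \<noteq> lookup \<mu> y"
      proof (cases "k \<in> J")
        case True
        show ?thesis
        proof (cases "(x, y) = (k, Suc k)")
          case False
          then have "map_prod (sw k) (sw k) (x, y) \<in> run_pairs J - {(k, Suc k)}"
            using R by (intro run_pairs_swap[OF True]) simp
          then have "(sw k x, sw k y) \<in> run_pairs J" by simp
          then have "sw k x < sw k y" "{sw k x..<sw k y} \<subseteq> J" by (auto simp: run_pairs_def)
          then have "lookup (act (sw k) \<mu>) (sw k x) \<noteq> lookup (act (sw k) \<mu>) (sw k y)" using IH by blast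
          then show ?thesis by (simp add: lookup_swap)
        next
          case True
          then show ?thesis using lt by simp
        qed
      next
        case False
        then have "k \<in> I" using k by simp
        then have "k - 1 \<notin> J" "Suc k \<notin> J" using adjI by auto
        then have "sw k x = x" "sw k y = y"
          by (rule run_pairs_no_swap[OF False _ _ R])+
        moreover have "lookup (act (sw k) \<mu>) x \<noteq> lookup (act (sw k) \<mu>) y"
          using IH \<open>x < y\<close> \<open>{x..<y} \<subseteq> J\<close> by blast
        ultimately show ?thesis by (simp add: lookup_swap)
      qed
    qed
  qed
  then show "x < y \<Longrightarrow> {x..<y} \<subseteq> J \<Longrightarrow> lookup \<mu> x \<noteq> lookup \<mu> y" by blast
qed

lemma orb_regular1: "\<mu> \<in> orb \<Longrightarrow> k \<in> J \<Longrightarrow> lookup \<mu> k \<noteq> lookup \<mu> (Suc k)"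
  by (rule orb_regular) (auto simp: less_Suc_eq_le)

lemma minus_minus_eq: "minus_minus I J \<eta> = lowest"
  unfolding minus_minus_def
proof (rule the_equality)
  show "(\<exists>w\<in>W K. lowest = act w \<eta>) \<and> (\<forall>i\<in>I. lookup lowest i \<le> lookup lowest (i + 1)) \<and>
    (\<forall>j\<in>J. lookup lowest j < lookup lowest (j + 1))"
    using lowest_orb lowest_mono orb_regular1[OF lowest_orb] by (auto simp: orb_def le_less)
next
  fix \<mu> assume "(\<exists>w\<in>W K. \<mu> = act w \<eta>) \<and> (\<forall>i\<in>I. lookup \<mu> i \<le> lookup \<mu> (i + 1)) \<and>
    (\<forall>j\<in>J. lookup \<mu> j < lookup \<mu> (j + 1))"
  then show "\<mu> = lowest"
    by (intro orb_antidominant_unique) (auto simp: orb_def le_less)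
qed

text \<open>Entries are distinct along a run of \<open>J\<close>, so an element fixing
  \<open>\<eta>\<close> cannot move a point across a cut inside such a run. It thus preserves every
  cut outside \<open>I\<close> and lies in \<open>W I\<close>.\<close>

lemma stab_W_I:
  assumes w: "w \<in> W K" and fx: "act w \<eta> = \<eta>"
  shows "w \<in> W I"
proof -
  have l: "lookup \<eta> (w x) = lookup \<eta> x" for x
    using lookup_act[OF W_bij[OF w], of \<eta> "w x"] fx by (simp add: W_bij[OF w] bij_is_inj)
  \<comment> \<open>By the separation of \<open>I\<close> and \<open>J\<close>, a run of generators
    that meets \<open>J\<close> stays in \<open>J\<close>; membership is propagated upwards and
    downwards from \<open>q\<close>.\<close>
  have run: "{a..<b} \<subseteq> J" if "{a..<b} \<subseteq> K" "q \<in> {a..<b}" "q \<in> J" for a b q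
  proof -
    have up: "q + n < b \<Longrightarrow> q + n \<in> J" for n
    proof (induction n)
      case (Suc n)
      then have "q + n \<in> J" "q + Suc n \<in> K" using that by (auto simp: subset_iff)
      then show ?case using adjJ[of "q + n"] by auto
    qed (use that in simp)
    have down: "a \<le> q - n \<Longrightarrow> q - n \<in> J" for n
    proof (induction n)
      case (Suc n)
      then have "q - n \<in> J" "q - Suc n \<in> K" using that by (auto simp: subset_iff)
      then show ?case using adjJ[of "q - n"] by auto
    qed (use that in simp)
    show ?thesis
    proof
      fix x assume x: "x \<in> {a..<b}"
      show "x \<in> J"
      proof (cases "q \<le> x")
        case True
        then show ?thesis using up[of "x - q"] x by simp
      next
        case False
        then show ?thesis using down[of "q - x"] x by simp
      qed
    qed
  qed
  have cut: "w ` {..q} \<subseteq> {..q}" if q: "q \<notin> I" for q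
  proof (cases "q \<in> J")
    case False
    then show ?thesis using W_cut[OF w, of q] q by simp
  next
    case True
    show ?thesis
    proof (rule image_subsetI, rule ccontr)
      fix x assume x: "x \<in> {..q}" "w x \<notin> {..q}"
      have "{x..<w x} \<subseteq> K"
      proof (rule subsetI, rule ccontr)
        fix r assume r: "r \<in> {x..<w x}" "r \<notin> K"
        then have "w x \<in> w ` {..r}" by (intro imageI) auto
        then have "w x \<in> {..r}" unfolding W_cut[OF w r(2)] .
        then show False using r by simp
      qed
      then have "{x..<w x} \<subseteq> J" using x True by (intro run[of x "w x" q]) auto
      then have "lookup \<eta> x \<noteq> lookup \<eta> (w x)" using x by (intro orb_regular[OF \<eta>_orb]) auto
      then show False using l by simp
    qed
  qed
  have "w ` {..q} = {..q}" if "q \<notin> I" for q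
    using cut[OF that] by (intro card_subset_eq) (auto simp: card_image inj_on_subset[OF bij_is_inj[OF W_bij[OF w]]])
  then show ?thesis
    by (intro cut_W[OF I_sub W_bij[OF w]])
qed

lemma stab_eq: "{w \<in> W K. act w \<eta> = \<eta>} = {w \<in> W I. act w \<eta> = \<eta>}"
  using stab_W_I W_mono by blast

lemma stab_card_pos: "stab_card I \<eta> > 0"
proof -
  have "finite {w \<in> W I. act w \<eta> = \<eta>}" using finite_W[OF I_sub] by simp
  moreover have "id \<in> {w \<in> W I. act w \<eta> = \<eta>}" using W_id by simp
  ultimately show ?thesis unfolding stab_card_def by (metis card_gt_0_iff empty_iff)
qed

abbreviation "E \<equiv> nonsym_jack N \<alpha>"

lemma lookup_E_orb:
  assumes "\<mu> \<in> orb" "\<nu> \<in> orb" "lookup (E \<mu>) \<nu> \<noteq> 0"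
  shows "\<nu> = \<mu> \<or> comp_prec N \<nu> \<mu>"
  using nonsym_jack_triangular[OF N1 \<alpha> orb_composition[OF assms(1)]] assms(3)
  by (auto simp: monic_triangular_def in_keys_iff)

lemma lookup_E_self: "\<mu> \<in> orb \<Longrightarrow> lookup (E \<mu>) \<mu> = 1"
  by (rule lookup_nonsym_jack[OF N1 \<alpha> orb_composition])

text \<open>The lowest element is below the whole orbit, so by triangularity no other orbit monomial
  occurs in its polynomial. This makes leading coefficients of symmetrizations countable.\<close>

lemma lookup_E_low: "\<nu> \<in> orb \<Longrightarrow> lookup (E lowest) \<nu> = (if \<nu> = lowest then 1 else 0)"
  using lookup_E_orb[OF lowest_orb] lookup_E_self[OF lowest_orb] lowest_prec comp_prec_trans comp_prec_irrefl
  by metis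

lemma lookup_E_top: "\<mu> \<in> orb \<Longrightarrow> lookup (E \<mu>) \<eta> = (if \<mu> = \<eta> then 1 else 0)"
  using lookup_E_orb[OF _ \<eta>_orb] lookup_E_self[OF \<eta>_orb] orb_prec comp_prec_trans comp_prec_irrefl
  by metis

text \<open>Only the elements \<open>\<sigma> \<circ> w\<^sub>0\<close> with \<open>\<sigma>\<close> in the stabilizer of \<open>\<eta>\<close> contribute, where
  \<open>w\<^sub>0\<close> is a fixed element sending the lowest element of the orbit to \<open>\<eta>\<close>.\<close>

lemma lookup_sum_low:
  obtains w0 where "w0 \<in> W K" and "\<And>c. lookup (\<Sum>w\<in>W K. Const (c w) * pact w (E lowest)) \<eta> =
    (\<Sum>\<sigma>\<in>{\<sigma>\<in>W I. act \<sigma> \<eta> = \<eta>}. c (\<sigma> \<circ> w0))"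
proof -
  obtain w0 where w0: "w0 \<in> W K" "\<eta> = act w0 lowest" using orb_trans[OF lowest_orb \<eta>_orb] by blast
  have "lookup (\<Sum>w\<in>W K. Const (c w) * pact w (E lowest)) \<eta> = (\<Sum>\<sigma>\<in>{\<sigma>\<in>W I. act \<sigma> \<eta> = \<eta>}. c (\<sigma> \<circ> w0))" for c
  proof -
    have "lookup (\<Sum>w\<in>W K. Const (c w) * pact w (E lowest)) \<eta> =
      (\<Sum>w\<in>W K. c w * lookup (E lowest) (act (inv w) \<eta>))"
      by (simp add: lookup_sum lookup_Const_mult lookup_pact W_bij)
    also have "\<dots> = (\<Sum>w\<in>W K. if act w lowest = \<eta> then c w else 0)"
    proof (rule sum.cong)
      fix w assume w: "w \<in> W K"
      have "act (inv w) \<eta> = lowest \<longleftrightarrow> act w lowest = \<eta>"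
        using act_act_inv act_inv_act W_bij[OF w] by metis
      then show "c w * lookup (E lowest) (act (inv w) \<eta>) = (if act w lowest = \<eta> then c w else 0)"
        using lookup_E_low[OF orb_act[OF \<eta>_orb W_inv[OF w]]] by simp
    qed simp
    also have "\<dots> = (\<Sum>w\<in>W K. if act (w \<circ> w0) lowest = \<eta> then c (w \<circ> w0) else 0)"
      by (rule sum.reindex_bij_betw[OF bij_W_right[OF w0(1)], symmetric])
    also have "\<dots> = (\<Sum>w\<in>W K. if act w \<eta> = \<eta> then c (w \<circ> w0) else 0)"
      by (rule sum.cong) (use w0 in \<open>auto simp: act_comp W_bij\<close>)
    also have "\<dots> = (\<Sum>\<sigma>\<in>{\<sigma>\<in>W I. act \<sigma> \<eta> = \<eta>}. c (\<sigma> \<circ> w0))"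
      unfolding stab_eq[symmetric] using fin_W by (simp add: sum.If_cases Int_def)
    finally show ?thesis .
  qed
  with w0(1) show ?thesis using that by blast
qed

end

section \<open>Prescribed symmetry\<close>

context prescribed
begin

text \<open>All polynomials compared later lie in the span of the \<open>E \<mu>\<close> over the
  orbit, and identities among them are proved on coefficients.\<close>

definition comb :: "(comp \<Rightarrow> real) \<Rightarrow> mpol" where
  "comb b = (\<Sum>\<mu>\<in>orb. Const (b \<mu>) * E \<mu>)"

lemma comb_add: "comb b + comb c = comb (\<lambda>\<mu>. b \<mu> + c \<mu>)"
  by (simp add: comb_def Const_add distrib_right sum.distrib)

lemma comb_diff: "comb b - comb c = comb (\<lambda>\<mu>. b \<mu> - c \<mu>)"
  by (simp add: comb_def Const_diff left_diff_distrib sum_subtractf)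

lemma comb_Const_mult: "Const x * comb b = comb (\<lambda>\<mu>. x * b \<mu>)"
  by (simp add: comb_def Const_mult sum_distrib_left mult.assoc)

lemma comb_cong: "(\<And>\<mu>. \<mu> \<in> orb \<Longrightarrow> b \<mu> = c \<mu>) \<Longrightarrow> comb b = comb c"
  unfolding comb_def by (rule sum.cong) auto

lemma lookup_comb: "lookup (comb b) \<kappa> = (\<Sum>\<mu>\<in>orb. b \<mu> * lookup (E \<mu>) \<kappa>)"
  by (simp add: comb_def lookup_sum lookup_Const_mult)

lemma lookup_comb_top: "lookup (comb b) \<eta> = b \<eta>"
proof -
  have "lookup (comb b) \<eta> = (\<Sum>\<mu>\<in>orb. if \<mu> = \<eta> then b \<mu> else 0)"
    unfolding lookup_comb by (rule sum.cong) (auto simp: lookup_E_top)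
  then show ?thesis using finite_orb \<eta>_orb by simp
qed

text \<open>Linear independence: at a maximal \<mu> with nonzero coefficient only
  \<open>E \<mu>\<close> contributes to the monomial z^\<mu>.\<close>

lemma comb_zero:
  assumes "comb b = 0" "\<mu> \<in> orb"
  shows "b \<mu> = 0"
proof (rule ccontr)
  assume "b \<mu> \<noteq> 0"
  let ?A = "{\<mu>\<in>orb. b \<mu> \<noteq> 0}"
  have "\<exists>m\<in>?A. \<forall>x\<in>?A. x \<noteq> m \<longrightarrow> \<not> comp_prec N m x"
    using assms(2) \<open>b \<mu> \<noteq> 0\<close> finite_orb
    by (intro Finite_Set.bex_max_element asymp_onI transp_onI)
       (auto dest: comp_prec_trans simp: comp_prec_irrefl)
  then obtain m where m: "m \<in> orb" "b m \<noteq> 0" "\<And>x. x \<in> orb \<Longrightarrow> b x \<noteq> 0 \<Longrightarrow> x \<noteq> m \<Longrightarrow> \<not> comp_prec N m x"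
    by blast
  have "lookup (comb b) m = (\<Sum>\<nu>\<in>orb. if \<nu> = m then b \<nu> else 0)"
    unfolding lookup_comb
  proof (rule sum.cong)
    fix \<nu> assume \<nu>: "\<nu> \<in> orb"
    show "b \<nu> * lookup (E \<nu>) m = (if \<nu> = m then b \<nu> else 0)"
      using lookup_E_self[OF m(1)] lookup_E_orb[OF \<nu> m(1)] m(3)[OF \<nu>] by auto
  qed simp
  also have "\<dots> = b m" using m finite_orb by simp
  finally show False using assms(1) m(2) by simp
qed

lemma comb_inj: "comb b = comb c \<Longrightarrow> \<mu> \<in> orb \<Longrightarrow> b \<mu> = c \<mu>"
  using comb_zero[of "\<lambda>\<mu>. b \<mu> - c \<mu>" \<mu>] by (simp flip: comb_diff)

definition bar_gap :: "nat \<Rightarrow> comp \<Rightarrow> real" where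
  "bar_gap k \<mu> = eta_bar N \<alpha> \<mu> (Suc k) - eta_bar N \<alpha> \<mu> k"

lemma bar_gap_swap: "k \<in> K \<Longrightarrow> lookup \<mu> k \<noteq> lookup \<mu> (Suc k) \<Longrightarrow> bar_gap k (act (sw k) \<mu>) = - bar_gap k \<mu>"
  using K_bounds[of k] eta_bar_swap[of k N k \<mu> \<alpha>] eta_bar_swap[of k N "Suc k" \<mu> \<alpha>]
  by (simp add: bar_gap_def)

text \<open>The gap is a hook length of the swapped composition. Being above 1, it keeps both signs
  in 1/g + 1 and 1/g - 1 away from zero.\<close>

lemma bar_gap_gt1: "k \<in> K \<Longrightarrow> lookup \<mu> k < lookup \<mu> (Suc k) \<Longrightarrow> bar_gap k \<mu> > 1"
  using K_bounds[of k] d_comp_swap(2)[OF \<alpha>, of k N "act (sw k) \<mu>" "bar_gap k \<mu>"] bar_gap_swap[of k \<mu>]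
  by (simp add: lookup_swap) (simp add: bar_gap_def)

lemma bar_gap_eq: "k \<in> K \<Longrightarrow> lookup \<mu> k = lookup \<mu> (Suc k) \<Longrightarrow> bar_gap k \<mu> = - 1"
  using K_bounds[of k] eta_bar_adjacent[of k N \<mu> \<alpha>] by (simp add: bar_gap_def)

lemma bar_gap_nonzero: "k \<in> K \<Longrightarrow> bar_gap k \<mu> \<noteq> 0"
  using bar_gap_gt1[of k \<mu>] bar_gap_gt1[of k "act (sw k) \<mu>"] bar_gap_eq[of k \<mu>] bar_gap_swap[of k \<mu>]
  by (cases "lookup \<mu> k" "lookup \<mu> (Suc k)" rule: linorder_cases) (auto simp: lookup_swap)

lemma E_swap_up:
  assumes "\<mu> \<in> orb" "k \<in> K" "lookup \<mu> k < lookup \<mu> (Suc k)"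
  shows "E (act (sw k) \<mu>) = pact (sw k) (E \<mu>) + Const (1 / bar_gap k \<mu>) * E \<mu>"
  using K_bounds[OF assms(2)] assms
  by (intro nonsym_jack_swap N1 \<alpha> orb_composition bar_gap_def)

definition swap_coeff :: "nat \<Rightarrow> comp \<Rightarrow> real" where
  "swap_coeff k \<mu> = (if lookup \<mu> k < lookup \<mu> (Suc k) then 1 else 1 - 1 / (bar_gap k \<mu>)\<^sup>2)"

text \<open>For an ascent this is the construction of \<open>E\<close> at the swapped composition.
  For a descent that relation is inverted with s^2 = 1, which produces 1 - 1/g^2. For equal entries
  g = -1, the first coefficient is 0 and the polynomial is invariant.\<close>

lemma pact_E:
  assumes \<mu>: "\<mu> \<in> orb" and k: "k \<in> K"
  shows "pact (sw k) (E \<mu>) = Const (swap_coeff k \<mu>) * E (act (sw k) \<mu>) - Const (1 / bar_gap k \<mu>) * E \<mu>"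
proof (cases "lookup \<mu> k" "lookup \<mu> (Suc k)" rule: linorder_cases)
  case less
  then show ?thesis using E_swap_up[OF \<mu> k less] by (simp add: swap_coeff_def)
next
  case equal
  then have "pact (sw k) (E \<mu>) = E \<mu>"
    using K_bounds[OF k] \<mu> by (intro nonsym_jack_swap_fixed N1 \<alpha> orb_composition)
  then show ?thesis
    using equal bar_gap_eq[OF k equal] by (simp add: swap_coeff_def Const_minus)
next
  case greater
  let ?\<nu> = "act (sw k) \<mu>"
  have lt: "lookup ?\<nu> k < lookup ?\<nu> (Suc k)" using greater by (simp add: lookup_swap)
  define D where "D = bar_gap k \<mu>"
  have d: "bar_gap k ?\<nu> = - D" using greater bar_gap_swap[OF k, of \<mu>] by (simp add: D_def)
  have up: "E \<mu> = pact (sw k) (E ?\<nu>) + Const (- (1 / D)) * E ?\<nu>"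
    using E_swap_up[OF orb_swap[OF \<mu> k] k lt] d by simp
  have "pact (sw k) (E \<mu>) = pact (sw k) (pact (sw k) (E ?\<nu>) + Const (- (1 / D)) * E ?\<nu>)"
    by (rule arg_cong[OF up])
  also have "\<dots> = E ?\<nu> + Const (- (1 / D)) * pact (sw k) (E ?\<nu>)"
    by (simp add: pact_add pact_Const_mult)
  also have "pact (sw k) (E ?\<nu>) = E \<mu> + Const (1 / D) * E ?\<nu>"
    using up by (simp add: Const_minus)
  also have "E ?\<nu> + Const (- (1 / D)) * (E \<mu> + Const (1 / D) * E ?\<nu>)
    = Const (1 - 1 / D\<^sup>2) * E ?\<nu> - Const (1 / D) * E \<mu>"
  proof -
    have c: "Const (1 - 1 / D\<^sup>2) = 1 - Const (1 / D) * Const (1 / D)"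
      by (simp add: Const_diff power2_eq_square flip: Const_mult)
    show ?thesis unfolding c by (simp add: Const_minus algebra_simps)
  qed
  finally show ?thesis using greater by (simp add: swap_coeff_def D_def)
qed

lemma bij_orb_swap: "k \<in> K \<Longrightarrow> bij_betw (act (sw k)) orb orb"
  by (rule bij_betw_byWitness[where f' = "act (sw k)"]) (auto intro: orb_swap)

lemma pact_comb:
  assumes k: "k \<in> K"
  shows "pact (sw k) (comb b) = comb (\<lambda>\<mu>. swap_coeff k (act (sw k) \<mu>) * b (act (sw k) \<mu>) - b \<mu> / bar_gap k \<mu>)"
proof -
  let ?s = "act (sw k)"
  have "pact (sw k) (comb b) = (\<Sum>\<mu>\<in>orb. Const (b \<mu>) * (Const (swap_coeff k \<mu>) * E (?s \<mu>) - Const (1 / bar_gap k \<mu>) * E \<mu>))"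
    unfolding comb_def pact_sum pact_Const_mult by (rule sum.cong) (simp_all only: pact_E[OF _ k])
  also have "\<dots> = (\<Sum>\<mu>\<in>orb. Const (swap_coeff k \<mu> * b \<mu>) * E (?s \<mu>)) - (\<Sum>\<mu>\<in>orb. Const (b \<mu> / bar_gap k \<mu>) * E \<mu>)"
    unfolding sum_subtractf[symmetric]
  proof (rule sum.cong)
    fix \<mu>
    have "Const (b \<mu> / bar_gap k \<mu>) = Const (b \<mu>) * Const (1 / bar_gap k \<mu>)"
      by (simp flip: Const_mult)
    then show "Const (b \<mu>) * (Const (swap_coeff k \<mu>) * E (?s \<mu>) - Const (1 / bar_gap k \<mu>) * E \<mu>) =
        Const (swap_coeff k \<mu> * b \<mu>) * E (?s \<mu>) - Const (b \<mu> / bar_gap k \<mu>) * E \<mu>"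
      by (simp add: Const_mult algebra_simps)
  qed simp
  also have "(\<Sum>\<mu>\<in>orb. Const (swap_coeff k \<mu> * b \<mu>) * E (?s \<mu>)) =
      (\<Sum>\<mu>\<in>orb. Const (swap_coeff k (?s \<mu>) * b (?s \<mu>)) * E (?s (?s \<mu>)))"
    by (rule sum.reindex_bij_betw[OF bij_orb_swap[OF k], symmetric])
  finally show ?thesis
    by (simp add: comb_def Const_diff left_diff_distrib sum_subtractf)
qed

text \<open>Compare the coefficients at the swapped composition, where the contribution of
  \<open>\<mu>\<close> has coefficient 1. This expresses every coefficient through one closer to
  \<open>\<eta>\<close>.\<close>

lemma comb_symmetryD:
  assumes k: "k \<in> K" and e: "pact (sw k) (comb b) = Const x * comb b"
    and \<mu>: "\<mu> \<in> orb" and lt: "lookup \<mu> k < lookup \<mu> (Suc k)"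
  shows "b \<mu> = (x - 1 / bar_gap k \<mu>) * b (act (sw k) \<mu>)"
proof -
  let ?\<nu> = "act (sw k) \<mu>"
  have "swap_coeff k (act (sw k) ?\<nu>) * b (act (sw k) ?\<nu>) - b ?\<nu> / bar_gap k ?\<nu> = x * b ?\<nu>"
    using e by (intro comb_inj[where \<mu> = ?\<nu>] orb_swap[OF \<mu> k]) (simp add: pact_comb[OF k] comb_Const_mult)
  then show ?thesis
    using lt bar_gap_swap[OF k, of \<mu>] by (simp add: swap_coeff_def algebra_simps)
qed

lemma comb_symmetricI:
  assumes k: "k \<in> K"
    and r: "\<And>\<mu>. \<mu> \<in> orb \<Longrightarrow> lookup \<mu> k < lookup \<mu> (Suc k) \<Longrightarrow> b \<mu> = (1 - 1 / bar_gap k \<mu>) * b (act (sw k) \<mu>)"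
  shows "pact (sw k) (comb b) = comb b"
  unfolding pact_comb[OF k]
proof (rule comb_cong)
  fix \<mu> assume \<mu>: "\<mu> \<in> orb"
  let ?\<nu> = "act (sw k) \<mu>"
  have nz: "bar_gap k \<mu> \<noteq> 0" by (rule bar_gap_nonzero[OF k])
  show "swap_coeff k ?\<nu> * b ?\<nu> - b \<mu> / bar_gap k \<mu> = b \<mu>"
  proof (cases "lookup \<mu> k" "lookup \<mu> (Suc k)" rule: linorder_cases)
    case less
    then have c: "swap_coeff k ?\<nu> = 1 - 1 / (bar_gap k \<mu>)\<^sup>2"
      using bar_gap_swap[OF k, of \<mu>] by (simp add: swap_coeff_def lookup_swap)
    show ?thesis
      unfolding c r[OF \<mu> less] using nz by (simp add: field_simps power2_eq_square)
  next
    case equal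
    have "?\<nu> = \<mu>"
      using equal by (intro poly_mapping_eqI) (auto simp: lookup_swap Transposition.transpose_def)
    then show ?thesis
      using equal bar_gap_eq[OF k equal] by (simp add: swap_coeff_def)
  next
    case greater
    then have "b ?\<nu> = (1 + 1 / bar_gap k \<mu>) * b \<mu>"
      using r[OF orb_swap[OF \<mu> k]] bar_gap_swap[OF k, of \<mu>] by (simp add: lookup_swap)
    moreover have "swap_coeff k ?\<nu> = 1" using greater by (simp add: swap_coeff_def lookup_swap)
    ultimately show ?thesis by (simp add: algebra_simps)
  qed
qed

text \<open>The recursion propagates the zero at \<open>\<eta>\<close> down the whole orbit. Hence
  combinations with the same symmetry are proportional as soon as their coefficients at
  \<open>\<eta>\<close> are.\<close>

lemma comb_symmetric_zero:
  assumes r: "\<And>k. k \<in> K \<Longrightarrow> \<exists>x. pact (sw k) (comb b) = Const x * comb b" and "b \<eta> = 0"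
  shows "comb b = 0"
proof -
  have "b \<mu> = 0" if "\<mu> \<in> orb" for \<mu>
  proof (rule orb_up_induct[OF that, of "\<lambda>\<mu>. b \<mu> = 0"])
    fix \<mu> k assume "\<mu> \<in> orb" "k \<in> K" "lookup \<mu> k < lookup \<mu> (Suc k)" "b (act (sw k) \<mu>) = 0"
    then show "b \<mu> = 0" using r[of k] comb_symmetryD[of k b _ \<mu>] by fastforce
  qed fact
  then show ?thesis
    by (simp add: comb_def)
qed

definition in_span :: "mpol \<Rightarrow> bool" where
  "in_span f \<longleftrightarrow> (\<exists>b. f = comb b)"

lemma in_span_E: "\<mu> \<in> orb \<Longrightarrow> in_span (E \<mu>)"
  unfolding in_span_def
proof (rule exI)
  assume "\<mu> \<in> orb"
  have "comb (\<lambda>\<nu>. if \<nu> = \<mu> then 1 else 0) = (\<Sum>\<nu>\<in>orb. if \<nu> = \<mu> then E \<nu> else 0)"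
    unfolding comb_def by (rule sum.cong) auto
  then show "E \<mu> = comb (\<lambda>\<nu>. if \<nu> = \<mu> then 1 else 0)"
    using finite_orb \<open>\<mu> \<in> orb\<close> by simp
qed

lemma in_span_0: "in_span 0"
  unfolding in_span_def by (rule exI[of _ "\<lambda>_. 0"]) (simp add: comb_def)

lemma in_span_add: "in_span f \<Longrightarrow> in_span g \<Longrightarrow> in_span (f + g)"
  unfolding in_span_def using comb_add by metis

lemma in_span_Const_mult: "in_span f \<Longrightarrow> in_span (Const c * f)"
  unfolding in_span_def using comb_Const_mult by metis

lemma in_span_sum: "(\<And>a. a \<in> A \<Longrightarrow> in_span (F a)) \<Longrightarrow> in_span (sum F A)"
  by (induction A rule: infinite_finite_induct) (auto intro: in_span_add in_span_0)

lemma in_span_pact: "w \<in> W K \<Longrightarrow> in_span f \<Longrightarrow> in_span (pact w f)"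
proof (induction rule: W_induct)
  case (step k w)
  have "pact (sw k \<circ> w) f = pact (sw k) (pact w f)"
    using step by (intro pact_comp bij_transpose W_bij)
  moreover have "in_span (pact (sw k) (pact w f))"
    using step pact_comb[of k] unfolding in_span_def by metis
  ultimately show ?case by (simp only:)
next
  case id
  then show ?case by (simp only: pact_id)
qed

lemma in_span_sym_op: "\<mu> \<in> orb \<Longrightarrow> in_span (sym_op I J (E \<mu>))"
  unfolding sym_op_eq by (intro in_span_sum in_span_Const_mult in_span_pact in_span_E)

text \<open>Start at the lowest element, where z^\<eta> gets the stabilizer order times a sign, and
  climb: a swap step multiplies the symmetrization by sign + 1/g, nonzero because g > 1.\<close>

lemma sym_op_nonzero:
  assumes "\<mu> \<in> orb"
  shows "sym_op I J (E \<mu>) \<noteq> 0"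
proof (rule orb_down_induct[OF assms, of "\<lambda>\<mu>. sym_op I J (E \<mu>) \<noteq> 0"])
  obtain w0 where w0: "w0 \<in> W K" and l: "\<And>c. lookup (\<Sum>w\<in>W K. Const (c w) * pact w (E lowest)) \<eta> =
    (\<Sum>\<sigma>\<in>{\<sigma>\<in>W I. act \<sigma> \<eta> = \<eta>}. c (\<sigma> \<circ> w0))"
    using lookup_sum_low by blast
  have "lookup (sym_op I J (E lowest)) \<eta> = (\<Sum>\<sigma>\<in>{\<sigma>\<in>W I. act \<sigma> \<eta> = \<eta>}. det (\<sigma> \<circ> w0))"
    unfolding sym_op_eq by (rule l)
  also have "\<dots> = (\<Sum>\<sigma>\<in>{\<sigma>\<in>W I. act \<sigma> \<eta> = \<eta>}. det w0)"
    by (rule sum.cong) (use w0 det_comp det_I W_mono[of I K] in auto)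
  also have "\<dots> = stab_card I \<eta> * det w0"
    by (simp add: stab_card_def)
  also have "\<dots> \<noteq> 0"
    using stab_card_pos det_nonzero[OF w0] by simp
  finally show "sym_op I J (E lowest) \<noteq> 0" by auto
next
  fix \<mu> k assume \<mu>: "\<mu> \<in> orb" and k: "k \<in> K" and lt: "lookup \<mu> k < lookup \<mu> (Suc k)"
    and nz: "sym_op I J (E \<mu>) \<noteq> 0"
  have "sym_op I J (E (act (sw k) \<mu>)) = Const (gen_sign k + 1 / bar_gap k \<mu>) * sym_op I J (E \<mu>)"
    unfolding E_swap_up[OF \<mu> k lt] sym_op_add sym_op_Const_mult sym_op_pact[OF k]
    by (simp add: Const_add distrib_right)
  moreover have "gen_sign k + 1 / bar_gap k \<mu> \<noteq> 0"
    using bar_gap_gt1[OF k lt] by (auto simp: gen_sign_def field_simps)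
  moreover have "Const c * f \<noteq> 0" if "c \<noteq> 0" "f \<noteq> 0" for c f
  proof
    assume "Const c * f = 0"
    then have "Const (1 / c) * (Const c * f) = 0" by simp
    then show False using that by (simp add: mult.assoc[symmetric] flip: Const_mult)
  qed
  ultimately show "sym_op I J (E (act (sw k) \<mu>)) \<noteq> 0" using nz by metis
qed

lemma jack_S_comb:
  obtains a where "jack_S N \<alpha> I J \<eta> = comb a" "a \<eta> = 1"
    "\<And>k. k \<in> K \<Longrightarrow> pact (sw k) (comb a) = Const (gen_sign k) * comb a"
proof -
  let ?O = "sym_op I J (E \<eta>)"
  obtain a0 where a0: "?O = comb a0"
    using in_span_sym_op[OF \<eta>_orb] by (auto simp: in_span_def)
  \<comment> \<open>Otherwise the whole symmetrization would be zero; so it can be normalized to be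
    monic at \<open>\<eta>\<close>.\<close>
  have nz: "a0 \<eta> \<noteq> 0"
    using comb_symmetric_zero[of a0] pact_sym_op[of _ "E \<eta>"] sym_op_nonzero[OF \<eta>_orb] unfolding a0 by blast
  define a where "a = (\<lambda>\<mu>. 1 / a0 \<eta> * a0 \<mu>)"
  have a: "comb a = Const (1 / a0 \<eta>) * ?O"
    unfolding a0 comb_Const_mult a_def ..
  have a1: "a \<eta> = 1" using nz by (simp add: a_def)
  have sy: "pact (sw k) (comb a) = Const (gen_sign k) * comb a" if "k \<in> K" for k
    unfolding a pact_Const_mult pact_sym_op[OF that] by (rule mult.left_commute)
  have "monic_triangular N \<eta> (comb a)"
    unfolding monic_triangular_def
  proof (intro conjI ballI)
    show "lookup (comb a) \<eta> = 1" by (simp add: lookup_comb_top a1)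
    fix \<nu> assume "\<nu> \<in> keys (comb a)"
    then have "(\<Sum>\<mu>\<in>orb. a \<mu> * lookup (E \<mu>) \<nu>) \<noteq> 0"
      by (simp add: in_keys_iff lookup_comb)
    then obtain \<mu> where \<mu>: "\<mu> \<in> orb" "lookup (E \<mu>) \<nu> \<noteq> 0"
      using sum.neutral by force
    then have "\<nu> = \<mu> \<or> comp_prec N \<nu> \<mu>"
      using nonsym_jack_triangular[OF N1 \<alpha> orb_composition[OF \<mu>(1)]]
      by (auto simp: monic_triangular_def in_keys_iff)
    then show "\<nu> = \<eta> \<or> comp_prec N \<nu> \<eta>"
      using orb_prec[OF \<mu>(1)] comp_prec_trans by metis
  qed
  then have "jack_S N \<alpha> I J \<eta> = comb a"
    unfolding jack_S_def
  proof (intro the_equality)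
    fix S assume "(\<exists>c. S = Const c * ?O) \<and> monic_triangular N \<eta> S"
    then obtain c where c: "S = Const c * ?O" "lookup S \<eta> = 1"
      by (auto simp: monic_triangular_def)
    then have "c * a0 \<eta> = 1"
      by (simp add: a0 lookup_Const_mult lookup_comb_top)
    then have "c = 1 / a0 \<eta>" using nz by (simp add: field_simps)
    then show "S = comb a" using a c by simp
  qed (use a in blast)
  then show ?thesis using that a1 sy by blast
qed

definition root_prod :: "comp \<Rightarrow> real" where
  "root_prod \<mu> = (\<Prod>(j, k)\<in>run_pairs J. eta_bar N \<alpha> \<mu> j - eta_bar N \<alpha> \<mu> k + 1)"

lemma pxi_E:
  assumes \<mu>: "\<mu> \<in> orb" and rs: "set rs \<subseteq> run_pairs J"
  shows "pxi N \<alpha> rs (E \<mu>) = Const (prod_list (map (\<lambda>(j, k). eta_bar N \<alpha> \<mu> j - eta_bar N \<alpha> \<mu> k + 1) rs)) * E \<mu>"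
  using rs
proof (induction rs)
  case (Cons r rs)
  obtain j k where r: "r = (j, k)" by force
  have "j \<in> {1..N}" "k \<in> {1..N}" using run_pairs_bounds[OF J_sub, of j k] Cons r by auto
  then have "cherednik N \<alpha> j (E \<mu>) = Const (eta_bar N \<alpha> \<mu> j) * E \<mu>" "cherednik N \<alpha> k (E \<mu>) = Const (eta_bar N \<alpha> \<mu> k) * E \<mu>"
    using nonsym_jack_eigen[OF N1 \<alpha> orb_composition[OF \<mu>]] by (auto simp: eigen_def)
  with Cons show ?case
    by (simp add: r pxi_Cons cherednik_Const_mult Const_mult Const_add Const_diff) (simp add: algebra_simps)
qed simp

lemma pxi_comb:
  assumes rs: "set rs = run_pairs J" "distinct rs"
  shows "pxi N \<alpha> rs (comb b) = comb (\<lambda>\<mu>. b \<mu> * root_prod \<mu>)"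
proof -
  have sum: "pxi N \<alpha> rs (sum F A) = (\<Sum>a\<in>A. pxi N \<alpha> rs (F a))" for F :: "comp \<Rightarrow> mpol" and A
  proof (induction A rule: infinite_finite_induct)
    case empty
    show ?case using pxi_Const_mult[of N \<alpha> rs 0 0] by simp
  next
    case (infinite A)
    then show ?case using pxi_Const_mult[of N \<alpha> rs 0 0] by simp
  qed (simp add: pxi_add)
  have p: "prod_list (map (\<lambda>(j, k). eta_bar N \<alpha> \<mu> j - eta_bar N \<alpha> \<mu> k + 1) rs) = root_prod \<mu>" for \<mu>
    unfolding root_prod_def rs(1)[symmetric] using rs(2) by (rule prod.distinct_set_conv_list[symmetric])
  show ?thesis
    unfolding comb_def sum pxi_Const_mult
    by (rule sum.cong) (use rs in \<open>auto simp: pxi_E p Const_mult mult.assoc\<close>)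
qed

text \<open>For \<open>k\<close> in \<open>J\<close> only the factor of the root (k, k + 1) differs,
  where the gap changes sign; for \<open>k\<close> in \<open>I\<close> no factor involves k or k +
  1.\<close>

lemma root_prod_swap:
  assumes k: "k \<in> K" and \<mu>: "lookup \<mu> k < lookup \<mu> (Suc k)"
  shows "(if k \<in> J then (1 + bar_gap k \<mu>) * root_prod \<mu> = (1 - bar_gap k \<mu>) * root_prod (act (sw k) \<mu>) else root_prod \<mu> = root_prod (act (sw k) \<mu>))"
proof -
  let ?x = "eta_bar N \<alpha> \<mu>"
  have "eta_bar N \<alpha> (act (sw k) \<mu>) j = ?x (sw k j)" if "j \<in> {1..N}" for j
    using K_bounds[OF k] \<mu> that by (intro eta_bar_swap) auto
  then have p: "root_prod (act (sw k) \<mu>) = (\<Prod>(a, b)\<in>run_pairs J. ?x (sw k a) - ?x (sw k b) + 1)"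
    unfolding root_prod_def by (intro prod.cong) (use run_pairs_bounds[OF J_sub] in \<open>auto dest: run_pairs_bounds[OF J_sub]\<close>)
  show ?thesis
  proof (cases "k \<in> J")
    case True
    define R where "R = (\<Prod>(a, b)\<in>run_pairs J - {(k, Suc k)}. ?x a - ?x b + 1)"
    have "root_prod (act (sw k) \<mu>) = (?x (Suc k) - ?x k + 1) * R"
      unfolding p R_def by (rule prod_run_pairs_swap[OF fin_run_pairs True])
    then have 1: "root_prod (act (sw k) \<mu>) = (1 + bar_gap k \<mu>) * R"
      by (simp add: bar_gap_def algebra_simps)
    have "root_prod \<mu> = (?x k - ?x (Suc k) + 1) * R"
      unfolding root_prod_def R_def using fin_run_pairs run_pairs_simple[OF True] by (subst prod.remove[of _ "(k, Suc k)"]) auto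
    then have 2: "root_prod \<mu> = (1 - bar_gap k \<mu>) * R"
      by (simp add: bar_gap_def algebra_simps)
    show ?thesis using True unfolding 1 2 by simp
  next
    case False
    then have "k - 1 \<notin> J" "Suc k \<notin> J" using adjI k by auto
    then have "root_prod (act (sw k) \<mu>) = root_prod \<mu>"
      unfolding p unfolding root_prod_def
      by (intro prod.cong refl) (use run_pairs_no_swap[OF False] in \<open>auto split: prod.splits\<close>)
    then show ?thesis using False by simp
  qed
qed

text \<open>P applied to \<open>jack_S\<close> is computed twice: through its factor
  \<open>vdm J\<close>, and as a multiple of the full symmetrization of \<open>E lowest\<close>. The
  latter has a known value because each of its |W_K| summands has the same one.\<close>

lemma evaluation:
  assumes rs: "set rs = run_pairs J" "distinct rs"
  shows "jack_S N \<alpha> I J \<eta> = vdm J * jack_U N \<alpha> I J \<eta>"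
    and "real (stab_card I \<eta>) * (ev1 (jack_U N \<alpha> I J \<eta>) * ev1 (pxi N \<alpha> rs (vdm J))) =
      root_prod \<eta> * real (card (W K)) * (eprod N \<alpha> \<eta> / d_comp N \<alpha> (minus_minus I J \<eta>))"
proof -
  obtain a where S: "jack_S N \<alpha> I J \<eta> = comb a" and a1: "a \<eta> = 1"
    and sy: "\<And>k. k \<in> K \<Longrightarrow> pact (sw k) (comb a) = Const (gen_sign k) * comb a"
    using jack_S_comb by metis
  have "pact (sw k) (comb a) = - comb a" if "k \<in> J" for k
    using sy[of k] that by (simp add: gen_sign_def Const_minus)
  then have "vdm J dvd comb a"
    by (rule vdm_dvd[OF fin_run_pairs])
  then obtain U where U: "comb a = vdm J * U" by (rule dvdE)
  have "jack_U N \<alpha> I J \<eta> = U"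
    unfolding jack_U_def vdm_eq_blocks[OF J_sub] S U by (rule exact_quotient_mult[OF vdm_nonzero[OF fin_run_pairs]])
  then show S_eq: "jack_S N \<alpha> I J \<eta> = vdm J * jack_U N \<alpha> I J \<eta>"
    using S U by simp
  let ?T = "comb (\<lambda>\<mu>. a \<mu> * root_prod \<mu>)"
  have T: "pxi N \<alpha> rs (vdm J * jack_U N \<alpha> I J \<eta>) = ?T"
    unfolding S_eq[symmetric] S by (rule pxi_comb[OF rs])
  \<comment> \<open>The recursion factor -(1 + g) / g of antisymmetric coefficients, times the ratio
    (1 - g) / (1 + g) of the scalars of P, equals 1 - 1/g, the factor of symmetric
    coefficients.\<close>
  have T_sym: "pact (sw k) ?T = ?T" if k: "k \<in> K" for k
  proof (rule comb_symmetricI[OF k])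
    fix \<mu> assume \<mu>: "\<mu> \<in> orb" and lt: "lookup \<mu> k < lookup \<mu> (Suc k)"
    have d: "bar_gap k \<mu> > 1" by (rule bar_gap_gt1[OF k lt])
    have a: "a \<mu> = (gen_sign k - 1 / bar_gap k \<mu>) * a (act (sw k) \<mu>)"
      by (rule comb_symmetryD[OF k sy[OF k] \<mu> lt])
    show "a \<mu> * root_prod \<mu> = (1 - 1 / bar_gap k \<mu>) * (a (act (sw k) \<mu>) * root_prod (act (sw k) \<mu>))"
    proof (cases "k \<in> J")
      case True
      have p: "(1 + bar_gap k \<mu>) * root_prod \<mu> = (1 - bar_gap k \<mu>) * root_prod (act (sw k) \<mu>)"
        using root_prod_swap[OF k lt] True by simp
      have "a \<mu> * root_prod \<mu> = - (a (act (sw k) \<mu>) * ((1 + bar_gap k \<mu>) * root_prod \<mu>)) / bar_gap k \<mu>"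
        unfolding a using True d by (simp add: gen_sign_def field_simps)
      also have "\<dots> = (1 - 1 / bar_gap k \<mu>) * (a (act (sw k) \<mu>) * root_prod (act (sw k) \<mu>))"
        unfolding p using d by (simp add: field_simps)
      finally show ?thesis .
    next
      case False
      then have "root_prod \<mu> = root_prod (act (sw k) \<mu>)" using root_prod_swap[OF k lt] by simp
      then show ?thesis unfolding a using False by (simp add: gen_sign_def)
    qed
  qed
  let ?M = "real (stab_card I \<eta>)"
  define G where "G = (\<Sum>w\<in>W K. pact w (E lowest))"
  have "in_span G"
    unfolding G_def by (intro in_span_sum in_span_pact in_span_E lowest_orb)
  then obtain g where g: "G = comb g" by (auto simp: in_span_def)
  have G_sym: "pact (sw k) G = G" if k: "k \<in> K" for k
  proof -
    have "pact (sw k) G = (\<Sum>w\<in>W K. pact (sw k \<circ> w) (E lowest))"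
      unfolding G_def pact_sum by (rule sum.cong) (auto simp: pact_comp W_bij)
    also have "\<dots> = G"
      unfolding G_def by (rule sum.reindex_bij_betw[OF bij_W_left[OF W_generator[OF k]]])
    finally show ?thesis .
  qed
  have g1: "g \<eta> = ?M"
  proof -
    obtain w0 where "\<And>c. lookup (\<Sum>w\<in>W K. Const (c w) * pact w (E lowest)) \<eta> =
      (\<Sum>\<sigma>\<in>{\<sigma>\<in>W I. act \<sigma> \<eta> = \<eta>}. c (\<sigma> \<circ> w0))"
      using lookup_sum_low by blast
    from this[of "\<lambda>_. 1"] have "lookup G \<eta> = ?M"
      by (simp add: G_def stab_card_def)
    then show ?thesis by (simp add: g lookup_comb_top)
  qed
  \<comment> \<open>At \<open>E \<eta>\<close> the two symmetric combinations have coefficients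
    \<open>root_prod \<eta>\<close> and the stabilizer order; cross-multiplication makes the
    difference vanish there, hence everywhere.\<close>
  let ?c = "\<lambda>\<mu>. ?M * (a \<mu> * root_prod \<mu>) - root_prod \<eta> * g \<mu>"
  have c: "comb ?c = Const ?M * ?T - Const (root_prod \<eta>) * G"
    unfolding g comb_Const_mult comb_diff ..
  have "comb ?c = 0"
  proof (rule comb_symmetric_zero)
    fix k assume k: "k \<in> K"
    have "pact (sw k) (comb ?c) = Const 1 * comb ?c"
      unfolding c pact_diff pact_Const_mult T_sym[OF k] G_sym[OF k] by simp
    then show "\<exists>x. pact (sw k) (comb ?c) = Const x * comb ?c" by blast
  qed (simp add: a1 g1)
  then have "ev1 (Const ?M * ?T - Const (root_prod \<eta>) * G) = 0"
    unfolding c[symmetric] by simp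
  then have "?M * ev1 ?T = root_prod \<eta> * ev1 G"
    unfolding ev1_diff ev1_Const_mult by simp
  also have "ev1 G = real (card (W K)) * ev1 (E lowest)"
    by (simp add: G_def ev1_sum ev1_pact)
  also have "ev1 (E lowest) = eprod N \<alpha> lowest / d_comp N \<alpha> lowest"
    by (rule ev1_nonsym_jack[OF N1 \<alpha> orb_composition[OF lowest_orb]])
  also have "eprod N \<alpha> lowest = eprod N \<alpha> \<eta>"
  proof -
    obtain w where w: "w \<in> W K" "lowest = act w \<eta>"
      using lowest_orb by (auto simp: orb_def)
    then have "sort_comp N lowest = sort_comp N \<eta>"
      using sort_comp_act[OF W_bij W_image[OF K_sub]] by simp
    then show ?thesis by (metis eprod_sort)
  qed
  finally have "?M * ev1 ?T = root_prod \<eta> * (real (card (W K)) * (eprod N \<alpha> \<eta> / d_comp N \<alpha> (minus_minus I J \<eta>)))"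
    by (simp add: minus_minus_eq)
  moreover have "ev1 ?T = ev1 (jack_U N \<alpha> I J \<eta>) * ev1 (pxi N \<alpha> rs (vdm J))"
    unfolding T[symmetric] using distinct_card[OF rs(2)] rs(1) by (intro ev1_pxi_vdm fin_run_pairs) simp
  ultimately show "?M * (ev1 (jack_U N \<alpha> I J \<eta>) * ev1 (pxi N \<alpha> rs (vdm J))) =
      root_prod \<eta> * real (card (W K)) * (eprod N \<alpha> \<eta> / d_comp N \<alpha> (minus_minus I J \<eta>))"
    by simp
qed

end

section \<open>The composition delta\<close>

text \<open>The entry at \<open>j\<close> is the number of later positions in the same run, so the
  boxes of the diagram correspond to positive roots, row by row.\<close>

lemma lookup_delta:
  assumes J: "J \<subseteq> {1..N - 1}"
  shows "lookup (delta J) j = card {k. (j, k) \<in> run_pairs J}"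
proof -
  have fin: "finite J" and 0: "0 \<notin> J" using J finite_subset by auto
  have ft: "finite (tilde X)" if "X \<in> blocks J" for X
    using that blocks_iff[OF 0 fin, of X] by (auto simp: tilde_def)
  have l: "lookup (delta J) j = (\<Sum>X\<in>blocks J. if j \<in> tilde X then Max (tilde X) - j else 0)"
    unfolding delta_def lookup_sum
  proof (rule sum.cong)
    fix X assume X: "X \<in> blocks J"
    have "(\<Sum>i\<in>tilde X. lookup (single i (Max (tilde X) - i)) j) = (\<Sum>i\<in>tilde X. if i = j then Max (tilde X) - i else 0)"
      by (rule sum.cong) (auto simp: lookup_single when_def)
    then show "(\<Sum>i\<in>tilde X. lookup (single i (Max (tilde X) - i)) j) = (if j \<in> tilde X then Max (tilde X) - j else 0)"
      using ft[OF X] by simp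
  qed simp
  have mx: "Max (tilde {a..b}) = Suc b" if "a \<le> b" for a b :: nat
    using that by (intro Max_eqI) (auto simp: tilde_interval)
  show ?thesis
  proof (cases "j \<in> J")
    case True
    then obtain a b where ab: "{a..b} \<in> blocks J" "a \<le> j" "Suc j \<le> Suc b" "a \<le> b"
      using block_exists[OF 0 fin, of j "Suc j"] by auto
    obtain a' b' where ab': "a' \<le> b'" "{a..b} = {a'..b'}" "{a'..b'} \<subseteq> J" "Suc b' \<notin> J"
      using ab(1) blocks_iff[OF 0 fin] by metis
    have e: "a' = a" "b' = b" using ab' ab(4) by (auto simp: Icc_eq_Icc)
    have "j \<in> tilde {a..b}" using ab by (simp add: tilde_interval)
    then have u: "X = {a..b}" if "X \<in> blocks J" "j \<in> tilde X" for X
      using tilde_disjoint[OF 0 fin that(1) ab(1)] that(2) by blast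
    have "lookup (delta J) j = (\<Sum>X\<in>blocks J. if X = {a..b} then Suc b - j else 0)"
      unfolding l
    proof (rule sum.cong)
      fix X assume "X \<in> blocks J"
      then have "j \<in> tilde X \<longleftrightarrow> X = {a..b}"
        using u \<open>j \<in> tilde {a..b}\<close> by blast
      then show "(if j \<in> tilde X then Max (tilde X) - j else 0) = (if X = {a..b} then Suc b - j else 0)"
        using mx[OF ab(4)] by simp
    qed simp
    also have "\<dots> = Suc b - j"
      using finite_blocks[OF fin] ab(1) by simp
    also have "{k. (j, k) \<in> run_pairs J} = {Suc j..Suc b}"
    proof (intro set_eqI iffI)
      fix k assume "k \<in> {k. (j, k) \<in> run_pairs J}"
      then have k: "j < k" "{j..<k} \<subseteq> J" by (auto simp: run_pairs_def)
      have "k \<le> Suc b"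
      proof (rule ccontr)
        assume "\<not> k \<le> Suc b"
        then have "Suc b \<in> {j..<k}" using ab by auto
        then have "Suc b \<in> J" using k(2) by blast
        then show False using ab'(4) e by simp
      qed
      then show "k \<in> {Suc j..Suc b}" using k by auto
    next
      fix k assume k: "k \<in> {Suc j..Suc b}"
      then have "{j..<k} \<subseteq> {a..b}" using ab by auto
      also have "{a..b} \<subseteq> J" using ab'(3) e by simp
      finally show "k \<in> {k. (j, k) \<in> run_pairs J}" using k by (simp add: run_pairs_def)
    qed
    then have "Suc b - j = card {k. (j, k) \<in> run_pairs J}" by simp
    finally show ?thesis .
  next
    case False
    have "Max (tilde X) - j = 0" if X: "X \<in> blocks J" "j \<in> tilde X" for X
    proof -
      obtain a b where "a \<le> b" "X = {a..b}" "{a..b} \<subseteq> J"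
        using iffD1[OF blocks_iff[OF 0 fin] X(1)] by blast
      moreover have "j \<in> {a..Suc b}" using calculation X(2) by (simp add: tilde_interval)
      moreover have "j \<notin> {a..b}" using calculation(3) False by blast
      moreover have "j = Suc b" using calculation(4,5) by auto
      ultimately show ?thesis by (simp add: mx)
    qed
    then have "lookup (delta J) j = 0" unfolding l by (intro sum.neutral) auto
    moreover have "{k. (j, k) \<in> run_pairs J} = {}"
      using False by (auto simp: run_pairs_def subset_iff)
    ultimately show ?thesis by (simp only: card.empty)
  qed
qed

lemma finite_run_pairs_row: "J \<subseteq> {1..N - 1} \<Longrightarrow> finite {k. (j, k) \<in> run_pairs J}"
  by (rule finite_subset[OF _ finite_imageI[OF finite_run_pairs, of J N snd]]) (auto intro: image_eqI[of _ snd "(j, _)"])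

lemma delta_step:
  assumes J: "J \<subseteq> {1..N - 1}" and j: "j \<in> J"
  shows "lookup (delta J) j = Suc (lookup (delta J) (Suc j))"
proof -
  have "(j, k) \<in> run_pairs J \<longleftrightarrow> k = Suc j \<or> (Suc j, k) \<in> run_pairs J" for k
  proof
    assume "(j, k) \<in> run_pairs J"
    then show "k = Suc j \<or> (Suc j, k) \<in> run_pairs J" by (auto simp: run_pairs_def subset_iff)
  next
    assume "k = Suc j \<or> (Suc j, k) \<in> run_pairs J"
    then show "(j, k) \<in> run_pairs J"
    proof
      assume "(Suc j, k) \<in> run_pairs J"
      then have k: "Suc j < k" "{Suc j..<k} \<subseteq> J" by (auto simp: run_pairs_def)
      have "{j..<k} = insert j {Suc j..<k}" using k by auto
      then show ?thesis using k j by (auto simp: run_pairs_def)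
    qed (use run_pairs_simple[OF j] in simp)
  qed
  then have "{k. (j, k) \<in> run_pairs J} = insert (Suc j) {k. (Suc j, k) \<in> run_pairs J}" by blast
  moreover have "finite {k. (Suc j, k) \<in> run_pairs J}"
    by (rule finite_run_pairs_row[OF J])
  moreover have "(Suc j, Suc j) \<notin> run_pairs J" by (auto simp: run_pairs_def)
  ultimately show ?thesis
    unfolding lookup_delta[OF J] by simp
qed

lemma composition_delta:
  assumes J: "J \<subseteq> {1..N - 1}" shows "composition N (delta J)"
  unfolding composition_def
proof
  fix j assume "j \<in> keys (delta J)"
  then have "card {k. (j, k) \<in> run_pairs J} \<noteq> 0" by (simp add: in_keys_iff lookup_delta[OF J])
  then obtain k where "(j, k) \<in> run_pairs J" by (metis Collect_empty_eq card.empty)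
  then show "j \<in> {1..N}" using run_pairs_bounds[OF J, of j k] by auto
qed

lemma run_pairs_Sigma:
  assumes J: "J \<subseteq> {1..N - 1}" shows "run_pairs J = (SIGMA j:{1..N}. {k. (j, k) \<in> run_pairs J})"
proof (rule set_eqI)
  fix p :: "nat \<times> nat"
  obtain j k where p: "p = (j, k)" by force
  show "p \<in> run_pairs J \<longleftrightarrow> p \<in> (SIGMA j:{1..N}. {k. (j, k) \<in> run_pairs J})"
    unfolding p using run_pairs_bounds[OF J, of j k] by auto
qed

lemma weight_delta: 
  assumes J: "J \<subseteq> {1..N - 1}" shows "weight N (delta J) = card (run_pairs J)"
proof -
  have "card (run_pairs J) = card (SIGMA j:{1..N}. {k. (j, k) \<in> run_pairs J})"
    using run_pairs_Sigma[OF J] by (rule arg_cong)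
  then show ?thesis
    using finite_run_pairs_row[OF J] by (simp add: weight_def lookup_delta[OF J])
qed

lemma delta_run:
  assumes J: "J \<subseteq> {1..N - 1}" shows "(j, k) \<in> run_pairs J \<Longrightarrow> lookup (delta J) j = lookup (delta J) k + (k - j)"
proof -
  assume "(j, k) \<in> run_pairs J"
  then have "j \<le> k" "{j..<k} \<subseteq> J" by (auto simp: run_pairs_def)
  then show ?thesis
  proof (induction k rule: dec_induct)
    case (step n)
    have "{j..<n} \<subseteq> {j..<Suc n}" by auto
    then have "lookup (delta J) j = lookup (delta J) n + (n - j)" using step by blast
    moreover have "n \<in> J" using step by (simp add: subset_iff)
    ultimately show ?case using delta_step[OF J] step by simp
  qed simp
qed

text \<open>The root (j, k) corresponds to the box in row j and column \<delta>_k + 1, whose hook is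
  the difference of eigenvalues; along a run the entries drop by one each time, so every box of the
  row is hit once.\<close>

lemma d_comp_delta:
  assumes J: "J \<subseteq> {1..N - 1}"
  shows "d_comp N \<alpha> (delta J) = (\<Prod>(j, k)\<in>run_pairs J. eta_bar N \<alpha> (delta J) j - eta_bar N \<alpha> (delta J) k)"
proof -
  let ?d = "delta J"
  have row: "(\<Prod>m=1..lookup ?d j. hook N \<alpha> ?d j m) =
      (\<Prod>k\<in>{k. (j, k) \<in> run_pairs J}. eta_bar N \<alpha> ?d j - eta_bar N \<alpha> ?d k)" for j
  proof -
    let ?R = "{k. (j, k) \<in> run_pairs J}" and ?f = "\<lambda>k. Suc (lookup ?d k)"
    have inj: "inj_on ?f ?R"
    proof (rule inj_onI)
      fix x y assume "x \<in> ?R" "y \<in> ?R" "?f x = ?f y"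
      then show "x = y" using delta_run[OF J, of j x] delta_run[OF J, of j y] by (auto simp: run_pairs_def)
    qed
    have "?f ` ?R \<subseteq> {1..lookup ?d j}"
    proof (rule image_subsetI)
      fix k assume "k \<in> ?R"
      then have "j < k" "lookup ?d j = lookup ?d k + (k - j)" using delta_run[OF J] by (auto simp: run_pairs_def)
      then show "?f k \<in> {1..lookup ?d j}" by auto
    qed
    then have "?f ` ?R = {1..lookup ?d j}"
      using card_image[OF inj] lookup_delta[OF J, of j] by (intro card_subset_eq) simp_all
    then have "(\<Prod>m=1..lookup ?d j. hook N \<alpha> ?d j m) = (\<Prod>k\<in>?R. hook N \<alpha> ?d j (?f k))"
      using prod.reindex[OF inj, of "hook N \<alpha> ?d j"] by simp
    also have "\<dots> = (\<Prod>k\<in>?R. eta_bar N \<alpha> ?d j - eta_bar N \<alpha> ?d k)"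
    proof (rule prod.cong)
      fix k assume "k \<in> ?R"
      then have jk: "(j, k) \<in> run_pairs J" by simp
      have r: "lookup ?d j = lookup ?d k + (k - j)" by (rule delta_run[OF J jk])
      have b: "1 \<le> j" "j < k" "k \<le> N" using run_pairs_bounds[OF J jk] by auto
      have "lookup ?d l \<noteq> lookup ?d k" if "j < l" "l < k" for l
      proof -
        have "{l..<k} \<subseteq> J" using jk that by (auto simp: run_pairs_def subset_iff)
        then have "lookup ?d l = lookup ?d k + (k - l)"
          using that by (intro delta_run[OF J]) (simp add: run_pairs_def)
        then show ?thesis using that by simp
      qed
      then show "hook N \<alpha> ?d j (?f k) = eta_bar N \<alpha> ?d j - eta_bar N \<alpha> ?d k"
        using r b by (intro eta_bar_diff[symmetric]) auto
    qed simp
    finally show ?thesis .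
  qed
  have "d_comp N \<alpha> ?d = (\<Prod>j=1..N. \<Prod>k\<in>{k. (j, k) \<in> run_pairs J}. eta_bar N \<alpha> ?d j - eta_bar N \<alpha> ?d k)"
    unfolding d_comp_hook row ..
  also have "\<dots> = (\<Prod>(j, k)\<in>(SIGMA j:{1..N}. {k. (j, k) \<in> run_pairs J}). eta_bar N \<alpha> ?d j - eta_bar N \<alpha> ?d k)"
    using finite_run_pairs_row[OF J] by (intro prod.Sigma) auto
  finally show ?thesis
    using run_pairs_Sigma[OF J] by simp
qed

text \<open>Used with two weightings: N - i singles out the leading monomial of a Vandermonde
  product, and the constant 1 gives total degree.\<close>

definition grade :: "(nat \<Rightarrow> nat) \<Rightarrow> comp \<Rightarrow> nat" where
  "grade g \<kappa> = (\<Sum>i\<in>keys \<kappa>. lookup \<kappa> i * g i)"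

lemma grade_add: "grade g (\<kappa> + \<nu>) = grade g \<kappa> + grade g \<nu>"
  unfolding grade_def by (rule setsum_keys_plus_distrib) (auto simp: algebra_simps)

lemma grade_single: "grade g (single i 1) = g i"
  by (simp add: grade_def)

lemma keys_mult_obtain:
  assumes "\<kappa> \<in> keys (f * g :: mpol)"
  obtains a b where "a \<in> keys f" "b \<in> keys g" "\<kappa> = a + b"
  using subsetD[OF keys_mult assms] by blast

text \<open>\<open>f\<close> is z^c plus terms of strictly smaller grade; the coefficient 1 of the
  leading monomial is built in, so the notion is multiplicative.\<close>

definition lead :: "(nat \<Rightarrow> nat) \<Rightarrow> comp \<Rightarrow> mpol \<Rightarrow> bool" where
  "lead g c f \<longleftrightarrow> (\<forall>\<kappa>\<in>keys (f - monom c). grade g \<kappa> < grade g c)"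

lemma keys_diff: "keys (f - g :: mpol) \<subseteq> keys f \<union> keys g"
  by (auto simp: in_keys_iff lookup_minus)

lemma keys_add_cases: "\<kappa> \<in> keys (f + g :: mpol) \<Longrightarrow> \<kappa> \<in> keys f \<or> \<kappa> \<in> keys g"
  using subsetD[OF keys_add] by (metis Un_iff)

lemma lead_mult:
  assumes f: "lead g c f" and h: "lead g d h"
  shows "lead g (c + d) (f * h)"
  unfolding lead_def
proof
  fix \<kappa> assume \<kappa>: "\<kappa> \<in> keys (f * h - monom (c + d))"
  have "f * h - monom (c + d) = monom c * (h - monom d) + (f - monom c) * h"
    by (simp add: monom_add algebra_simps)
  then consider "\<kappa> \<in> keys (monom c * (h - monom d))" | "\<kappa> \<in> keys ((f - monom c) * h)"
    using \<kappa> keys_add_cases by auto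
  then show "grade g \<kappa> < grade g (c + d)"
  proof cases
    case 1
    then show ?thesis
      using h by (elim keys_mult_obtain) (auto simp: lead_def grade_add)
  next
    case 2
    then obtain a b where ab: "a \<in> keys (f - monom c)" "b \<in> keys h" "\<kappa> = a + b"
      by (rule keys_mult_obtain)
    have "h = (h - monom d) + monom d" by simp
    then have "b \<in> keys (h - monom d) \<or> b \<in> keys (monom d)"
      using ab(2) keys_add_cases by metis
    then have "grade g b \<le> grade g d" using h by (auto simp: lead_def less_imp_le)
    moreover have "grade g a < grade g c" using f ab by (auto simp: lead_def)
    ultimately show ?thesis by (simp add: ab grade_add)
  qed
qed

lemma lead_prod:
  assumes "finite S" "\<And>a b. (a, b) \<in> S \<Longrightarrow> g b < g a"
  shows "lead g (\<Sum>(a, b)\<in>S. single a 1) (\<Prod>(a, b)\<in>S. Z a - Z b)"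
  using assms
proof (induction S)
  case empty
  show ?case by (simp add: lead_def)
next
  case (insert p S)
  obtain a b where p: "p = (a, b)" by force
  have "lead g (single a 1) (Z a - Z b)"
    using insert(4)[of a b] by (simp add: lead_def Z_def grade_single p del: One_nat_def)
  then have "lead g (single a 1 + (\<Sum>(a, b)\<in>S. single a 1)) ((Z a - Z b) * (\<Prod>(a, b)\<in>S. Z a - Z b))"
    using insert by (intro lead_mult) auto
  then show ?case using insert(1,2) p by simp
qed

text \<open>With weight N - i the leading term of z_a - z_b is z_a for a < b \<le> N. The product of
  these terms has at \<open>j\<close> the number of roots starting there, which is
  \<delta>_j.\<close>

lemma lookup_vdm_delta:
  assumes J: "J \<subseteq> {1..N - 1}"
  shows "lookup (vdm J) (delta J) = 1"
proof -
  have "(\<Sum>(a, b)\<in>run_pairs J. single a 1) = delta J"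
  proof (rule poly_mapping_eqI)
    fix j
    have "lookup (\<Sum>(a, b)\<in>run_pairs J. single a 1) j = (\<Sum>p\<in>run_pairs J. if fst p = j then 1 else 0)"
      unfolding lookup_sum by (rule sum.cong) (auto simp: lookup_single when_def)
    also have "\<dots> = card {p\<in>run_pairs J. fst p = j}"
      using finite_run_pairs[OF J] by (simp add: sum.If_cases Int_def)
    also have "\<dots> = card {k. (j, k) \<in> run_pairs J}"
      by (rule bij_betw_same_card[of snd], rule bij_betw_byWitness[where f' = "Pair j"]) auto
    finally show "lookup (\<Sum>(a, b)\<in>run_pairs J. single a 1) j = lookup (delta J) j"
      by (simp add: lookup_delta[OF J])
  qed
  then have "lead (\<lambda>i. N - i) (delta J) (vdm J)"
    unfolding vdm_def using lead_prod[OF finite_run_pairs[OF J], of "\<lambda>i. N - i"] run_pairs_bounds[OF J]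
    by (metis (no_types, lifting) diff_less_mono2 less_le_trans)
  then have "delta J \<notin> keys (vdm J - monom (delta J))"
    by (auto simp: lead_def)
  then show ?thesis
    by (simp add: in_keys_iff lookup_minus lookup_monom)
qed

lemma grade_vdm:
  assumes "finite S" "\<kappa> \<in> keys (\<Prod>(a, b)\<in>S. Z a - Z b)"
  shows "grade (\<lambda>_. 1) \<kappa> = card S"
  using assms
proof (induction S arbitrary: \<kappa>)
  case empty
  then show ?case by (simp add: grade_def)
next
  case (insert p S)
  obtain a b where p: "p = (a, b)" by force
  have "\<kappa> \<in> keys ((Z a - Z b) * (\<Prod>(a, b)\<in>S. Z a - Z b))" using insert p by simp
  then obtain c d where cd: "c \<in> keys (Z a - Z b)" "d \<in> keys (\<Prod>(a, b)\<in>S. Z a - Z b)" "\<kappa> = c + d"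
    by (rule keys_mult_obtain)
  have "c = single a 1 \<or> c = single b 1"
    using subsetD[OF keys_diff cd(1)] by (auto simp: Z_def)
  then have "grade (\<lambda>_. 1) c = 1" using grade_single by metis
  then show ?case using insert cd by (simp add: grade_add)
qed

lemma grade_composition: "composition N \<kappa> \<Longrightarrow> grade (\<lambda>_. 1) \<kappa> = weight N \<kappa>"
  unfolding grade_def weight_def composition_def
  by (simp, rule sum.mono_neutral_left) (auto simp: in_keys_iff)

context prescribed
begin

lemma eta_bar_root_pos:
  assumes ab: "(a, b) \<in> run_pairs J"
  shows "eta_bar N \<alpha> \<eta> b < eta_bar N \<alpha> \<eta> a"
proof (rule eta_bar_less[OF \<alpha>])
  have r: "a < b" "{a..<b} \<subseteq> J" using ab by (auto simp: run_pairs_def)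
  show "a \<in> {1..N}" "b \<in> {1..N}" using run_pairs_bounds[OF J_sub ab] by auto
  have "int (lookup \<eta> b) \<le> int (lookup \<eta> a)"
    by (rule antimono_run[where K = K and h = "\<lambda>i. int (lookup \<eta> i)"]) (use domK r in auto)
  then show "before \<eta> a b" using r(1) by (auto simp: before_def)
qed

text \<open>The product of \<open>d_comp\<close> with the factors 1 + 1/x over roots of positive
  difference x is constant on the orbit: a swap turns one negative root positive and shrinks one
  hook accordingly. At the lowest element no root is positive, at \<open>\<eta>\<close> all
  are.\<close>

lemma d_comp_low:
  assumes "I = {}"
  shows "d_comp N \<alpha> lowest = d_comp N \<alpha> \<eta> * (\<Prod>(a, b)\<in>run_pairs J. 1 + 1 / (eta_bar N \<alpha> \<eta> a - eta_bar N \<alpha> \<eta> b))"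
proof -
  \<comment> \<open>Value 1 on nonpositive differences, so that only roots already in decreasing
    order contribute.\<close>
  define G :: "real \<Rightarrow> real" where "G x = (if x > 0 then 1 + 1 / x else 1)" for x
  define F where "F \<mu> = (\<Prod>(a, b)\<in>run_pairs J. G (eta_bar N \<alpha> \<mu> a - eta_bar N \<alpha> \<mu> b))" for \<mu>
  have bd: "a \<in> {1..N}" "b \<in> {1..N}" "a < b" "{a..<b} \<subseteq> J" if "(a, b) \<in> run_pairs J" for a b
    using run_pairs_bounds[OF J_sub that] that by (auto simp: run_pairs_def)
  have "d_comp N \<alpha> \<mu> * F \<mu> = d_comp N \<alpha> lowest" if "\<mu> \<in> orb" for \<mu>
  proof (rule orb_down_induct[OF that, of "\<lambda>\<mu>. d_comp N \<alpha> \<mu> * F \<mu> = d_comp N \<alpha> lowest"])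
    have "F lowest = 1"
      unfolding F_def
    proof (rule prod.neutral, clarify)
      fix a b assume ab: "(a, b) \<in> run_pairs J"
      have "- int (lookup lowest b) \<le> - int (lookup lowest a)"
        by (rule antimono_run[where K = J and h = "\<lambda>i. - int (lookup lowest i)"])
           (use lowest_mono bd[OF ab] in auto)
      moreover have "lookup lowest a \<noteq> lookup lowest b"
        by (rule orb_regular[OF lowest_orb]) (use bd[OF ab] in auto)
      ultimately have "before lowest b a" by (simp add: before_def)
      then have "eta_bar N \<alpha> lowest a < eta_bar N \<alpha> lowest b"
        by (rule eta_bar_less[OF \<alpha> bd(1)[OF ab] bd(2)[OF ab]])
      then show "G (eta_bar N \<alpha> lowest a - eta_bar N \<alpha> lowest b) = 1"
        by (simp add: G_def)
    qed
    then show "d_comp N \<alpha> lowest * F lowest = d_comp N \<alpha> lowest" by simp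
  next
    fix \<mu> k assume \<mu>: "\<mu> \<in> orb" and k: "k \<in> K" and lt: "lookup \<mu> k < lookup \<mu> (Suc k)"
      and IH: "d_comp N \<alpha> \<mu> * F \<mu> = d_comp N \<alpha> lowest"
    let ?\<nu> = "act (sw k) \<mu>" and ?x = "eta_bar N \<alpha> \<mu>"
    have kJ: "k \<in> J" using k assms by simp
    have d: "bar_gap k \<mu> > 1" by (rule bar_gap_gt1[OF k lt])
    have lt': "lookup ?\<nu> (Suc k) < lookup ?\<nu> k" using lt by (simp add: lookup_swap)
    have \<delta>: "bar_gap k \<mu> = eta_bar N \<alpha> ?\<nu> k - eta_bar N \<alpha> ?\<nu> (Suc k)"
      using bar_gap_swap[OF k, of \<mu>] lt unfolding bar_gap_def by simp
    have dc: "d_comp N \<alpha> \<mu> = d_comp N \<alpha> ?\<nu> * ((bar_gap k \<mu> + 1) / bar_gap k \<mu>)"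
      using d_comp_swap(1)[OF \<alpha> K_bounds(1)[OF k] K_bounds(2)[OF k] lt' \<delta>] by simp
    define R where "R = (\<Prod>(a, b)\<in>run_pairs J - {(k, Suc k)}. G (?x a - ?x b))"
    have "eta_bar N \<alpha> ?\<nu> j = ?x (sw k j)" if "j \<in> {1..N}" for j
      using K_bounds[OF k] lt that by (intro eta_bar_swap) auto
    then have "F ?\<nu> = (\<Prod>(a, b)\<in>run_pairs J. G (?x (sw k a) - ?x (sw k b)))"
      unfolding F_def by (intro prod.cong) (auto dest: run_pairs_bounds[OF J_sub])
    also have "\<dots> = G (?x (Suc k) - ?x k) * R"
      unfolding R_def by (rule prod_run_pairs_swap[OF fin_run_pairs kJ])
    finally have 1: "F ?\<nu> = ((bar_gap k \<mu> + 1) / bar_gap k \<mu>) * R"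
      using d by (simp add: G_def bar_gap_def field_simps)
    have "F \<mu> = G (?x k - ?x (Suc k)) * R"
      unfolding F_def R_def using fin_run_pairs run_pairs_simple[OF kJ] by (subst prod.remove[of _ "(k, Suc k)"]) auto
    then have 2: "F \<mu> = R"
      using d by (simp add: G_def bar_gap_def)
    show "d_comp N \<alpha> ?\<nu> * F ?\<nu> = d_comp N \<alpha> lowest"
      using IH unfolding 1 2 dc by simp
  qed
  from this[OF \<eta>_orb] have "d_comp N \<alpha> lowest = d_comp N \<alpha> \<eta> * F \<eta>" by simp
  also have "F \<eta> = (\<Prod>(a, b)\<in>run_pairs J. 1 + 1 / (eta_bar N \<alpha> \<eta> a - eta_bar N \<alpha> \<eta> b))"
    unfolding F_def
  proof (rule prod.cong, simp, clarify)
    fix a b assume ab: "(a, b) \<in> run_pairs J"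
    have "eta_bar N \<alpha> \<eta> b < eta_bar N \<alpha> \<eta> a"
      by (rule eta_bar_root_pos[OF ab])
    then show "G (eta_bar N \<alpha> \<eta> a - eta_bar N \<alpha> \<eta> b) = 1 + 1 / (eta_bar N \<alpha> \<eta> a - eta_bar N \<alpha> \<eta> b)"
      by (simp add: G_def)
  qed
  finally show ?thesis .
qed

end

lemma grade_pos: "\<kappa> \<noteq> 0 \<Longrightarrow> grade (\<lambda>_. 1) \<kappa> > 0"
proof -
  assume "\<kappa> \<noteq> 0"
  then obtain i where "i \<in> keys \<kappa>" by (meson keys_eq_empty ex_in_conv)
  then show ?thesis
    unfolding grade_def by (intro sum_pos2[of _ i]) (auto simp: in_keys_iff)
qed

lemma W_empty: "W {} = {id}"
  unfolding W_def by auto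

lemma prescribed_delta:
  assumes "1 \<le> N" "\<alpha> > 0" and J: "J \<subseteq> {1..N - 1}"
  shows "prescribed N \<alpha> {} J (delta J)"
  using assms delta_step[OF J] composition_delta[OF J] by unfold_locales auto

text \<open>By degree, \<open>U\<close> is constant for \<open>\<eta>\<^sup>* = \<delta>\<close>; comparing the coefficients of \<open>z\<^sup>\<delta>\<close> gives the constant.\<close>

lemma ev1_jack_U_delta:
  assumes "1 \<le> N" "\<alpha> > 0" and J: "J \<subseteq> {1..N - 1}"
  shows "ev1 (jack_U N \<alpha> {} J (delta J)) = 1"
proof -
  interpret D: prescribed N \<alpha> "{}" J "delta J"
    by (rule prescribed_delta[OF assms])
  let ?S = "jack_S N \<alpha> {} J (delta J)" and ?U = "jack_U N \<alpha> {} J (delta J)"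
  obtain rs where rs: "set rs = run_pairs J" "distinct rs"
    using finite_distinct_list[OF finite_run_pairs[OF J]] by blast
  have SU: "?S = vdm J * ?U" by (rule D.evaluation(1)[OF rs])
  obtain a where S: "?S = D.comb a" "a (delta J) = 1" using D.jack_S_comb by metis
  have S1: "lookup ?S (delta J) = 1"
    unfolding S(1) D.lookup_comb_top by (rule S(2))
  have hS: "grade (\<lambda>_. 1) \<kappa> = card (run_pairs J)" if "\<kappa> \<in> keys ?S" for \<kappa>
  proof -
    have "(\<Sum>\<mu>\<in>D.orb. a \<mu> * lookup (D.E \<mu>) \<kappa>) \<noteq> 0"
      using that by (simp add: S(1) in_keys_iff D.lookup_comb)
    then obtain \<mu> where \<mu>: "\<mu> \<in> D.orb" "lookup (D.E \<mu>) \<kappa> \<noteq> 0"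
      using sum.neutral by force
    then have "\<kappa> = \<mu> \<or> comp_prec N \<kappa> \<mu>"
      using nonsym_jack_triangular[OF D.N1 D.\<alpha> D.orb_composition[OF \<mu>(1)]]
      by (auto simp: monic_triangular_def in_keys_iff)
    then have "composition N \<kappa>" "weight N \<kappa> = weight N \<mu>"
      using D.orb_composition[OF \<mu>(1)] by (auto simp: comp_prec_def)
    moreover have "weight N \<mu> = weight N (delta J)"
      using D.orb_prec[OF \<mu>(1)] by (auto simp: comp_prec_def)
    ultimately show ?thesis
      using grade_composition[of N \<kappa>] weight_delta[OF J] by simp
  qed
  define c where "c = lookup ?U 0"
  define V where "V = ?U - Const c"
  have V0: "lookup V 0 = 0" by (simp add: V_def c_def lookup_minus Const_def)
  have "vdm J * V = ?S - Const c * vdm J"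
    by (simp add: SU V_def algebra_simps)
  have "keys (vdm J * V) = {}"
  proof (rule ccontr)
    assume "keys (vdm J * V) \<noteq> {}"
    then obtain \<kappa> where \<kappa>: "\<kappa> \<in> keys (vdm J * V)" by blast
    then have "\<kappa> \<in> keys ?S \<or> \<kappa> \<in> keys (Const c * vdm J)"
      unfolding \<open>vdm J * V = ?S - Const c * vdm J\<close> using subsetD[OF keys_diff] by (metis Un_iff)
    moreover have hv: "grade (\<lambda>_. 1) \<nu> = card (run_pairs J)" if "\<nu> \<in> keys (vdm J)" for \<nu>
      using grade_vdm[OF finite_run_pairs[OF J]] that by (simp add: vdm_def)
    ultimately have "grade (\<lambda>_. 1) \<kappa> = card (run_pairs J)"
      using hS subsetD[OF keys_Const_mult] by metis
    moreover obtain x y where xy: "x \<in> keys (vdm J)" "y \<in> keys V" "\<kappa> = x + y"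
      by (rule keys_mult_obtain[OF \<kappa>])
    moreover have "y \<noteq> 0" using xy(2) V0 by (auto simp: in_keys_iff)
    ultimately show False
      using hv[OF xy(1)] grade_pos[of y] by (simp add: grade_add)
  qed
  then have "V = 0"
    using vdm_nonzero[OF finite_run_pairs[OF J]] by simp
  then have U: "?U = Const c" by (simp add: V_def)
  then have "?S = Const c * vdm J" unfolding SU by (simp add: mult.commute)
  then have "c = 1"
    using S1 by (simp add: lookup_Const_mult lookup_vdm_delta[OF J])
  then show ?thesis by (simp add: U)
qed

text \<open>In the evaluation for \<open>delta J\<close> the stabilizer is trivial and U is 1. The
  hook product of the lowest element is the product of x (1 + 1/x) = x + 1 over all roots, so it
  cancels \<open>root_prod\<close>.\<close>

lemma ev1_pxi_vdm_delta:
  assumes "1 \<le> N" "\<alpha> > 0" and J: "J \<subseteq> {1..N - 1}" and rs: "set rs = run_pairs J" "distinct rs"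
  shows "ev1 (pxi N \<alpha> rs (vdm J)) = real (card (W J)) * eprod N \<alpha> (delta J)"
proof -
  interpret D: prescribed N \<alpha> "{}" J "delta J"
    by (rule prescribed_delta[OF assms(1-3)])
  have st: "stab_card {} (delta J) = 1"
  proof -
    have "{\<sigma> \<in> W {}. act \<sigma> (delta J) = delta J} = {id}" unfolding W_empty by auto
    then show ?thesis by (simp add: stab_card_def)
  qed
  have d: "d_comp N \<alpha> (minus_minus {} J (delta J)) = D.root_prod (delta J)"
  proof -
    have "d_comp N \<alpha> (minus_minus {} J (delta J)) = d_comp N \<alpha> (delta J) *
       (\<Prod>(a, b)\<in>run_pairs J. 1 + 1 / (eta_bar N \<alpha> (delta J) a - eta_bar N \<alpha> (delta J) b))"
      unfolding D.minus_minus_eq by (rule D.d_comp_low) simp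
    also have "\<dots> = (\<Prod>p\<in>run_pairs J. (case p of (a, b) \<Rightarrow> eta_bar N \<alpha> (delta J) a - eta_bar N \<alpha> (delta J) b) *
       (case p of (a, b) \<Rightarrow> 1 + 1 / (eta_bar N \<alpha> (delta J) a - eta_bar N \<alpha> (delta J) b)))"
      unfolding d_comp_delta[OF J] prod.distrib ..
    also have "\<dots> = D.root_prod (delta J)"
      unfolding D.root_prod_def
    proof (rule prod.cong)
      fix p assume p: "p \<in> run_pairs J"
      obtain a b where ab: "p = (a, b)" by force
      have "eta_bar N \<alpha> (delta J) b < eta_bar N \<alpha> (delta J) a"
        using D.eta_bar_root_pos p ab by simp
      then show "(case p of (a, b) \<Rightarrow> eta_bar N \<alpha> (delta J) a - eta_bar N \<alpha> (delta J) b) *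
         (case p of (a, b) \<Rightarrow> 1 + 1 / (eta_bar N \<alpha> (delta J) a - eta_bar N \<alpha> (delta J) b)) =
         (case p of (j, k) \<Rightarrow> eta_bar N \<alpha> (delta J) j - eta_bar N \<alpha> (delta J) k + 1)"
        by (simp add: ab field_simps)
    qed simp
    finally show ?thesis .
  qed
  have "D.root_prod (delta J) \<noteq> 0"
    using d_comp_pos[OF assms(2), of N "minus_minus {} J (delta J)"] d by simp
  then show ?thesis
    using D.evaluation(2)[OF rs] ev1_jack_U_delta[OF assms(1-3)] st d by simp
qed

section \<open>Splitting the group order and the final formula\<close>

lemma same_type_run:
  fixes a b :: nat
  assumes "{a..b} \<subseteq> I \<union> J" "a \<in> I" and adj: "\<And>i. i \<in> I \<Longrightarrow> i + 1 \<notin> J"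
  shows "{a..b} \<subseteq> I"
proof
  fix x assume "x \<in> {a..b}"
  then have "a \<le> x" "x \<le> b" by auto
  then show "x \<in> I"
  proof (induction x rule: dec_induct)
    case (step n)
    then have "Suc n \<in> I \<union> J" using assms(1) by (auto simp: subset_iff)
    then show ?case using step adj[of n] by auto
  qed (rule assms(2))
qed

text \<open>Elements of \<open>I\<close> and \<open>J\<close> are never adjacent, so a maximal run
  of the union is entirely of one type and remains maximal there.\<close>

lemma blocks_Un:
  assumes fin: "finite I" "finite J" and 0: "0 \<notin> I" "0 \<notin> J"
    and adj: "\<And>i. i \<in> I \<Longrightarrow> i - 1 \<notin> J \<and> i + 1 \<notin> J" "\<And>j. j \<in> J \<Longrightarrow> j - 1 \<notin> I \<and> j + 1 \<notin> I"
  shows "blocks (I \<union> J) = blocks I \<union> blocks J"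
proof (intro set_eqI iffI)
  have K: "0 \<notin> I \<union> J" "finite (I \<union> J)" using assms by auto
  fix X
  {
    assume "X \<in> blocks (I \<union> J)"
    then obtain a b where ab: "1 \<le> a" "a \<le> b" "X = {a..b}" "{a..b} \<subseteq> I \<union> J" "a - 1 \<notin> I \<union> J" "Suc b \<notin> I \<union> J"
      using blocks_iff[OF K] by metis
    then have "a \<in> I \<or> a \<in> J" by (auto simp: subset_iff)
    then have "{a..b} \<subseteq> I \<or> {a..b} \<subseteq> J"
      using same_type_run[of a b I J] same_type_run[of a b J I] ab(4) adj by (auto simp: Un_commute)
    moreover have "a - 1 \<notin> I" "a - 1 \<notin> J" "Suc b \<notin> I" "Suc b \<notin> J" using ab by auto
    ultimately show "X \<in> blocks I \<union> blocks J"
      using ab(1-3) unfolding Un_iff blocks_iff[OF 0(1) fin(1)] blocks_iff[OF 0(2) fin(2)] by blast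
  next
    assume "X \<in> blocks I \<union> blocks J"
    then obtain a b where ab: "1 \<le> a" "a \<le> b" "X = {a..b}"
      and or: "({a..b} \<subseteq> I \<and> a - 1 \<notin> I \<and> Suc b \<notin> I) \<or> ({a..b} \<subseteq> J \<and> a - 1 \<notin> J \<and> Suc b \<notin> J)"
      unfolding Un_iff blocks_iff[OF 0(1) fin(1)] blocks_iff[OF 0(2) fin(2)] by blast
    have m: "a \<in> {a..b}" "b \<in> {a..b}" using ab by auto
    have "{a..b} \<subseteq> I \<union> J" "a - 1 \<notin> I \<union> J" "Suc b \<notin> I \<union> J"
      using or m adj[of a] adj[of b] by (auto dest: subsetD)
    then show "X \<in> blocks (I \<union> J)"
      unfolding blocks_iff[OF K] using ab by blast
  }
qed

context prescribed
begin

lemma card_W_K: "card (W K) = card (W I) * card (W J)"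
proof -
  have f: "finite I" "finite J" "0 \<notin> I" "0 \<notin> J"
    using I_sub J_sub finite_subset by auto
  have "blocks I \<inter> blocks J = {}"
  proof (rule ccontr)
    assume "blocks I \<inter> blocks J \<noteq> {}"
    then obtain X where "X \<in> blocks I" "X \<in> blocks J" by blast
    then obtain a b where "a \<le> b" "X = {a..b}" "{a..b} \<subseteq> I" "X \<subseteq> J"
      using blocks_iff[OF f(3,1)] by (auto simp: blocks_def)
    then have "a \<in> I \<inter> J" by (auto simp: subset_iff)
    then show False using disj by simp
  qed
  moreover have "blocks K = blocks I \<union> blocks J"
    by (rule blocks_Un[OF f]) (rule adjI, assumption, rule adjJ, assumption)
  ultimately show ?thesis
    unfolding card_W[OF K_sub] card_W[OF I_sub] card_W[OF J_sub]
    by (simp only:) (intro prod.union_disjoint finite_blocks f)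
qed

end

theorem proposition3p6:
  fixes N :: nat and \<alpha> :: real and I J :: "nat set" and \<eta> :: comp
  assumes "N \<ge> 1" and "\<alpha> > 0"
    and "I \<subseteq> {1..N - 1}" and "J \<subseteq> {1..N - 1}" and "I \<inter> J = {}"
    and "\<And>i. i \<in> I \<Longrightarrow> i - 1 \<notin> J \<and> i + 1 \<notin> J"
    and "\<And>j. j \<in> J \<Longrightarrow> j - 1 \<notin> I \<and> j + 1 \<notin> I"
    and "composition N \<eta>"
    and "\<And>i. i \<in> I \<Longrightarrow> Poly_Mapping.lookup \<eta> i \<ge> Poly_Mapping.lookup \<eta> (i + 1)"
    and "\<And>j. j \<in> J \<Longrightarrow> Poly_Mapping.lookup \<eta> j > Poly_Mapping.lookup \<eta> (j + 1)"
  shows "eval (\<lambda>_. 1) (jack_U N \<alpha> I J \<eta>) =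
    (\<Prod>X\<in>blocks I. fact (card (tilde X))) / real (stab_card I \<eta>) *
    (e_part N \<alpha> (sort_comp N \<eta>) /
      (\<alpha> powi (- int (weight N (delta J))) * e_part N \<alpha> (sort_comp N (delta J)) *
       d_comp N \<alpha> (minus_minus I J \<eta>))) *
    (\<Prod>\<beta>\<in>pos_roots N J. (eta_bar_root N \<alpha> \<eta> \<beta> + 1) / \<alpha>)"
proof -
  interpret prescribed N \<alpha> I J \<eta>
    by (rule prescribed.intro) (fact assms)+
  obtain rs where rs: "set rs = run_pairs J" "distinct rs"
    using finite_distinct_list[OF fin_run_pairs] by blast
  define n where "n = card (run_pairs J)"
  define d where "d = d_comp N \<alpha> (minus_minus I J \<eta>)"
  define M where "M = real (stab_card I \<eta>)"
  define u where "u = ev1 (jack_U N \<alpha> I J \<eta>)"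
  \<comment> \<open>Inserting the value of P on \<open>vdm J\<close>: |W_J| occurs on both sides and
    cancels, leaving |W_I| as the product of factorials and e_\<delta> in the denominator.\<close>
  have "M * (u * (real (card (W J)) * eprod N \<alpha> (delta J))) =
      root_prod \<eta> * real (card (W I) * card (W J)) * (eprod N \<alpha> \<eta> / d)"
    using evaluation(2)[OF rs]
    unfolding ev1_pxi_vdm_delta[OF N1 \<alpha> J_sub rs] card_W_K M_def u_def d_def .
  moreover have "card (W J) > 0"
    using finite_W[OF J_sub] W_id by (metis card_gt_0_iff empty_iff)
  moreover have "M > 0" using stab_card_pos by (simp add: M_def)
  moreover have "eprod N \<alpha> (delta J) > 0" by (rule eprod_pos[OF \<alpha>])
  moreover have "d > 0" unfolding d_def by (rule d_comp_pos[OF \<alpha>])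
  ultimately have u: "u = real (card (W I)) / M * (eprod N \<alpha> \<eta> / (eprod N \<alpha> (delta J) * d)) * root_prod \<eta>"
    by (simp add: field_simps)
  \<comment> \<open>One \<alpha> is divided out per root, and the number of roots is the weight of
    \<open>delta J\<close>; the power of \<alpha> in the denominator of the formula compensates
    exactly.\<close>
  have roots: "(\<Prod>\<beta>\<in>pos_roots N J. (eta_bar_root N \<alpha> \<eta> \<beta> + 1) / \<alpha>) = root_prod \<eta> / \<alpha> ^ n"
    unfolding pos_roots_eq[OF J_sub] prod_dividef root_prod_def n_def
    by (simp add: eta_bar_root_def split_def)
  have "\<alpha> powi (- int (weight N (delta J))) = 1 / \<alpha> ^ n"
    by (simp add: weight_delta[OF J_sub] n_def power_int_minus inverse_eq_divide)
  moreover have "real (card (W I)) = (\<Prod>X\<in>blocks I. fact (card (tilde X)))"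
    unfolding card_W[OF I_sub] by simp
  ultimately show ?thesis
    using u \<alpha> unfolding roots e_part_sort[OF \<alpha>] d_def[symmetric] M_def[symmetric]
    by (simp add: u_def ev1_def)
qed

end
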